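(* Suppose that $T=\bar\Lambda$ and that, for all $\alpha,\beta\in(0,1)$, the tests $\tilde\chi=(\tilde\tau,\tilde d)$, $\hat\chi=(\hat\tau,\hat d)$, $\check\chi=(\check\tau,\check d)$ are designed as described in the context, with the free parameters selected as the minimizers described there. (i) If $\alpha,\beta\to0$ so that $|\log\alpha|\gtrsim|\log\beta|$, then $$\mathsf E_1[\tilde\tau]\sim\mathsf E_1[\hat\tau]\sim\mathsf E_1[\check\tau]\sim\frac{|\log\alpha|}{I_1}\sim\mathcal L_1(\alpha,\beta).$$ (ii) If, in addition, $|\log\alpha|\lesssim|\log\beta|/\beta^r$ for some $r>0$, then $$\mathsf E_0[\hat\tau]\sim\frac{|\log\beta|}{I_0}\sim\mathcal L_0(\alpha,\beta).$$ (iii) If $\alpha,\beta\to0$ so that $|\log\alpha|\gtrsim|\log\beta|$ and, in addition, $|\log\alpha|\lesssim|\log\beta|^r$ for some $r\ge1$, then $$\mathsf E_0[\tilde\tau]\sim\mathsf E_0[\check\tau]\sim\frac{|\log\beta|}{I_0}\sim\mathcal L_0(\alpha,\beta).$$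
   Context: Setting. Let $X=(X_n)_{n\ge1}$ be a sequence of random elements of a measurable space $(\mathbb S,\mathcal S)$ and $\mathcal F_n=\sigma(X_1,\dots,X_n)$. The distribution of $X$ belongs to a family $\mathcal P$; $\mathcal P_0,\mathcal P_1\subset\mathcal P$ are disjoint, $H_i$ is the hypothesis that this distribution is in $\mathcal P_i$, and $\mathsf P_0\in\mathcal P_0$, $\mathsf P_1\in\mathcal P_1$ are fixed, with expectations $\mathsf E_0,\mathsf E_1$. A test is a pair $(\tau,d)$ where $\tau$ is a stopping time of $(\mathcal F_n)_{n\ge1}$ and $d\in\{0,1\}$ is $\mathcal F_\tau$-measurable ($d=i$ means that $H_i$ is selected). For $\alpha,\beta\in(0,1)$, $\mathcal C(\alpha,\beta)$ is the set of tests with $\mathsf P_0(d=1)\le\alpha$ and $\mathsf P_1(d=0)\le\beta$, and $\mathcal L_i(\alpha,\beta)=\inf\{\mathsf E_i[\tau]:(\tau,d)\in\mathcal C(\alpha,\beta)\}$, $i\in\{0,1\}$. Test statistic. $T=(T_n)_{n\ge1}$ is a sequence of real-valued statistics, $T_n$ being $\mathcal F_n$-measurable, such that for all $\alpha,\beta\in(0,1)$ there are $n\in\mathbb N$ and $\kappa\in\mathbb R$ with $\mathsf P_0(T_n>\kappa)\le\alpha$ and $\mathsf P_1(T_n\le\kappa)\le\beta$. The smallest such $n$ is denoted $n^*(\alpha,\beta)$, and $\kappa^*(\alpha,\beta)$ denotes any $\kappa$ satisfying these two inequalities with $n=n^*(\alpha,\beta)$. Standing assumptions. For every $n$, $\mathsf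 P_0$ and $\mathsf P_1$ are mutually absolutely continuous on $\mathcal F_n$; $\Lambda_n=\log\frac{d\mathsf P_1}{d\mathsf P_0}(\mathcal F_n)$, $\bar\Lambda_n=\Lambda_n/n$, $\bar\Lambda=(\bar\Lambda_n)_{n\ge1}$. There are $I_0,I_1\in(0,\infty)$ with $\mathsf P_0(\bar\Lambda_n\to-I_0)=\mathsf P_1(\bar\Lambda_n\to I_1)=1$ and, for every $\epsilon>0$, $\sum_n\mathsf P_0(\bar\Lambda_n>-I_0+\epsilon)+\sum_n\mathsf P_1(\bar\Lambda_n\le I_1-\epsilon)<\infty$. There are reals $J_0<J_1$ with $\mathsf P_0(T_n\to J_0)=\mathsf P_1(T_n\to J_1)=1$ (so $J_0=-I_0$, $J_1=I_1$ when $T=\bar\Lambda$), and convex lower-semicontinuous functions $\psi_0,\psi_1:\mathbb R\to[0,\infty]$, both finite on $[J_0,J_1]$, with $\psi_0(J_0)=0$, $\psi_0$ strictly increasing on $[J_0,J_1]$, $\psi_1(J_1)=0$, $\psi_1$ strictly decreasing on $[J_0,J_1]$, and for every $\kappa\in(J_0,J_1)$: $\lim_n\frac1n\log\mathsf P_0(T_n>\kappa)=-\psi_0(\kappa)$ and $\lim_n\frac1n\log\mathsf P_1(T_n\le\kappa)=-\psi_1(\kappa)$. Multistage tests. All three have parameters: positive integers $n_0,n_1,N$ with $n_0\vee n_1<N$ and reals $\kappa_0\le\kappa_1$ and $K$. The 4-stage test $\hat\chi$ has in addition an integer $N_0$ with $n_0<N_0<N$ and a real $K_0\le\kappa_1$;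 the 4-stage test $\check\chi$ has in addition an integer $N_1$ with $n_1<N_1<N$ and a real $K_1\ge\kappa_0$. The relevant times ($n_0,n_1,N$ for the 3-stage test $\tilde\chi$; $n_0,n_1,N_0,N$ for $\hat\chi$; $n_0,n_1,N_1,N$ for $\check\chi$) are visited in increasing order until a decision is made: at time $n_0$, stop and accept $H_0$ (decision 0) if $T_{n_0}\le\kappa_0$; at time $n_1$, stop and reject $H_0$ (decision 1) if $T_{n_1}>\kappa_1$; for $\hat\chi$, at time $N_0$, stop and accept $H_0$ if $T_{N_0}\le K_0$; for $\check\chi$, at time $N_1$, stop and reject $H_0$ if $T_{N_1}>K_1$; if no decision has been made before, stop at time $N$ and reject $H_0$ iff $T_N>K$. The number of observations used is $\tilde\tau,\hat\tau,\check\tau$, respectively. Design for given $\alpha,\beta\in(0,1)$ (each threshold is the value of $\kappa^*$ at the same arguments as $n^*$ in the corresponding sample size: $\kappa_i$ goes with $n_i$, $K_i$ with $N_i$, $K$ with $N$). - $\tilde\chi$: $n_0=n^*(\gamma,\beta/2)$, $n_1=n^*(\alpha/2,\delta)$, $N=n^*(\alpha/2,\beta/2)$, with free parameters $\gamma\in(\alpha/2,1)$, $\delta\in(\beta/2,1)$. - $\hat\chi$: $n_0=n^*(\gamma,\beta/3)$, $N_0=n^*(\gamma',\beta/3)$, $n_1=n^*(\alpha/2,\delta)$, $N=n^*(\alpha/2,\beta/3)$, with free parameters $\alpha/2<\gamma'<\gamma<1$, $\delta\in(\beta/3,1)$. - $\check\chi$: $n_0=n^*(\gamma,\beta/2)$,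 $n_1=n^*(\alpha/3,\delta)$, $N_1=n^*(\alpha/3,\delta')$, $N=n^*(\alpha/3,\beta/2)$, with free parameters $\gamma\in(\alpha/3,1)$, $\beta/2<\delta'<\delta<1$. Selection of the free parameters (over the ranges just given, for each $\alpha,\beta$). - $\tilde\chi$: $\gamma$ minimizes $n_0+(N-n_0)\gamma$ and $\delta$ minimizes $n_1+(N-n_1)\delta$. - $\hat\chi$: $(\gamma,\gamma')$ minimizes $n_0+(N_0-n_0)\gamma+(N-N_0)\gamma'$ and $\delta$ minimizes $n_1+(N-n_1)\delta$. - $\check\chi$: $\gamma$ minimizes $n_0+(N-n_0)\gamma$ and $(\delta,\delta')$ minimizes $n_1+(N_1-n_1)\delta+(N-N_1)\delta'$. Here $n_0,n_1,N_0,N_1,N$ are the functions of the free parameters given in the design of the respective test. Asymptotic notation. Limits are along arbitrary sequences of $(\alpha,\beta)\in(0,1)^2$ in the stated regime; $x\sim y$ means $x/y\to1$, $x\gtrsim y$ means $\liminf x/y\ge1$, $x\lesssim y$ means $\limsup x/y\le1$. *)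

theory Defs
  imports "HOL-Probability.Probability" "HOL-Library.Landau_Symbols"
begin

text \<open>
  The observations are \<open>X 1, X 2, \<dots>\<close>; the value at index 0 of \<open>X\<close>, of a statistic \<open>T\<close> and of the
  log-likelihood ratios plays no role.  Times are extended naturals, so that stopping times may be
  infinite: \<open>obs_filtration \<Omega> S X (enat n)\<close> is \<open>\<sigma>(X 1, \<dots>, X n)\<close>, and
  \<open>obs_filtration \<Omega> S X \<infinity>\<close> is \<open>\<sigma>(X 1, X 2, \<dots>)\<close>.
\<close>

definition obs_filtration ::
    "'o set \<Rightarrow> 's measure \<Rightarrow> (nat \<Rightarrow> 'o \<Rightarrow> 's) \<Rightarrow> enat \<Rightarrow> 'o measure" where
  "obs_filtration \<Omega> S X t =
     sigma \<Omega> {X i -` A \<inter> \<Omega> | i A. 1 \<le> i \<and> enat i \<le> t \<and> A \<in> sets S}"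

definition obs_law ::
    "'s measure \<Rightarrow> (nat \<Rightarrow> 'o \<Rightarrow> 's) \<Rightarrow> 'o measure \<Rightarrow> (nat \<Rightarrow> 's) measure" where
  "obs_law S X P = distr P (\<Pi>\<^sub>M n\<in>{1..}. S) (\<lambda>\<omega>. \<lambda>n\<in>{1..}. X n \<omega>)"

subsection \<open>Sequential tests\<close>

definition is_test ::
    "'o set \<Rightarrow> (enat \<Rightarrow> 'o measure) \<Rightarrow> ('o \<Rightarrow> enat) \<Rightarrow> ('o \<Rightarrow> nat) \<Rightarrow> bool" where
  "is_test \<Omega> F \<tau> d \<longleftrightarrow>
     stopping_time F \<tau> \<and> (\<forall>\<omega>\<in>\<Omega>. 1 \<le> \<tau> \<omega>) \<and>
     d \<in> filtration.pre_sigma \<Omega> F \<tau> \<rightarrow>\<^sub>M count_space {0, 1}"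

definition test_class ::
    "'o set \<Rightarrow> (enat \<Rightarrow> 'o measure) \<Rightarrow> 'o measure \<Rightarrow> 'o measure \<Rightarrow> real \<Rightarrow> real
      \<Rightarrow> (('o \<Rightarrow> enat) \<times> ('o \<Rightarrow> nat)) set" where
  "test_class \<Omega> F P0 P1 \<alpha> \<beta> =
     {(\<tau>, d). is_test \<Omega> F \<tau> d \<and>
        measure P0 {\<omega> \<in> \<Omega>. d \<omega> = 1} \<le> \<alpha> \<and> measure P1 {\<omega> \<in> \<Omega>. d \<omega> = 0} \<le> \<beta>}"

text \<open>\<open>P\<close> is the measure under which the expectation is taken, i.e. \<open>P0\<close> or \<open>P1\<close>.\<close>

definition optimal_ESS ::
    "'o measure \<Rightarrow> 'o set \<Rightarrow> (enat \<Rightarrow> 'o measure) \<Rightarrow> 'o measure \<Rightarrow> 'o measure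
      \<Rightarrow> real \<Rightarrow> real \<Rightarrow> ennreal" where
  "optimal_ESS P \<Omega> F P0 P1 \<alpha> \<beta> =
     (INF (\<tau>, d)\<in>test_class \<Omega> F P0 P1 \<alpha> \<beta>. \<integral>\<^sup>+\<omega>. ennreal_of_enat (\<tau> \<omega>) \<partial>P)"

subsection \<open>Log-likelihood ratios and rate functions\<close>

text \<open>\<open>L\<close> is an arbitrary \<open>G\<close>-measurable version of \<open>log (dP1/dP0)\<close> on the sub-\<open>\<sigma>\<close>-algebra \<open>G\<close>.\<close>

definition is_LLR ::
    "'o measure \<Rightarrow> 'o measure \<Rightarrow> 'o measure \<Rightarrow> ('o \<Rightarrow> real) \<Rightarrow> bool" where
  "is_LLR P0 P1 G L \<longleftrightarrow>
     L \<in> borel_measurable G \<and>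
     (AE \<omega> in P0. L \<omega> = ln (enn2real (RN_deriv (restr_to_subalg P0 G) (restr_to_subalg P1 G) \<omega>)))"

text \<open>
  Exponential rates are stated with the real logarithm, for which \<open>ln 0 = 0\<close>.  This is harmless: the
  limits \<open>- \<psi> \<kappa>\<close> are finite and negative for \<open>\<kappa>\<close> strictly between \<open>J0\<close> and \<open>J1\<close>, so the
  convergence still forces the probabilities to be eventually positive.
\<close>

definition convex_ennreal :: "(real \<Rightarrow> ennreal) \<Rightarrow> bool" where
  "convex_ennreal \<psi> \<longleftrightarrow>
     (\<forall>x y. \<forall>t\<in>{0..1}. \<psi> ((1 - t) * x + t * y) \<le> ennreal (1 - t) * \<psi> x + ennreal t * \<psi> y)"

definition lsc_ennreal :: "(real \<Rightarrow> ennreal) \<Rightarrow> bool" where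
  "lsc_ennreal \<psi> \<longleftrightarrow> (\<forall>x. \<psi> x \<le> Liminf (at x) \<psi>)"

subsection \<open>Fixed-sample-size design\<close>

definition fss_feasible ::
    "'o measure \<Rightarrow> 'o measure \<Rightarrow> (nat \<Rightarrow> 'o \<Rightarrow> real) \<Rightarrow> real \<Rightarrow> real \<Rightarrow> nat \<Rightarrow> real \<Rightarrow> bool" where
  "fss_feasible P0 P1 T \<alpha> \<beta> n \<kappa> \<longleftrightarrow>
     measure P0 {\<omega> \<in> space P0. T n \<omega> > \<kappa>} \<le> \<alpha> \<and> measure P1 {\<omega> \<in> space P1. T n \<omega> \<le> \<kappa>} \<le> \<beta>"

definition nstar ::
    "'o measure \<Rightarrow> 'o measure \<Rightarrow> (nat \<Rightarrow> 'o \<Rightarrow> real) \<Rightarrow> real \<Rightarrow> real \<Rightarrow> nat" where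
  "nstar P0 P1 T \<alpha> \<beta> = (LEAST n. 1 \<le> n \<and> (\<exists>\<kappa>. fss_feasible P0 P1 T \<alpha> \<beta> n \<kappa>))"

subsection \<open>Multistage tests\<close>

text \<open>
  \<open>A\<close> and \<open>R\<close> are the sets of pairs (time, threshold) of the intermediate acceptance and rejection
  stages, \<open>N\<close> is the time and \<open>K\<close> the threshold of the final stage.  The result is the pair of the
  sample size and the decision.

  No relation between the parameters (such as \<open>n0 < N\<close>, \<open>\<kappa>0 \<le> \<kappa>1\<close>) is built in.  The designs below
  always give \<open>n0, n1, N0, N1 \<le> N\<close>, but equality can occur (e.g. \<open>N = 1\<close> when \<open>\<alpha>\<close> and \<open>\<beta>\<close> are
  close to 1), and the order of the thresholds depends on the choice of \<open>\<kappa>*\<close>.  If an acceptance and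
  a rejection stage at the same time both apply, which \<open>\<kappa>0 \<le> \<kappa>1\<close> excludes, the decision is 0; the
  sample size does not depend on this convention.
\<close>

definition multistage_time ::
    "(nat \<Rightarrow> 'o \<Rightarrow> real) \<Rightarrow> (nat \<times> real) set \<Rightarrow> (nat \<times> real) set \<Rightarrow> nat \<Rightarrow> 'o \<Rightarrow> nat" where
  "multistage_time T A R N \<omega> =
     (LEAST n. (\<exists>c. (n, c) \<in> A \<and> T n \<omega> \<le> c) \<or> (\<exists>c. (n, c) \<in> R \<and> T n \<omega> > c) \<or> n = N)"

definition multistage_test ::
    "(nat \<Rightarrow> 'o \<Rightarrow> real) \<Rightarrow> (nat \<times> real) set \<Rightarrow> (nat \<times> real) set \<Rightarrow> nat \<Rightarrow> real
      \<Rightarrow> ('o \<Rightarrow> nat) \<times> ('o \<Rightarrow> nat)" where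
  "multistage_test T A R N K =
     (multistage_time T A R N,
      \<lambda>\<omega>. let n = multistage_time T A R N \<omega> in
        if \<exists>c. (n, c) \<in> A \<and> T n \<omega> \<le> c then 0
        else if \<exists>c. (n, c) \<in> R \<and> T n \<omega> > c then 1
        else if T N \<omega> > K then 1 else 0)"

text \<open>
  In the designs, \<open>ks\<close> is the threshold function \<open>\<kappa>*\<close>, and \<open>g, g', d, d'\<close> are the free parameters
  \<open>\<gamma>, \<gamma>', \<delta>, \<delta>'\<close>.
\<close>

definition tilde_test ::
    "'o measure \<Rightarrow> 'o measure \<Rightarrow> (nat \<Rightarrow> 'o \<Rightarrow> real) \<Rightarrow> (real \<Rightarrow> real \<Rightarrow> real) \<Rightarrow> real \<Rightarrow> real
      \<Rightarrow> real \<Rightarrow> real \<Rightarrow> ('o \<Rightarrow> nat) \<times> ('o \<Rightarrow> nat)" where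
  "tilde_test P0 P1 T ks \<alpha> \<beta> g d =
     (let n = nstar P0 P1 T in
      multistage_test T
        {(n g (\<beta>/2), ks g (\<beta>/2))}
        {(n (\<alpha>/2) d, ks (\<alpha>/2) d)}
        (n (\<alpha>/2) (\<beta>/2)) (ks (\<alpha>/2) (\<beta>/2)))"

definition hat_test ::
    "'o measure \<Rightarrow> 'o measure \<Rightarrow> (nat \<Rightarrow> 'o \<Rightarrow> real) \<Rightarrow> (real \<Rightarrow> real \<Rightarrow> real) \<Rightarrow> real \<Rightarrow> real
      \<Rightarrow> real \<Rightarrow> real \<Rightarrow> real \<Rightarrow> ('o \<Rightarrow> nat) \<times> ('o \<Rightarrow> nat)" where
  "hat_test P0 P1 T ks \<alpha> \<beta> g g' d =
     (let n = nstar P0 P1 T in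
      multistage_test T
        {(n g (\<beta>/3), ks g (\<beta>/3)), (n g' (\<beta>/3), ks g' (\<beta>/3))}
        {(n (\<alpha>/2) d, ks (\<alpha>/2) d)}
        (n (\<alpha>/2) (\<beta>/3)) (ks (\<alpha>/2) (\<beta>/3)))"

definition check_test ::
    "'o measure \<Rightarrow> 'o measure \<Rightarrow> (nat \<Rightarrow> 'o \<Rightarrow> real) \<Rightarrow> (real \<Rightarrow> real \<Rightarrow> real) \<Rightarrow> real \<Rightarrow> real
      \<Rightarrow> real \<Rightarrow> real \<Rightarrow> real \<Rightarrow> ('o \<Rightarrow> nat) \<times> ('o \<Rightarrow> nat)" where
  "check_test P0 P1 T ks \<alpha> \<beta> g d d' =
     (let n = nstar P0 P1 T in
      multistage_test T
        {(n g (\<beta>/2), ks g (\<beta>/2))}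
        {(n (\<alpha>/3) d, ks (\<alpha>/3) d), (n (\<alpha>/3) d', ks (\<alpha>/3) d')}
        (n (\<alpha>/3) (\<beta>/2)) (ks (\<alpha>/3) (\<beta>/2)))"

definition bound2 :: "nat \<Rightarrow> nat \<Rightarrow> real \<Rightarrow> real" where
  "bound2 n N g = real n + (real N - real n) * g"

definition bound3 :: "nat \<Rightarrow> nat \<Rightarrow> nat \<Rightarrow> real \<Rightarrow> real \<Rightarrow> real" where
  "bound3 n m N g g' = real n + (real m - real n) * g + (real N - real m) * g'"

definition tilde_selected ::
    "'o measure \<Rightarrow> 'o measure \<Rightarrow> (nat \<Rightarrow> 'o \<Rightarrow> real) \<Rightarrow> real \<Rightarrow> real \<Rightarrow> real \<Rightarrow> real \<Rightarrow> bool" where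
  "tilde_selected P0 P1 T \<alpha> \<beta> g d \<longleftrightarrow>
     (let n = nstar P0 P1 T; N = n (\<alpha>/2) (\<beta>/2) in
      is_arg_min (\<lambda>x. bound2 (n x (\<beta>/2)) N x) (\<lambda>x. \<alpha>/2 < x \<and> x < 1) g \<and>
      is_arg_min (\<lambda>y. bound2 (n (\<alpha>/2) y) N y) (\<lambda>y. \<beta>/2 < y \<and> y < 1) d)"

definition hat_selected ::
    "'o measure \<Rightarrow> 'o measure \<Rightarrow> (nat \<Rightarrow> 'o \<Rightarrow> real) \<Rightarrow> real \<Rightarrow> real \<Rightarrow> real \<Rightarrow> real \<Rightarrow> real \<Rightarrow> bool" where
  "hat_selected P0 P1 T \<alpha> \<beta> g g' d \<longleftrightarrow>
     (let n = nstar P0 P1 T; N = n (\<alpha>/2) (\<beta>/3) in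
      is_arg_min (\<lambda>(x, x'). bound3 (n x (\<beta>/3)) (n x' (\<beta>/3)) N x x')
        (\<lambda>(x, x'). \<alpha>/2 < x' \<and> x' < x \<and> x < 1) (g, g') \<and>
      is_arg_min (\<lambda>y. bound2 (n (\<alpha>/2) y) N y) (\<lambda>y. \<beta>/3 < y \<and> y < 1) d)"

definition check_selected ::
    "'o measure \<Rightarrow> 'o measure \<Rightarrow> (nat \<Rightarrow> 'o \<Rightarrow> real) \<Rightarrow> real \<Rightarrow> real \<Rightarrow> real \<Rightarrow> real \<Rightarrow> real \<Rightarrow> bool" where
  "check_selected P0 P1 T \<alpha> \<beta> g d d' \<longleftrightarrow>
     (let n = nstar P0 P1 T; N = n (\<alpha>/3) (\<beta>/2) in
      is_arg_min (\<lambda>x. bound2 (n x (\<beta>/2)) N x) (\<lambda>x. \<alpha>/3 < x \<and> x < 1) g \<and>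
      is_arg_min (\<lambda>(y, y'). bound3 (n (\<alpha>/3) y) (n (\<alpha>/3) y') N y y')
        (\<lambda>(y, y'). \<beta>/2 < y' \<and> y' < y \<and> y < 1) (d, d'))"

definition ESS :: "'o measure \<Rightarrow> ('o \<Rightarrow> nat) \<times> ('o \<Rightarrow> nat) \<Rightarrow> real" where
  "ESS P test = (\<integral>\<omega>. real (fst test \<omega>) \<partial>P)"

subsection \<open>Asymptotic notation\<close>

definition asymp_ge :: "(nat \<Rightarrow> real) \<Rightarrow> (nat \<Rightarrow> real) \<Rightarrow> bool" where
  "asymp_ge x y \<longleftrightarrow> 1 \<le> liminf (\<lambda>k. ereal (x k / y k))"

definition asymp_le :: "(nat \<Rightarrow> real) \<Rightarrow> (nat \<Rightarrow> real) \<Rightarrow> bool" where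
  "asymp_le x y \<longleftrightarrow> limsup (\<lambda>k. ereal (x k / y k)) \<le> 1"

definition regime :: "(nat \<Rightarrow> real) \<Rightarrow> (nat \<Rightarrow> real) \<Rightarrow> bool" where
  "regime a b \<longleftrightarrow>
     (\<forall>k. 0 < a k \<and> a k < 1 \<and> 0 < b k \<and> b k < 1) \<and>
     a \<longlonglongrightarrow> 0 \<and> b \<longlonglongrightarrow> 0 \<and> asymp_ge (\<lambda>k. \<bar>ln (a k)\<bar>) (\<lambda>k. \<bar>ln (b k)\<bar>)"

end

theory Submission
  imports Defs "HOL-Real_Asymp.Real_Asymp"
begin

text \<open>
  The assertion is a squeeze: a lower bound on the expected sample size of every test in the class
  meets an upper bound on that of each multistage test.  As the multistage tests belong to the
  class, the optimal value lies in between.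

  \<^emph>\<open>Lower bound.\<close>  A wrong decision under \<open>P1\<close> has probability at most \<open>\<beta>\<close>.  Suppose that a test
  stops by time \<open>n\<close> with the decision that is correct under \<open>P1\<close>.  Either the log-likelihood ratio
  at time \<open>n\<close> exceeds \<open>n \<rho>\<close>, which is unlikely under \<open>P1\<close> if \<open>\<rho> > I1\<close>, or a change of measure bounds
  the \<open>P1\<close>-probability of this event by
  \<open>exp (n \<rho>)\<close> times the type-I error probability \<open>\<alpha>\<close>.  For \<open>n\<close> slightly below \<open>\<bar>ln \<alpha>\<bar> / \<rho>\<close> this
  product vanishes, so that the test is unlikely to stop by time \<open>n\<close>
  (\<open>test_sample_size_lower_bound\<close>, \<open>lower_asymptotics\<close>).  The argument under \<open>P0\<close> is the same with
  the two measures exchanged.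

  \<^emph>\<open>Upper bound.\<close>  A change of measure also gives \<open>P0 (T n > \<kappa>) \<le> exp (- n \<kappa>)\<close>, whereas
  \<open>P1 (T n \<le> \<kappa>)\<close> decays exponentially for \<open>\<kappa>\<close> strictly between \<open>- I0\<close> and \<open>I1\<close>.
  Therefore, if \<open>0 < \<kappa> < I1\<close>, \<open>n* (t, x)\<close> is at most
  \<open>\<bar>ln t\<bar> / \<kappa> + O(1)\<close>, not merely for a fixed second level \<open>x\<close> but for all \<open>x\<close> down to some power
  \<open>t powr q\<close>; this and the crude bound \<open>O(\<bar>ln t\<bar> + \<bar>ln x\<bar>)\<close> that follows from it are the content of
  the locale \<open>sample_size\<close>.  Under \<open>P1\<close> a test with one rejection stage uses at most
  \<open>n* (\<alpha> / c, \<delta>) + N \<delta>\<close> observations on average, with the final sample size \<open>N = O(\<bar>ln \<alpha>\<bar>)\<close>.  Since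
  the selected parameter is a minimizer, every admissible \<open>\<delta>\<close> gives an upper bound, and
  \<open>\<delta> = \<alpha> powr q + \<beta>\<close> makes the correction \<open>N \<delta>\<close> negligible.

  Under \<open>P0\<close> the leading term is of order \<open>\<bar>ln \<beta>\<bar>\<close>, but \<open>N\<close> is still of order \<open>\<bar>ln \<alpha>\<bar>\<close>, which may be
  much larger.  If \<open>\<bar>ln \<alpha>\<bar>\<close> is at most a power of \<open>\<bar>ln \<beta>\<bar>\<close>, then \<open>\<gamma> = \<beta> powr q + \<alpha>\<close> still makes
  \<open>N \<gamma>\<close> negligible for every \<open>q > 0\<close>, and one acceptance stage suffices.  If \<open>\<bar>ln \<alpha>\<bar>\<close> can be as large
  as \<open>\<bar>ln \<beta>\<bar> / \<beta> powr r\<close>, a level of the order \<open>\<beta> powr (r + 1)\<close> is used in front of \<open>N\<close>.  The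
  corresponding sample size is \<open>O(\<bar>ln \<beta>\<bar>)\<close>, but with a constant that may be too large for a first
  stage.  A second acceptance stage at that time, entered only with probability about
  \<open>\<beta> powr q\<close>, contributes a negligible amount: this is how \<open>hat_test\<close> covers the larger range.
\<close>

section \<open>Sample sizes of logarithmic growth\<close>

lemma levels_at_right_0:
  fixes t :: "nat \<Rightarrow> real"
  assumes "t \<longlonglongrightarrow> 0" "\<And>k. 0 < t k"
  shows "filterlim t (at_right 0) sequentially"
  using assms by (intro tendsto_imp_filterlim_at_right) auto

lemma neg_ln_levels_at_top:
  fixes t :: "nat \<Rightarrow> real"
  assumes "t \<longlonglongrightarrow> 0" "\<And>k. 0 < t k"
  shows "filterlim (\<lambda>k. - ln (t k)) at_top sequentially"
  by (rule filterlim_compose[OF _ levels_at_right_0[OF assms], of "\<lambda>x. - ln x"]) real_asymp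

lemma powr_levels_tendsto_0:
  fixes t :: "nat \<Rightarrow> real"
  assumes "t \<longlonglongrightarrow> 0" "\<And>k. 0 < t k" "0 < p"
  shows "(\<lambda>k. t k powr p) \<longlonglongrightarrow> 0"
  by (rule filterlim_compose[OF _ levels_at_right_0[OF assms(1,2)], of "\<lambda>x. x powr p"])
    (use assms(3) in real_asymp)

text \<open>
  \<open>h t x\<close> stands for \<open>n*\<close> as a function of the level \<open>t\<close> that governs its growth and of the
  companion level \<open>x\<close>.  Growth at speed \<open>1 / I\<close> is required uniformly for companion levels as small
  as a power of \<open>t\<close>; the exponent \<open>q\<close> may shrink as \<open>\<kappa>\<close> approaches \<open>I\<close>.  The two levels of \<open>n*\<close> can
  take either role, so both hypotheses are covered by one argument.
\<close>

locale sample_size =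
  fixes h :: "real \<Rightarrow> real \<Rightarrow> nat" and I :: real
  assumes I_pos: "0 < I"
    and antimono: "\<lbrakk>0 < t; t \<le> t'; t' < 1; 0 < x; x \<le> x'; x' < 1\<rbrakk> \<Longrightarrow> h t' x' \<le> h t x"
    and speed: "\<lbrakk>0 < \<kappa>; \<kappa> < I\<rbrakk> \<Longrightarrow>
      \<exists>q>0. \<exists>B. \<forall>t x. 0 < t \<and> t < 1 \<and> 0 < x \<and> x < 1 \<and> t powr q \<le> x \<longrightarrow> real (h t x) \<le> - ln t / \<kappa> + B"
begin

text \<open>
  Lowering \<open>t\<close> to \<open>t * x powr (1 / q)\<close> makes any companion level \<open>x\<close> admissible in the uniform
  estimate, at the price of a constant factor in front of the logarithms.
\<close>

lemma linear_bound:
  obtains C B where "0 < C" "0 \<le> B"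
    "\<And>t x. \<lbrakk>0 < t; t < 1; 0 < x; x < 1\<rbrakk> \<Longrightarrow> real (h t x) \<le> C * (- ln t - ln x) + B"
proof -
  define \<kappa> where "\<kappa> = I / 2"
  have \<kappa>: "0 < \<kappa>" "\<kappa> < I" using I_pos by (auto simp: \<kappa>_def)
  obtain q B where q: "q > 0" and
    B: "\<And>t x. \<lbrakk>0 < t; t < 1; 0 < x; x < 1; t powr q \<le> x\<rbrakk> \<Longrightarrow> real (h t x) \<le> - ln t / \<kappa> + B"
    using speed[OF \<kappa>] by blast
  define C where "C = (1 + 1 / q) / \<kappa>"
  have C: "0 < C" using q \<kappa> by (simp add: C_def add_pos_pos)
  show thesis
  proof (rule that[of C "max B 0"])
    fix t x :: real assume tx: "0 < t" "t < 1" "0 < x" "x < 1"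
    define t' where "t' = t * x powr (1 / q)"
    have xq: "0 < x powr (1/q)" "x powr (1/q) < 1" using tx q powr_less_mono2[of "1 / q" x 1] by auto
    have t': "0 < t'" "t' \<le> t"
      using tx xq mult_left_le[of "x powr (1/q)" t] by (auto simp: t'_def)
    have "t' < 1" using t' tx by simp
    note t' = t' this
    have "t' powr q = t powr q * x" using tx q by (simp add: t'_def powr_mult powr_powr)
    also have "\<dots> \<le> x" using tx q by (simp add: powr_le1)
    finally have "t' powr q \<le> x" .
    then have 1: "real (h t' x) \<le> - ln t' / \<kappa> + B" using B t' tx by auto
    have "real (h t x) \<le> real (h t' x)" using antimono[of t' t x x] t' tx by auto
    also have "\<dots> \<le> (- ln t - ln x / q) / \<kappa> + B"
      using 1 tx xq by (simp add: t'_def ln_mult ln_powr)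
    also have "\<dots> \<le> C * (- ln t - ln x) + max B 0"
    proof -
      have "- ln t - ln x / q \<le> (1 + 1 / q) * (- ln t - ln x)"
        using tx q divide_nonpos_pos[of "ln t" q] by (simp add: algebra_simps add_nonpos_nonpos)
      then have "(- ln t - ln x / q) / \<kappa> \<le> C * (- ln t - ln x)"
        using \<kappa> by (simp add: C_def divide_right_mono)
      then show ?thesis by simp
    qed
    finally show "real (h t x) \<le> C * (- ln t - ln x) + max B 0" .
  qed (use C in auto)
qed

text \<open>
  The levels \<open>x = t powr q + u\<close> and \<open>x' = t powr s + u\<close> with \<open>q < s\<close> are inserted into the bound on
  \<open>V\<close>: the first stage then has the optimal speed, the middle term is \<open>O(\<bar>ln t\<bar>)\<close> times a vanishing
  level, and the exponent \<open>s\<close> is chosen by the caller to make the last term negligible.  Adding \<open>u\<close>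
  keeps both levels above the lower end \<open>u / d\<close> of the admissible range.
\<close>

lemma three_stage_upper:
  fixes t u V N :: "nat \<Rightarrow> real" and c d s \<epsilon> :: real
  assumes lev: "\<And>k. 0 < t k \<and> t k < 1 \<and> 0 < u k \<and> u k < 1"
    and lim: "t \<longlonglongrightarrow> 0" "u \<longlonglongrightarrow> 0"
    and c: "1 \<le> c" "1 \<le> d" and s: "0 < s"
    and N: "(\<lambda>k. N k * (t k powr s + u k) / - ln (t k)) \<longlonglongrightarrow> 0"
    and V: "\<And>k x x'. \<lbrakk>u k / d < x'; x' < x; x < 1\<rbrakk> \<Longrightarrow>
      V k \<le> real (h (t k / c) x) + real (h (t k / c) x') * x + N k * x'"
    and \<epsilon>: "0 < \<epsilon>"
  shows "\<forall>\<^sub>F k in sequentially. V k \<le> (1 / I + \<epsilon>) * - ln (t k)"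
proof -
  define \<kappa> where "\<kappa> = 1 / (1 / I + \<epsilon> / 2)"
  have \<kappa>: "0 < \<kappa>" "\<kappa> < I" "1 / \<kappa> = 1 / I + \<epsilon> / 2"
    using I_pos \<epsilon> by (auto simp: \<kappa>_def field_simps add_pos_pos)
  obtain q0 B where q0: "q0 > 0" and
    B0: "\<And>t x. \<lbrakk>0 < t; t < 1; 0 < x; x < 1; t powr q0 \<le> x\<rbrakk> \<Longrightarrow> real (h t x) \<le> - ln t / \<kappa> + B"
    using speed[OF \<kappa>(1,2)] by blast
  define q where "q = min q0 (s / 2)"
  have q: "0 < q" "q < s" "q \<le> q0" using q0 s by (auto simp: q_def)
  obtain C B' where C: "0 < C" "0 \<le> B'" and
    C': "\<And>t x. \<lbrakk>0 < t; t < 1; 0 < x; x < 1\<rbrakk> \<Longrightarrow> real (h t x) \<le> C * (- ln t - ln x) + B'"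
    using linear_bound by metis
  define x where "x = (\<lambda>k. t k powr q + u k)"
  define x' where "x' = (\<lambda>k. t k powr s + u k)"
  have U: "filterlim (\<lambda>k. - ln (t k)) at_top sequentially"
    using neg_ln_levels_at_top lim lev by blast
  have pw: "(\<lambda>k. t k powr p) \<longlonglongrightarrow> 0" if "p > 0" for p
    using powr_levels_tendsto_0[OF lim(1) _ that] lev by blast
  have x0: "x \<longlonglongrightarrow> 0" "x' \<longlonglongrightarrow> 0"
    unfolding x_def x'_def using pw lim(2) s q by (auto intro!: tendsto_add_zero)
  have ev1: "\<forall>\<^sub>F k in sequentially. x k < 1" using order_tendstoD(2)[OF x0(1)] by simp
  define W where "W = (\<lambda>k. 1 / \<kappa> + (ln c / \<kappa> + B) / - ln (t k)
     + (C * (1 + s) + (C * ln c + B') / - ln (t k)) * x k + N k * x' k / - ln (t k))"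
  have "W \<longlonglongrightarrow> 1 / \<kappa> + 0 + (C * (1 + s) + 0) * 0 + 0"
    unfolding W_def
    by (intro tendsto_intros x0 N[folded x'_def]
        real_tendsto_divide_at_top[OF tendsto_const U] ) (use N in \<open>simp add: x'_def\<close>)
  then have "W \<longlonglongrightarrow> 1 / I + \<epsilon> / 2" using \<kappa> by simp
  then have ev2: "\<forall>\<^sub>F k in sequentially. W k < 1 / I + \<epsilon>"
    by (rule order_tendstoD) (use \<epsilon> in simp)
  show ?thesis
    using ev1 ev2
  proof eventually_elim
    case (elim k)
    have tk: "0 < t k" "t k < 1" and uk: "0 < u k" "u k < 1" using lev by auto
    have L: "0 < - ln (t k)" using tk by simp
    have tc: "0 < t k / c" "t k / c < 1" "t k / c \<le> t k"
      using tk c mult_left_mono[of 1 c "t k"] by (auto simp: divide_simps)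
    have lt: "t k powr s < t k powr q" using tk q by (simp add: powr_less_mono')
    have xk: "u k / d < x' k" "x' k < x k" "x k < 1"
    proof -
      have "u k / d \<le> u k" using uk c mult_left_mono[of 1 d "u k"] by (simp add: divide_simps)
      also have "\<dots> < x' k" using tk by (simp add: x'_def)
      finally show "u k / d < x' k" .
    qed (use lt elim in \<open>auto simp: x_def x'_def\<close>)
    have x'pos: "0 < x' k" using tk uk by (simp add: x'_def add_pos_pos)
    have xpos: "0 < x k" using xk x'pos by simp
    have "(t k / c) powr q0 \<le> t k powr q0" using tc tk q0 by (intro powr_mono2) auto
    also have "\<dots> \<le> t k powr q" using tk q by (simp add: powr_mono')
    also have "\<dots> \<le> x k" using uk by (simp add: x_def)
    finally have "real (h (t k / c) (x k)) \<le> - ln (t k / c) / \<kappa> + B"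
      using B0 tc xpos xk by auto
    also have "\<dots> = - ln (t k) / \<kappa> + (ln c / \<kappa> + B)"
      using tk c by (simp add: ln_div diff_divide_distrib)
    finally have 1: "real (h (t k / c) (x k)) \<le> - ln (t k) / \<kappa> + (ln c / \<kappa> + B)" .
    have ts: "0 < t k powr s" "t k powr s < 1" using tk s powr_less_mono2[of s "t k" 1] by auto
    have "real (h (t k / c) (x' k)) \<le> real (h (t k / c) (t k powr s))"
      using antimono[of "t k / c" "t k / c" "t k powr s" "x' k"] tc ts xk uk by (auto simp: x'_def)
    also have "\<dots> \<le> C * (- ln (t k / c) - ln (t k powr s)) + B'" using C' tc ts by blast
    also have "\<dots> = C * (1 + s) * - ln (t k) + (C * ln c + B')"
      using tk c by (simp add: ln_div ln_powr algebra_simps)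
    finally have 2: "real (h (t k / c) (x' k)) * x k \<le>
        (C * (1 + s) * - ln (t k) + (C * ln c + B')) * x k"
      using xpos by (intro mult_right_mono) auto
    have "V k \<le> (- ln (t k) / \<kappa> + (ln c / \<kappa> + B))
       + (C * (1 + s) * - ln (t k) + (C * ln c + B')) * x k + N k * x' k"
      using V[OF xk] 1 2 by linarith
    also have "\<dots> = W k * - ln (t k)"
      unfolding W_def using L by (simp add: field_simps)
    also have "\<dots> \<le> (1 / I + \<epsilon>) * - ln (t k)"
      using elim(2) L by (intro mult_right_mono) auto
    finally show ?case .
  qed
qed

text \<open>
  The only level available here must at once be large enough for the optimal speed of the first
  stage and small enough for \<open>N\<close>.  Since \<open>q\<close> depends on \<open>\<epsilon>\<close>, the correction term has to vanish for every
  exponent.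
\<close>

lemma two_stage_upper:
  fixes t u V N :: "nat \<Rightarrow> real" and c d \<epsilon> :: real
  assumes lev: "\<And>k. 0 < t k \<and> t k < 1 \<and> 0 < u k \<and> u k < 1"
    and lim: "t \<longlonglongrightarrow> 0" "u \<longlonglongrightarrow> 0"
    and c: "1 \<le> c" "1 \<le> d"
    and N: "\<And>q. 0 < q \<Longrightarrow> (\<lambda>k. N k * (t k powr q + u k) / - ln (t k)) \<longlonglongrightarrow> 0"
    and V: "\<And>k x. \<lbrakk>u k / d < x; x < 1\<rbrakk> \<Longrightarrow> V k \<le> real (h (t k / c) x) + N k * x"
    and \<epsilon>: "0 < \<epsilon>"
  shows "\<forall>\<^sub>F k in sequentially. V k \<le> (1 / I + \<epsilon>) * - ln (t k)"
proof -
  define \<kappa> where "\<kappa> = 1 / (1 / I + \<epsilon> / 2)"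
  have \<kappa>: "0 < \<kappa>" "\<kappa> < I" "1 / \<kappa> = 1 / I + \<epsilon> / 2"
    using I_pos \<epsilon> by (auto simp: \<kappa>_def field_simps add_pos_pos)
  obtain q B where q: "q > 0" and
    B: "\<And>t x. \<lbrakk>0 < t; t < 1; 0 < x; x < 1; t powr q \<le> x\<rbrakk> \<Longrightarrow> real (h t x) \<le> - ln t / \<kappa> + B"
    using speed[OF \<kappa>(1,2)] by blast
  define x where "x = (\<lambda>k. t k powr q + u k)"
  have U: "filterlim (\<lambda>k. - ln (t k)) at_top sequentially"
    using neg_ln_levels_at_top lim lev by blast
  have "(\<lambda>k. t k powr q) \<longlonglongrightarrow> 0"
    using powr_levels_tendsto_0[OF lim(1) _ q] lev by blast
  then have x0: "x \<longlonglongrightarrow> 0"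
    unfolding x_def using lim(2) by (auto intro!: tendsto_add_zero)
  have ev1: "\<forall>\<^sub>F k in sequentially. x k < 1" using order_tendstoD(2)[OF x0] by simp
  define W where "W = (\<lambda>k. 1 / \<kappa> + (ln c / \<kappa> + B) / - ln (t k) + N k * x k / - ln (t k))"
  have "W \<longlonglongrightarrow> 1 / \<kappa> + 0 + 0"
    unfolding W_def
    by (intro tendsto_intros real_tendsto_divide_at_top[OF tendsto_const U])
       (use N[OF q] in \<open>simp add: x_def\<close>)
  then have "W \<longlonglongrightarrow> 1 / I + \<epsilon> / 2" using \<kappa> by simp
  then have ev2: "\<forall>\<^sub>F k in sequentially. W k < 1 / I + \<epsilon>"
    by (rule order_tendstoD) (use \<epsilon> in simp)
  show ?thesis
    using ev1 ev2
  proof eventually_elim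
    case (elim k)
    have tk: "0 < t k" "t k < 1" and uk: "0 < u k" "u k < 1" using lev by auto
    have L: "0 < - ln (t k)" using tk by simp
    have tc: "0 < t k / c" "t k / c < 1" "t k / c \<le> t k"
      using tk c mult_left_mono[of 1 c "t k"] by (auto simp: divide_simps)
    have "u k / d \<le> u k" using uk c mult_left_mono[of 1 d "u k"] by (simp add: divide_simps)
    also have "\<dots> < x k" using tk by (simp add: x_def)
    finally have xk: "u k / d < x k" .
    have xpos: "0 < x k" using tk uk by (simp add: x_def add_pos_pos)
    have "(t k / c) powr q \<le> t k powr q" using tc tk q by (intro powr_mono2) auto
    also have "\<dots> \<le> x k" using uk by (simp add: x_def)
    finally have "real (h (t k / c) (x k)) \<le> - ln (t k / c) / \<kappa> + B"
      using B tc xpos elim by auto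
    also have "\<dots> = - ln (t k) / \<kappa> + (ln c / \<kappa> + B)"
      using tk c by (simp add: ln_div diff_divide_distrib)
    finally have "V k \<le> - ln (t k) / \<kappa> + (ln c / \<kappa> + B) + N k * x k"
      using V[OF xk] elim by linarith
    also have "\<dots> = W k * - ln (t k)"
      unfolding W_def using L by (simp add: field_simps)
    also have "\<dots> \<le> (1 / I + \<epsilon>) * - ln (t k)"
      using elim(2) L by (intro mult_right_mono) auto
    finally show ?case .
  qed
qed

end

section \<open>Lower asymptotics and the regimes of the error levels\<close>

text \<open>
  With \<open>I < \<rho> < \<rho>'\<close> and \<open>n = \<lfloor>\<bar>ln t\<bar> / \<rho>'\<rfloor>\<close>, the term \<open>exp (n \<rho>) * t\<close> is at most
  \<open>t powr (1 - \<rho> / \<rho>')\<close>, so the bracket tends to 1 while \<open>n / \<bar>ln t\<bar>\<close> tends to \<open>1 / \<rho>'\<close>.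
\<close>

lemma lower_asymptotics:
  fixes t u V :: "nat \<Rightarrow> real" and p :: "real \<Rightarrow> nat \<Rightarrow> real" and I \<epsilon> :: real
  assumes I: "0 < I"
    and t: "\<And>k. 0 < t k" "t \<longlonglongrightarrow> 0" and u: "u \<longlonglongrightarrow> 0"
    and p: "\<And>\<rho>. I < \<rho> \<Longrightarrow> p \<rho> \<longlonglongrightarrow> 0"
    and V: "\<And>k n \<rho>. 1 \<le> n \<Longrightarrow> real n * (1 - u k - exp (real n * \<rho>) * t k - p \<rho> n) \<le> V k"
    and \<epsilon>: "0 < \<epsilon>"
  shows "\<forall>\<^sub>F k in sequentially. (1 / I - \<epsilon>) * - ln (t k) \<le> V k"
proof -
  have "0 < min \<epsilon> (1 / I)" using I \<epsilon> by simp
  then obtain \<delta> where "0 < \<delta>" "\<delta> < min \<epsilon> (1 / I)" using dense by blast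
  then have \<delta>: "0 < \<delta>" "\<delta> < \<epsilon>" "\<delta> < 1 / I" by auto
  define \<rho>' where "\<rho>' = 1 / (1 / I - \<delta>)"
  have \<rho>': "0 < \<rho>'" "I < \<rho>'" "1 / \<rho>' = 1 / I - \<delta>"
    using \<delta> I by (auto simp: \<rho>'_def field_simps)
  define \<rho> where "\<rho> = (I + \<rho>') / 2"
  have \<rho>: "I < \<rho>" "\<rho> < \<rho>'" "0 < \<rho>" using \<rho>' I by (auto simp: \<rho>_def)
  define s where "s = 1 - \<rho> / \<rho>'"
  have s: "0 < s" using \<rho> \<rho>' by (simp add: s_def)
  define n where "n = (\<lambda>k. nat \<lfloor>- ln (t k) / \<rho>'\<rfloor>)"
  have U: "filterlim (\<lambda>k. - ln (t k)) at_top sequentially"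
    using neg_ln_levels_at_top t by blast
  have n_top: "filterlim n at_top sequentially"
  proof -
    have "filterlim (\<lambda>x. nat \<lfloor>x / \<rho>'\<rfloor>) at_top at_top"
      using \<rho>'(1) by real_asymp
    from filterlim_compose[OF this U] show ?thesis by (simp add: n_def)
  qed
  have n_ratio: "(\<lambda>k. real (n k) / - ln (t k)) \<longlonglongrightarrow> 1 / \<rho>'"
  proof -
    have "((\<lambda>x. real (nat \<lfloor>x / \<rho>'\<rfloor>) / x) \<longlongrightarrow> inverse \<rho>') at_top"
      using \<rho>'(1) by real_asymp
    from filterlim_compose[OF this U] show ?thesis by (simp only: n_def inverse_eq_divide)
  qed
  define W where "W = (\<lambda>k. real (n k) / - ln (t k) * (1 - u k - t k powr s - p \<rho> (n k)))"
  have "W \<longlonglongrightarrow> 1 / \<rho>' * (1 - 0 - 0 - 0)"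
    unfolding W_def
    by (intro tendsto_intros n_ratio u powr_levels_tendsto_0[OF t(2,1) s]
        filterlim_compose[OF p[OF \<rho>(1)] n_top])
  then have ev: "\<forall>\<^sub>F k in sequentially. 1 / I - \<epsilon> < W k"
    by (rule order_tendstoD) (use \<rho>' \<delta> in simp)
  have n1: "\<forall>\<^sub>F k in sequentially. 1 \<le> n k"
    using n_top by (auto simp: filterlim_at_top)
  have L1: "\<forall>\<^sub>F k in sequentially. 1 \<le> - ln (t k)"
    using U unfolding filterlim_at_top by blast
  show ?thesis
    using ev n1 L1
  proof eventually_elim
    case (elim k)
    have "real (n k) \<le> - ln (t k) / \<rho>'" 
      unfolding n_def by (rule of_nat_floor) (use elim \<rho>'(1) in \<open>intro divide_nonneg_pos, auto\<close>)
    then have "real (n k) * \<rho> \<le> - ln (t k) / \<rho>' * \<rho>" using \<rho> by (intro mult_right_mono) auto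
    then have "exp (real (n k) * \<rho>) * t k \<le> exp (- ln (t k) / \<rho>' * \<rho>) * t k"
      using t(1)[of k] by (intro mult_right_mono) auto
    also have "\<dots> = t k powr s"
      using t(1)[of k] by (simp add: s_def powr_def left_diff_distrib exp_diff exp_minus field_simps)
    finally have e: "exp (real (n k) * \<rho>) * t k \<le> t k powr s" .
    have "(1 / I - \<epsilon>) * - ln (t k) \<le> W k * - ln (t k)"
      using elim by (intro mult_right_mono) auto
    also have "\<dots> = real (n k) * (1 - u k - t k powr s - p \<rho> (n k))"
      using elim by (simp add: W_def)
    also have "\<dots> \<le> real (n k) * (1 - u k - exp (real (n k) * \<rho>) * t k - p \<rho> (n k))"
      using e by (intro mult_left_mono) auto
    also have "\<dots> \<le> V k" using V elim by blast
    finally show ?case .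
  qed
qed

lemma asymp_equiv_of_bounds:
  fixes U V :: "nat \<Rightarrow> real"
  assumes U: "filterlim U at_top sequentially" and I: "0 < I"
    and upper: "\<And>\<epsilon>. 0 < \<epsilon> \<Longrightarrow> \<forall>\<^sub>F k in sequentially. V k \<le> (1 / I + \<epsilon>) * U k"
    and lower: "\<And>\<epsilon>. 0 < \<epsilon> \<Longrightarrow> \<forall>\<^sub>F k in sequentially. (1 / I - \<epsilon>) * U k \<le> V k"
  shows "V \<sim>[sequentially] (\<lambda>k. U k / I)"
proof -
  have pos: "\<forall>\<^sub>F k in sequentially. 0 < U k"
    using U by (auto simp: filterlim_at_top_dense)
  have "(\<lambda>k. V k / U k) \<longlonglongrightarrow> 1 / I"
  proof (rule tendstoI)
    fix e :: real assume e: "0 < e"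
    then have e2: "0 < e / 2" by simp
    show "\<forall>\<^sub>F k in sequentially. dist (V k / U k) (1 / I) < e"
      using upper[OF e2] lower[OF e2] pos
    proof eventually_elim
      case (elim k)
      then have "V k / U k \<le> 1 / I + e / 2" "1 / I - e / 2 \<le> V k / U k"
        by (simp_all only: pos_divide_le_eq pos_le_divide_eq)
      then show ?case using e unfolding dist_real_def by linarith
    qed
  qed
  from tendsto_mult_right[OF this, of I] have "(\<lambda>k. V k / (U k / I)) \<longlonglongrightarrow> 1"
    using I by (simp add: mult.commute)
  then show ?thesis by (rule asymp_equivI'[rotated 0])
qed

lemma asymp_geD:
  assumes "asymp_ge x y" "c < 1"
  shows "\<forall>\<^sub>F k in sequentially. c < x k / y k"
proof -
  have "ereal c < ereal 1" using assms(2) by simp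
  then have "\<forall>\<^sub>F k in sequentially. ereal c < ereal (x k / y k)"
    using assms(1) unfolding asymp_ge_def le_Liminf_iff one_ereal_def by blast
  then show ?thesis by simp
qed

lemma asymp_leD:
  assumes "asymp_le x y" "1 < c"
  shows "\<forall>\<^sub>F k in sequentially. x k / y k < c"
proof -
  have "ereal 1 < ereal c" using assms(2) by simp
  then have "\<forall>\<^sub>F k in sequentially. ereal (x k / y k) < ereal c"
    using assms(1) unfolding asymp_le_def Limsup_le_iff one_ereal_def by blast
  then show ?thesis by simp
qed

lemma regimeD:
  assumes "regime a b"
  shows "\<And>k. 0 < a k \<and> a k < 1 \<and> 0 < b k \<and> b k < 1" "a \<longlonglongrightarrow> 0" "b \<longlonglongrightarrow> 0"
    and "\<forall>\<^sub>F k in sequentially. - ln (b k) \<le> 2 * - ln (a k)"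
proof -
  show lev: "\<And>k. 0 < a k \<and> a k < 1 \<and> 0 < b k \<and> b k < 1" "a \<longlonglongrightarrow> 0" "b \<longlonglongrightarrow> 0"
    using assms by (auto simp: regime_def)
  have "\<forall>\<^sub>F k in sequentially. 1 / 2 < \<bar>ln (a k)\<bar> / \<bar>ln (b k)\<bar>"
    using assms by (intro asymp_geD) (auto simp: regime_def)
  then show "\<forall>\<^sub>F k in sequentially. - ln (b k) \<le> 2 * - ln (a k)"
  proof eventually_elim
    case (elim k)
    have "ln (a k) < 0" "ln (b k) < 0" using lev(1)[of k] by auto
    then show ?case using elim by (simp add: field_simps)
  qed
qed

text \<open>
  Under \<open>P1\<close> the final sample size is comparable with the leading term, so any vanishing level
  makes the correction negligible.
\<close>

lemma first_stage_correction_vanishes: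
  assumes R: "regime a b" and N: "\<forall>\<^sub>F k in sequentially. real (N k) \<le> C * - ln (a k)" and q: "0 < q"
  shows "(\<lambda>k. real (N k) * (a k powr q + b k) / - ln (a k)) \<longlonglongrightarrow> 0"
proof (rule tendsto_sandwich[OF _ _ tendsto_const])
  note lev = regimeD(1-3)[OF R]
  have "(\<lambda>k. C * (a k powr q + b k)) \<longlonglongrightarrow> C * (0 + 0)"
    using powr_levels_tendsto_0[OF lev(2) _ q] lev by (intro tendsto_intros) auto
  then show "(\<lambda>k. C * (a k powr q + b k)) \<longlonglongrightarrow> 0" by simp
  show "\<forall>\<^sub>F k in sequentially. real (N k) * (a k powr q + b k) / - ln (a k) \<le> C * (a k powr q + b k)"
    using N
  proof eventually_elim
    case (elim k)
    have l: "0 < - ln (a k)" and x: "0 \<le> a k powr q + b k" using lev(1)[of k] by auto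
    have "real (N k) * (a k powr q + b k) \<le> C * (a k powr q + b k) * - ln (a k)"
      using mult_right_mono[OF elim x] by (simp add: algebra_simps)
    then show ?case using l by (simp only: pos_divide_le_eq)
  qed
  show "\<forall>\<^sub>F k in sequentially. 0 \<le> real (N k) * (a k powr q + b k) / - ln (a k)"
  proof (rule always_eventually, rule allI)
    fix k show "0 \<le> real (N k) * (a k powr q + b k) / - ln (a k)"
      using lev(1)[of k] by (intro divide_nonneg_pos mult_nonneg_nonneg add_nonneg_nonneg) auto
  qed
qed

text \<open>
  Under \<open>P0\<close> the part of the correction that comes from the summand \<open>a\<close> vanishes because
  \<open>x * ln x\<close> does at 0; the rest depends on how fast \<open>\<bar>ln a\<bar>\<close> grows relative to \<open>\<bar>ln b\<bar>\<close>.
\<close>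

lemma second_stage_correction_vanishes:
  assumes R: "regime a b" and N: "\<forall>\<^sub>F k in sequentially. real (N k) \<le> C * - ln (a k)" and C: "0 \<le> C"
    and q: "(\<lambda>k. - ln (a k) * b k powr q / - ln (b k)) \<longlonglongrightarrow> 0"
  shows "(\<lambda>k. real (N k) * (b k powr q + a k) / - ln (b k)) \<longlonglongrightarrow> 0"
proof (rule tendsto_sandwich[OF _ _ tendsto_const])
  note lev = regimeD(1-3)[OF R]
  have U: "filterlim (\<lambda>k. - ln (b k)) at_top sequentially"
    using neg_ln_levels_at_top lev by blast
  have "(\<lambda>k. - ln (a k) * a k) \<longlonglongrightarrow> 0"
    by (rule filterlim_compose[OF _ levels_at_right_0[OF lev(2)], of "\<lambda>x. - ln x * x"])
      (use lev in \<open>real_asymp | blast\<close>)+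
  from real_tendsto_divide_at_top[OF this U]
  have "(\<lambda>k. C * (- ln (a k) * b k powr q / - ln (b k) + - ln (a k) * a k / - ln (b k))) \<longlonglongrightarrow> C * (0 + 0)"
    using q by (intro tendsto_intros)
  then show "(\<lambda>k. C * (- ln (a k) * b k powr q / - ln (b k) + - ln (a k) * a k / - ln (b k))) \<longlonglongrightarrow> 0"
    by simp
  show "\<forall>\<^sub>F k in sequentially. real (N k) * (b k powr q + a k) / - ln (b k)
      \<le> C * (- ln (a k) * b k powr q / - ln (b k) + - ln (a k) * a k / - ln (b k))"
    using N
  proof eventually_elim
    case (elim k)
    have l: "0 < - ln (b k)" and x: "0 \<le> b k powr q + a k" using lev(1)[of k] by auto
    have "real (N k) * (b k powr q + a k) / - ln (b k) \<le> C * - ln (a k) * (b k powr q + a k) / - ln (b k)"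
      using mult_right_mono[OF elim x] l by (intro divide_right_mono) auto
    also have "\<dots> = C * (- ln (a k) * b k powr q / - ln (b k) + - ln (a k) * a k / - ln (b k))"
      using l by (simp add: field_simps)
    finally show ?case .
  qed
  show "\<forall>\<^sub>F k in sequentially. 0 \<le> real (N k) * (b k powr q + a k) / - ln (b k)"
  proof (rule always_eventually, rule allI)
    fix k show "0 \<le> real (N k) * (b k powr q + a k) / - ln (b k)"
      using lev(1)[of k] by (intro divide_nonneg_pos mult_nonneg_nonneg add_nonneg_nonneg) auto
  qed
qed

lemma correction_powr_regime:
  assumes R: "regime a b" and r: "0 < r"
    and le: "asymp_le (\<lambda>k. \<bar>ln (a k)\<bar>) (\<lambda>k. \<bar>ln (b k)\<bar> / (b k) powr r)"
  shows "(\<lambda>k. - ln (a k) * b k powr (r + 1) / - ln (b k)) \<longlonglongrightarrow> 0"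
proof (rule tendsto_sandwich[OF _ _ tendsto_const])
  note lev = regimeD(1-3)[OF R]
  have le2: "\<forall>\<^sub>F k in sequentially. \<bar>ln (a k)\<bar> / (\<bar>ln (b k)\<bar> / b k powr r) < 2"
    by (rule asymp_leD[OF le]) simp
  show "(\<lambda>k. 2 * b k) \<longlonglongrightarrow> 0" using tendsto_mult_right[OF lev(3), of 2] by simp
  show "\<forall>\<^sub>F k in sequentially. 0 \<le> - ln (a k) * b k powr (r + 1) / - ln (b k)"
    using lev(1) by (intro always_eventually allI divide_nonneg_pos mult_nonneg_nonneg) (auto intro: less_imp_le)
  show "\<forall>\<^sub>F k in sequentially. - ln (a k) * b k powr (r + 1) / - ln (b k) \<le> 2 * b k"
    using le2
  proof eventually_elim
    case (elim k)
    have l: "0 < - ln (a k)" "0 < - ln (b k)" and b: "0 < b k" using lev(1)[of k] by auto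
    have "\<bar>ln (a k)\<bar> / (\<bar>ln (b k)\<bar> / b k powr r) = - ln (a k) * b k powr r / - ln (b k)"
      using l by (simp add: field_simps)
    with elim have "- ln (a k) * b k powr r / - ln (b k) \<le> 2" by linarith
    then have "(- ln (a k) * b k powr r / - ln (b k)) * b k \<le> 2 * b k"
      using b by (intro mult_right_mono) auto
    then show ?case using b by (simp add: powr_add mult.assoc)
  qed
qed

lemma correction_polylog_regime:
  assumes R: "regime a b" and q: "0 < q"
    and le: "asymp_le (\<lambda>k. \<bar>ln (a k)\<bar>) (\<lambda>k. \<bar>ln (b k)\<bar> powr r)"
  shows "(\<lambda>k. - ln (a k) * b k powr q / - ln (b k)) \<longlonglongrightarrow> 0"
proof (rule tendsto_sandwich[OF _ _ tendsto_const])
  note lev = regimeD(1-3)[OF R]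
  have le2: "\<forall>\<^sub>F k in sequentially. \<bar>ln (a k)\<bar> / \<bar>ln (b k)\<bar> powr r < 2"
    by (rule asymp_leD[OF le]) simp
  have "((\<lambda>x. 2 * (- ln x) powr r * x powr q / - ln x) \<longlongrightarrow> 0) (at_right 0)"
    using q by real_asymp
  from filterlim_compose[OF this levels_at_right_0[OF lev(3)]]
  show "(\<lambda>k. 2 * (- ln (b k)) powr r * b k powr q / - ln (b k)) \<longlonglongrightarrow> 0"
    using lev(1) by blast
  show "\<forall>\<^sub>F k in sequentially. 0 \<le> - ln (a k) * b k powr q / - ln (b k)"
    using lev(1) by (intro always_eventually allI divide_nonneg_pos mult_nonneg_nonneg) (auto intro: less_imp_le)
  show "\<forall>\<^sub>F k in sequentially. - ln (a k) * b k powr q / - ln (b k)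
      \<le> 2 * (- ln (b k)) powr r * b k powr q / - ln (b k)"
    using le2
  proof eventually_elim
    case (elim k)
    have l: "0 < - ln (a k)" "0 < - ln (b k)" using lev(1)[of k] by auto
    then have "- ln (a k) \<le> 2 * (- ln (b k)) powr r"
      using elim by (simp add: field_simps)
    then show ?case using l by (intro divide_right_mono mult_right_mono) auto
  qed
qed

section \<open>Change of measure and the lower bound for arbitrary tests\<close>

text \<open>
  On the event \<open>L \<le> c\<close> the density of \<open>P1\<close> is at most \<open>exp c\<close>, and on \<open>- L \<le> c\<close> it is at least
  \<open>exp (- c)\<close>.  Where the density vanishes, \<open>L = ln 0 = 0\<close> does not reflect its size; this is
  harmless in the first inequality, and in the second one mutual absolute continuity turns the
  zero set of the density into a null set of \<open>P0\<close>.
\<close>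

lemma LLR_change_of_measure:
  assumes P: "prob_space P0" "prob_space P1"
    and sub: "subalgebra P0 G" "subalgebra P1 G"
    and ac: "absolutely_continuous (restr_to_subalg P0 G) (restr_to_subalg P1 G)"
      "absolutely_continuous (restr_to_subalg P1 G) (restr_to_subalg P0 G)"
    and L: "is_LLR P0 P1 G L"
    and A: "A \<in> sets G"
  shows "measure P1 {\<omega> \<in> A. L \<omega> \<le> c} \<le> exp c * measure P0 A"
    and "measure P0 {\<omega> \<in> A. - L \<omega> \<le> c} \<le> exp c * measure P1 A"
proof -
  interpret P0: prob_space P0 by fact
  interpret P1: prob_space P1 by fact
  define R0 where "R0 = restr_to_subalg P0 G"
  define R1 where "R1 = restr_to_subalg P1 G"
  define f where "f = RN_deriv R0 R1"
  interpret R0: prob_space R0 unfolding R0_def by (rule prob_space_restr_to_subalg) fact+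
  interpret R1: prob_space R1 unfolding R1_def by (rule prob_space_restr_to_subalg) fact+
  have setsR: "sets R0 = sets G" "sets R1 = sets G"
    using sub by (auto simp: R0_def R1_def sets_restr_to_subalg)
  have [measurable_cong]: "sets R0 = sets G" by (rule setsR)
  have [measurable]: "A \<in> sets G" by (rule A)
  have emR: "emeasure P0 B = emeasure R0 B" "emeasure P1 B = emeasure R1 B" if "B \<in> sets G" for B
    using that sub by (auto simp: R0_def R1_def emeasure_restr_to_subalg)
  have [measurable]: "L \<in> borel_measurable G" using L by (simp add: is_LLR_def)
  have [measurable]: "f \<in> borel_measurable G"
    using borel_measurable_RN_deriv[of R0 R1] by (simp add: f_def measurable_cong_sets[OF setsR(1) refl])
  have dens: "density R0 f = R1"
    unfolding f_def by (rule R0.density_RN_deriv) (use ac setsR in \<open>auto simp: R0_def R1_def\<close>)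
  have em1: "emeasure R1 B = (\<integral>\<^sup>+\<omega>. f \<omega> * indicator B \<omega> \<partial>R0)" if "B \<in> sets G" for B
    unfolding dens[symmetric] using that setsR by (intro emeasure_density) auto
  have fin: "AE \<omega> in R0. f \<omega> \<noteq> \<infinity>"
    unfolding f_def using ac setsR R1.sigma_finite_measure_axioms
    by (intro R0.RN_deriv_finite) (auto simp: R0_def R1_def)
  have Lf: "AE \<omega> in R0. L \<omega> = ln (enn2real (f \<omega>))"
    unfolding R0_def
    by (rule AE_restr_to_subalg2[OF sub(1)])
      (use L in \<open>simp_all add: is_LLR_def f_def[symmetric] R0_def[symmetric] R1_def[symmetric]\<close>)
  have Asub: "A \<subseteq> space G" using sets.sets_into_space[OF A] .
  have B[measurable]: "{\<omega> \<in> A. L \<omega> \<le> c} \<in> sets G" "{\<omega> \<in> A. - L \<omega> \<le> c} \<in> sets G"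
  proof -
    have "{\<omega> \<in> A. L \<omega> \<le> c} = {\<omega> \<in> space G. \<omega> \<in> A \<and> L \<omega> \<le> c}"
      "{\<omega> \<in> A. - L \<omega> \<le> c} = {\<omega> \<in> space G. \<omega> \<in> A \<and> - L \<omega> \<le> c}" using Asub by auto
    then show "{\<omega> \<in> A. L \<omega> \<le> c} \<in> sets G" "{\<omega> \<in> A. - L \<omega> \<le> c} \<in> sets G" by simp_all
  qed
  have P0A: "emeasure R0 {\<omega> \<in> A. L \<omega> \<le> c} \<le> emeasure P0 A"
    unfolding emR(1)[OF A] using A setsR by (intro emeasure_mono) auto
  have P1A: "emeasure R1 {\<omega> \<in> A. - L \<omega> \<le> c} \<le> emeasure P1 A"
    unfolding emR(2)[OF A] using A setsR by (intro emeasure_mono) auto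
  have "emeasure P1 {\<omega> \<in> A. L \<omega> \<le> c} = (\<integral>\<^sup>+\<omega>. f \<omega> * indicator {\<omega> \<in> A. L \<omega> \<le> c} \<omega> \<partial>R0)"
    by (simp add: emR em1 B)
  also have "\<dots> \<le> (\<integral>\<^sup>+\<omega>. ennreal (exp c) * indicator {\<omega> \<in> A. L \<omega> \<le> c} \<omega> \<partial>R0)"
  proof (rule nn_integral_mono_AE)
    show "AE \<omega> in R0. f \<omega> * indicator {\<omega> \<in> A. L \<omega> \<le> c} \<omega>
        \<le> ennreal (exp c) * indicator {\<omega> \<in> A. L \<omega> \<le> c} \<omega>"
      using fin Lf
    proof eventually_elim
      case (elim \<omega>)
      have "f \<omega> \<le> ennreal (exp c)" if "L \<omega> \<le> c"
      proof -
        have "enn2real (f \<omega>) \<le> exp c"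
        proof (cases "enn2real (f \<omega>) = 0")
          case False
          then have "0 < enn2real (f \<omega>)" using enn2real_nonneg[of "f \<omega>"] by linarith
          then show ?thesis using that elim by (metis exp_le_cancel_iff exp_ln)
        qed simp
        then have "ennreal (enn2real (f \<omega>)) \<le> ennreal (exp c)" by (rule ennreal_leI)
        then show ?thesis using elim by (simp add: less_top)
      qed
      then show ?case by (auto simp: indicator_def)
    qed
  qed
  also have "\<dots> = ennreal (exp c) * emeasure R0 {\<omega> \<in> A. L \<omega> \<le> c}"
    using B setsR by (intro nn_integral_cmult_indicator) auto
  also have "\<dots> \<le> ennreal (exp c) * emeasure P0 A" using P0A by (rule mult_left_mono) simp
  also have "\<dots> = ennreal (exp c * measure P0 A)"
    by (simp add: P0.emeasure_eq_measure ennreal_mult')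
  finally show "measure P1 {\<omega> \<in> A. L \<omega> \<le> c} \<le> exp c * measure P0 A"
    by (simp add: P1.emeasure_eq_measure)
  have pos: "AE \<omega> in R0. f \<omega> \<noteq> 0"
  proof -
    have N: "{\<omega> \<in> space R0. f \<omega> = 0} \<in> sets R0" by simp
    have "emeasure R1 {\<omega> \<in> space R0. f \<omega> = 0} = 
      (\<integral>\<^sup>+\<omega>. f \<omega> * indicator {\<omega> \<in> space R0. f \<omega> = 0} \<omega> \<partial>R0)" using em1 N setsR by simp
    also have "\<dots> = (\<integral>\<^sup>+\<omega>. 0 \<partial>R0)" by (intro nn_integral_cong) (auto simp: indicator_def)
    finally have "{\<omega> \<in> space R0. f \<omega> = 0} \<in> null_sets R1" using N setsR by (simp add: null_setsI)
    then have "{\<omega> \<in> space R0. f \<omega> = 0} \<in> null_sets R0"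
      using ac(2) by (auto simp: absolutely_continuous_def R0_def R1_def)
    then show ?thesis by (rule AE_I') auto
  qed
  have "emeasure P0 {\<omega> \<in> A. - L \<omega> \<le> c} = (\<integral>\<^sup>+\<omega>. indicator {\<omega> \<in> A. - L \<omega> \<le> c} \<omega> \<partial>R0)"
    using B setsR by (simp add: emR)
  also have "\<dots> \<le> (\<integral>\<^sup>+\<omega>. ennreal (exp c) * (f \<omega> * indicator {\<omega> \<in> A. - L \<omega> \<le> c} \<omega>) \<partial>R0)"
  proof (rule nn_integral_mono_AE)
    show "AE \<omega> in R0. (indicator {\<omega> \<in> A. - L \<omega> \<le> c} \<omega> :: ennreal)
        \<le> ennreal (exp c) * (f \<omega> * indicator {\<omega> \<in> A. - L \<omega> \<le> c} \<omega>)"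
      using fin Lf pos
    proof eventually_elim
      case (elim \<omega>)
      have "1 \<le> ennreal (exp c) * f \<omega>" if "- L \<omega> \<le> c"
      proof -
        have p: "0 < enn2real (f \<omega>)" using elim by (simp add: enn2real_positive_iff less_top zero_less_iff_neq_zero)
        have "exp (- c) \<le> exp (L \<omega>)" using that by simp
        also have "\<dots> = enn2real (f \<omega>)" using p elim by simp
        finally have "1 \<le> exp c * enn2real (f \<omega>)" by (simp add: exp_minus field_simps)
        then have "ennreal 1 \<le> ennreal (exp c * enn2real (f \<omega>))" by (rule ennreal_leI)
        also have "\<dots> = ennreal (exp c) * f \<omega>" using elim by (simp add: ennreal_mult' less_top)
        finally show ?thesis by simp
      qed
      then show ?case by (auto simp: indicator_def)
    qed
  qed
  also have "\<dots> = ennreal (exp c) * emeasure R1 {\<omega> \<in> A. - L \<omega> \<le> c}"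
    using B by (subst nn_integral_cmult) (simp_all add: em1)
  also have "\<dots> \<le> ennreal (exp c) * emeasure P1 A" using P1A by (rule mult_left_mono) simp
  also have "\<dots> = ennreal (exp c * measure P1 A)"
    by (simp add: P1.emeasure_eq_measure ennreal_mult')
  finally show "measure P0 {\<omega> \<in> A. - L \<omega> \<le> c} \<le> exp c * measure P1 A"
    by (simp add: P0.emeasure_eq_measure)
qed

text \<open>
  The event that the test stops by time \<open>n\<close> is split according to the decision and to the size of
  the likelihood ratio at the deterministic time \<open>n\<close>.  Both the decision and the stopping are
  determined by then, so the change of measure applies at time \<open>n\<close> itself, and
  convergence in probability of the normalized log-likelihood ratio makes the last term small.  Here \<open>j\<close> is the decision that is
  correct under \<open>Q\<close>, and \<open>P\<close> is the measure under which it is an error.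
\<close>

lemma test_sample_size_lower_bound:
  assumes filt: "filtration \<Omega> (F :: enat \<Rightarrow> 'o measure)"
    and P: "prob_space P" "prob_space Q"
    and space: "space Q = \<Omega>"
    and sub: "\<And>t. sets (F t) \<subseteq> sets Q"
    and change: "\<And>A c. A \<in> sets (F (enat n)) \<Longrightarrow>
      measure Q {\<omega> \<in> A. L \<omega> \<le> c} \<le> exp c * measure P A"
    and L: "L \<in> borel_measurable (F (enat n))"
    and test: "is_test \<Omega> F \<tau> d"
    and j: "{i, j} = {0, 1 :: nat}"
    and err: "measure P {\<omega> \<in> \<Omega>. d \<omega> = j} \<le> x" "measure Q {\<omega> \<in> \<Omega>. d \<omega> = i} \<le> y"
    and subP: "\<And>t. sets (F t) \<subseteq> sets P"
  shows "ennreal (real n * (1 - y - exp c * x - measure Q {\<omega> \<in> \<Omega>. L \<omega> > c}))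
    \<le> (\<integral>\<^sup>+\<omega>. ennreal_of_enat (\<tau> \<omega>) \<partial>Q)"
proof -
  interpret filtration \<Omega> F by fact
  interpret P: prob_space P by fact
  interpret Q: prob_space Q by fact
  have st: "stopping_time F \<tau>" and d: "d \<in> pre_sigma \<tau> \<rightarrow>\<^sub>M count_space {0, 1}"
    using test by (auto simp: is_test_def)
  have dj: "{\<omega> \<in> \<Omega>. d \<omega> = k} \<in> sets (pre_sigma \<tau>)" if "k \<in> {0, 1}" for k
  proof -
    have "d -` {k} \<inter> space (pre_sigma \<tau>) \<in> sets (pre_sigma \<tau>)"
      using that by (intro measurable_sets[OF d]) auto
    also have "d -` {k} \<inter> space (pre_sigma \<tau>) = {\<omega> \<in> \<Omega>. d \<omega> = k}"
      by (auto simp: space_pre_sigma)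
    finally show ?thesis .
  qed
  have d01: "d \<omega> \<in> {i, j}" if "\<omega> \<in> \<Omega>" for \<omega>
    using measurable_space[OF d, of \<omega>] that j by (auto simp: space_pre_sigma)
  have dF: "{\<omega> \<in> \<Omega>. d \<omega> = k} \<in> sets (F \<infinity>)" if "k \<in> {0, 1}" for k
    using sets_pre_sigmaD[OF st dj[OF that], of \<infinity>] by simp
  define E where "E = {\<omega> \<in> {\<omega> \<in> \<Omega>. d \<omega> = j}. \<tau> \<omega> \<le> enat n}"
  have E: "E \<in> sets (F (enat n))" unfolding E_def using j by (intro sets_pre_sigmaD[OF st dj]) auto
  have le: "{\<omega> \<in> \<Omega>. \<tau> \<omega> \<le> enat n} \<in> sets (F (enat n))"
    using stopping_timeD[OF st, of "enat n"] by (simp add: pred_def space_F)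
  have EL: "{\<omega> \<in> E. L \<omega> \<le> c} \<in> sets (F (enat n))" 
  proof -
    have "{\<omega> \<in> E. L \<omega> \<le> c} = {\<omega> \<in> space (F (enat n)). \<omega> \<in> E \<and> L \<omega> \<le> c}"
      using sets.sets_into_space[OF E] by auto
    also have "\<dots> \<in> sets (F (enat n))" using E L by measurable
    finally show ?thesis .
  qed
  have Lc: "{\<omega> \<in> \<Omega>. L \<omega> > c} \<in> sets (F (enat n))"
  proof -
    have "{\<omega> \<in> space (F (enat n)). L \<omega> > c} \<in> sets (F (enat n))" using L by measurable
    then show ?thesis by (simp add: space_F)
  qed
  have ij: "i \<in> {0, 1}" "j \<in> {0, 1}" using j by auto
  have ev: "{\<omega> \<in> \<Omega>. d \<omega> = i} \<in> sets Q" "{\<omega> \<in> E. L \<omega> \<le> c} \<in> sets Q" "{\<omega> \<in> \<Omega>. L \<omega> > c} \<in> sets Q"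
    by (rule subsetD[OF sub], fact dF[OF ij(1)] EL Lc)+
  have "measure Q {\<omega> \<in> \<Omega>. \<tau> \<omega> \<le> enat n}
      \<le> measure Q ({\<omega> \<in> \<Omega>. d \<omega> = i} \<union> ({\<omega> \<in> E. L \<omega> \<le> c} \<union> {\<omega> \<in> \<Omega>. L \<omega> > c}))"
  proof (rule Q.finite_measure_mono)
    show "{\<omega> \<in> \<Omega>. \<tau> \<omega> \<le> enat n} \<subseteq> {\<omega> \<in> \<Omega>. d \<omega> = i} \<union> ({\<omega> \<in> E. L \<omega> \<le> c} \<union> {\<omega> \<in> \<Omega>. L \<omega> > c})"
      using d01 by (fastforce simp: E_def)
  qed (intro sets.Un ev)
  also have "\<dots> \<le> measure Q {\<omega> \<in> \<Omega>. d \<omega> = i} +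
      (measure Q {\<omega> \<in> E. L \<omega> \<le> c} + measure Q {\<omega> \<in> \<Omega>. L \<omega> > c})"
    by (intro order_trans[OF measure_Un_le] add_left_mono measure_Un_le sets.Un ev)
  also have "\<dots> \<le> y + (exp c * x + measure Q {\<omega> \<in> \<Omega>. L \<omega> > c})"
  proof -
    have "measure Q {\<omega> \<in> E. L \<omega> \<le> c} \<le> exp c * measure P E" by (rule change[OF E])
    also have "\<dots> \<le> exp c * measure P {\<omega> \<in> \<Omega>. d \<omega> = j}"
      using subsetD[OF subP dF[OF ij(2)]]
      by (intro mult_left_mono P.finite_measure_mono) (auto simp: E_def)
    also have "\<dots> \<le> exp c * x" using err by simp
    finally show ?thesis using err by linarith
  qed
  finally have 1: "1 - y - exp c * x - measure Q {\<omega> \<in> \<Omega>. L \<omega> > c}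
      \<le> 1 - measure Q {\<omega> \<in> \<Omega>. \<tau> \<omega> \<le> enat n}" by linarith
  have leQ: "{\<omega> \<in> \<Omega>. \<tau> \<omega> \<le> enat n} \<in> sets Q" by (rule subsetD[OF sub le])
  have gt: "{\<omega> \<in> \<Omega>. \<not> \<tau> \<omega> \<le> enat n} \<in> sets Q"
  proof -
    have "{\<omega> \<in> \<Omega>. \<not> \<tau> \<omega> \<le> enat n} = space Q - {\<omega> \<in> \<Omega>. \<tau> \<omega> \<le> enat n}" by (auto simp: space)
    then show ?thesis using sets.compl_sets[OF leQ] by simp
  qed
  have "1 - measure Q {\<omega> \<in> \<Omega>. \<tau> \<omega> \<le> enat n} = measure Q {\<omega> \<in> \<Omega>. \<not> \<tau> \<omega> \<le> enat n}"
    using Q.prob_neg[of "\<lambda>\<omega>. \<tau> \<omega> \<le> enat n"] leQ by (simp add: space)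
  with 1 have "real n * (1 - y - exp c * x - measure Q {\<omega> \<in> \<Omega>. L \<omega> > c})
      \<le> real n * measure Q {\<omega> \<in> \<Omega>. \<not> \<tau> \<omega> \<le> enat n}"
    by (intro mult_left_mono) auto
  then have "ennreal (real n * (1 - y - exp c * x - measure Q {\<omega> \<in> \<Omega>. L \<omega> > c}))
      \<le> ennreal (real n) * emeasure Q {\<omega> \<in> \<Omega>. \<not> \<tau> \<omega> \<le> enat n}"
    unfolding Q.emeasure_eq_measure by (subst ennreal_mult[symmetric]) (auto intro: ennreal_leI)
  also have "\<dots> = (\<integral>\<^sup>+\<omega>. ennreal (real n) * indicator {\<omega> \<in> \<Omega>. \<not> \<tau> \<omega> \<le> enat n} \<omega> \<partial>Q)"
    using gt by (simp add: nn_integral_cmult_indicator)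
  also have "\<dots> \<le> (\<integral>\<^sup>+\<omega>. ennreal_of_enat (\<tau> \<omega>) \<partial>Q)"
  proof (rule nn_integral_mono)
    fix \<omega>
    have "ennreal (real n) \<le> ennreal_of_enat (\<tau> \<omega>)" if "\<not> \<tau> \<omega> \<le> enat n"
    proof -
      have "ennreal (real n) = ennreal_of_enat (enat n)" by (simp add: ennreal_of_nat_eq_real_of_nat)
      also have "\<dots> \<le> ennreal_of_enat (\<tau> \<omega>)" using that by (subst ennreal_of_enat_le_iff) simp
      finally show ?thesis .
    qed
    then show "ennreal (real n) * indicator {\<omega> \<in> \<Omega>. \<not> \<tau> \<omega> \<le> enat n} \<omega> \<le> ennreal_of_enat (\<tau> \<omega>)"
      by (cases "\<omega> \<in> {\<omega> \<in> \<Omega>. \<not> \<tau> \<omega> \<le> enat n}") simp_all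
  qed
  finally show ?thesis .
qed

section \<open>Multistage tests\<close>

definition accepts :: "(nat \<Rightarrow> 'o \<Rightarrow> real) \<Rightarrow> (nat \<times> real) set \<Rightarrow> nat \<Rightarrow> 'o \<Rightarrow> bool" where
  "accepts T A n \<omega> \<longleftrightarrow> (\<exists>c. (n, c) \<in> A \<and> T n \<omega> \<le> c)"

definition rejects :: "(nat \<Rightarrow> 'o \<Rightarrow> real) \<Rightarrow> (nat \<times> real) set \<Rightarrow> nat \<Rightarrow> 'o \<Rightarrow> bool" where
  "rejects T R n \<omega> \<longleftrightarrow> (\<exists>c. (n, c) \<in> R \<and> T n \<omega> > c)"

lemma multistage_time_alt:
  "multistage_time T A R N \<omega> = (LEAST n. accepts T A n \<omega> \<or> rejects T R n \<omega> \<or> n = N)"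
  by (simp add: multistage_time_def accepts_def rejects_def)

lemma multistage_time_le_iff:
  "multistage_time T A R N \<omega> \<le> n \<longleftrightarrow> (\<exists>m\<le>n. accepts T A m \<omega> \<or> rejects T R m \<omega> \<or> m = N)"
proof -
  let ?P = "\<lambda>m. accepts T A m \<omega> \<or> rejects T R m \<omega> \<or> m = N"
  have "?P (Least ?P)" by (rule LeastI[of ?P N]) simp
  then have "Least ?P \<le> n \<Longrightarrow> \<exists>m\<le>n. ?P m" by blast
  moreover have "\<exists>m\<le>n. ?P m \<Longrightarrow> Least ?P \<le> n" using Least_le[of ?P] order_trans by blast
  ultimately show ?thesis unfolding multistage_time_alt by blast
qed

lemma multistage_time_le_N: "multistage_time T A R N \<omega> \<le> N"
  by (auto simp: multistage_time_le_iff)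

lemma multistage_time_stops:
  fixes T A R N \<omega>
  defines "n \<equiv> multistage_time T A R N \<omega>"
  shows "accepts T A n \<omega> \<or> rejects T R n \<omega> \<or> n = N"
  unfolding n_def multistage_time_alt
  by (rule LeastI[of "\<lambda>n. accepts T A n \<omega> \<or> rejects T R n \<omega> \<or> n = N" N]) simp

text \<open>
  The decision as a function of the stage at which the test stops.  The condition \<open>n = N\<close> makes it
  depend on the first \<open>n\<close> observations only, as the measurability of the decision requires.
\<close>

definition stage_decision ::
    "(nat \<Rightarrow> 'o \<Rightarrow> real) \<Rightarrow> (nat \<times> real) set \<Rightarrow> (nat \<times> real) set \<Rightarrow> nat \<Rightarrow> real \<Rightarrow> nat \<Rightarrow> 'o \<Rightarrow> nat" where
  "stage_decision T A R N K n \<omega> =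
     (if accepts T A n \<omega> then 0 else if rejects T R n \<omega> then 1
      else if n = N \<and> T N \<omega> > K then 1 else 0)"

lemma multistage_decision:
  "snd (multistage_test T A R N K) \<omega> = stage_decision T A R N K (multistage_time T A R N \<omega>) \<omega>"
  using multistage_time_stops[of T A R N \<omega>]
  by (auto simp: multistage_test_def stage_decision_def accepts_def rejects_def Let_def)

text \<open>
  The test takes finitely many times, so stopping at \<open>n\<close> and deciding \<open>i\<close> are finite combinations of
  the stage events up to \<open>n\<close>.
\<close>

lemma multistage_is_test:
  fixes F :: "enat \<Rightarrow> 'o measure"
  assumes filt: "filtration \<Omega> F"
    and T: "\<And>n. 1 \<le> n \<Longrightarrow> T n \<in> borel_measurable (F (enat n))"
    and fin: "finite A" "finite R"
    and pos: "\<And>n c. (n, c) \<in> A \<union> R \<Longrightarrow> 1 \<le> n" "1 \<le> N"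
  shows "is_test \<Omega> F (\<lambda>\<omega>. enat (fst (multistage_test T A R N K) \<omega>)) (snd (multistage_test T A R N K))"
proof -
  interpret filtration \<Omega> F by fact
  let ?\<tau> = "multistage_time T A R N"
  let ?d = "snd (multistage_test T A R N K)"
  have sl: "finite {c. (n, c) \<in> A}" "finite {c. (n, c) \<in> R}" for n
    by (rule finite_subset[OF _ finite_imageI[OF fin(1), of snd]], force)
      (rule finite_subset[OF _ finite_imageI[OF fin(2), of snd]], force)
  have lift: "Measurable.pred (F t) P" if "Measurable.pred (F s) P" "s \<le> t" for P s t
    using that sets_F_mono[of s t] by (auto simp: pred_def space_F)
  have acc: "Measurable.pred (F (enat n)) (accepts T A n)" for n
  proof -
    have "Measurable.pred (F (enat n)) (\<lambda>\<omega>. \<exists>c\<in>{c. (n, c) \<in> A}. T n \<omega> \<le> c)"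
    proof (intro pred_intros_finite sl)
      fix c assume "c \<in> {c. (n, c) \<in> A}"
      then have [measurable]: "T n \<in> borel_measurable (F (enat n))" using pos(1)[of n c] T by auto
      show "Measurable.pred (F (enat n)) (\<lambda>\<omega>. T n \<omega> \<le> c)" by measurable
    qed
    moreover have "(\<lambda>\<omega>. \<exists>c\<in>{c. (n, c) \<in> A}. T n \<omega> \<le> c) = accepts T A n"
      by (rule ext) (unfold accepts_def, blast)
    ultimately show ?thesis by (simp only:)
  qed
  have rej: "Measurable.pred (F (enat n)) (rejects T R n)" for n
  proof -
    have "Measurable.pred (F (enat n)) (\<lambda>\<omega>. \<exists>c\<in>{c. (n, c) \<in> R}. c < T n \<omega>)"
    proof (intro pred_intros_finite sl)
      fix c assume "c \<in> {c. (n, c) \<in> R}"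
      then have [measurable]: "T n \<in> borel_measurable (F (enat n))" using pos(1)[of n c] T by auto
      show "Measurable.pred (F (enat n)) (\<lambda>\<omega>. c < T n \<omega>)" by measurable
    qed
    moreover have "(\<lambda>\<omega>. \<exists>c\<in>{c. (n, c) \<in> R}. c < T n \<omega>) = rejects T R n"
      by (rule ext) (unfold rejects_def, blast)
    ultimately show ?thesis by (simp only:)
  qed
  have le: "Measurable.pred (F (enat n)) (\<lambda>\<omega>. ?\<tau> \<omega> \<le> n)" for n
  proof -
    have "Measurable.pred (F (enat n)) (\<lambda>\<omega>. \<exists>m\<in>{..n}. accepts T A m \<omega> \<or> rejects T R m \<omega> \<or> m = N)"
    proof (rule pred_intros_finite)
      fix m assume "m \<in> {..n}"
      then have [measurable]: "Measurable.pred (F (enat n)) (accepts T A m)"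
          "Measurable.pred (F (enat n)) (rejects T R m)"
        using lift[OF acc] lift[OF rej] by auto
      show "Measurable.pred (F (enat n)) (\<lambda>\<omega>. accepts T A m \<omega> \<or> rejects T R m \<omega> \<or> m = N)"
        by measurable
    qed simp
    moreover have "(\<lambda>\<omega>. \<exists>m\<in>{..n}. accepts T A m \<omega> \<or> rejects T R m \<omega> \<or> m = N) = (\<lambda>\<omega>. ?\<tau> \<omega> \<le> n)"
      by (rule ext) (unfold multistage_time_le_iff, blast)
    ultimately show ?thesis by (simp only:)
  qed
  have st: "stopping_time F (\<lambda>\<omega>. enat (?\<tau> \<omega>))"
  proof
    fix t show "Measurable.pred (F t) (\<lambda>\<omega>. enat (?\<tau> \<omega>) \<le> t)"
      by (cases t) (use le in auto)
  qed
  have pos\<tau>: "1 \<le> ?\<tau> \<omega>" for \<omega>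
    using multistage_time_stops[of T A R N \<omega>] pos by (auto simp: accepts_def rejects_def)
  have KN: "Measurable.pred (F (enat n)) (\<lambda>\<omega>. n = N \<and> T N \<omega> > K)" for n
  proof (cases "n = N")
    case True
    have "Measurable.pred (F (enat n)) (\<lambda>\<omega>. K < T n \<omega>)"
    proof -
      have [measurable]: "T n \<in> borel_measurable (F (enat n))" using pos True T[of N] by auto
      show ?thesis by measurable
    qed
    then show ?thesis using True by simp
  qed simp
  have dec: "Measurable.pred (F (enat n)) (\<lambda>\<omega>. stage_decision T A R N K n \<omega> = i)" for n i
  proof -
    have "stage_decision T A R N K n \<in> F (enat n) \<rightarrow>\<^sub>M count_space UNIV"
      unfolding stage_decision_def[abs_def]
      by (intro measurable_If acc[unfolded pred_def] rej[unfolded pred_def] KN[unfolded pred_def])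
        (rule measurable_const, simp)+
    from measurable_compose[OF this, of "\<lambda>k. k = i" "count_space UNIV"]
    show ?thesis by (simp only: measurable_count_space)
  qed
  have eq: "Measurable.pred (F (enat n)) (\<lambda>\<omega>. ?\<tau> \<omega> = n)" for n
  proof (cases n)
    case 0
    then show ?thesis using le[of 0] by (simp only: le_zero_eq)
  next
    case (Suc m)
    have "Measurable.pred (F (enat n)) (\<lambda>\<omega>. ?\<tau> \<omega> \<le> n \<and> \<not> ?\<tau> \<omega> \<le> m)"
    proof -
      have [measurable]: "Measurable.pred (F (enat n)) (\<lambda>\<omega>. ?\<tau> \<omega> \<le> m)"
        by (rule lift[OF le]) (use Suc in simp)
      note [measurable] = le[of n]
      show ?thesis by measurable
    qed
    moreover have "(\<lambda>\<omega>. ?\<tau> \<omega> \<le> n \<and> \<not> ?\<tau> \<omega> \<le> m) = (\<lambda>\<omega>. ?\<tau> \<omega> = n)" using Suc by auto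
    ultimately show ?thesis by simp
  qed
  have "Measurable.pred (pre_sigma (\<lambda>\<omega>. enat (?\<tau> \<omega>))) (\<lambda>\<omega>. ?d \<omega> = i)" for i
  proof (rule pred_pre_sigmaI[OF st])
    fix t
    have "Measurable.pred (F t) (\<lambda>\<omega>. \<exists>n\<in>{n. n \<le> N \<and> enat n \<le> t}.
        ?\<tau> \<omega> = n \<and> stage_decision T A R N K n \<omega> = i)"
    proof (rule pred_intros_finite)
      fix n assume "n \<in> {n. n \<le> N \<and> enat n \<le> t}"
      then show "Measurable.pred (F t) (\<lambda>\<omega>. ?\<tau> \<omega> = n \<and> stage_decision T A R N K n \<omega> = i)"
        using lift[OF eq[of n], of t] lift[OF dec[of n i], of t] by (simp add: pred_intros_logic)
    qed simp
    moreover have "(\<lambda>\<omega>. \<exists>n\<in>{n. n \<le> N \<and> enat n \<le> t}. ?\<tau> \<omega> = n \<and> stage_decision T A R N K n \<omega> = i)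
      = (\<lambda>\<omega>. ?d \<omega> = i \<and> enat (?\<tau> \<omega>) \<le> t)"
      using multistage_time_le_N[of T A R N] by (auto simp: multistage_decision)
    ultimately show "Measurable.pred (F t) (\<lambda>\<omega>. ?d \<omega> = i \<and> enat (?\<tau> \<omega>) \<le> t)" by simp
  qed
  then have "?d -` {i} \<inter> space (pre_sigma (\<lambda>\<omega>. enat (?\<tau> \<omega>)))
      \<in> sets (pre_sigma (\<lambda>\<omega>. enat (?\<tau> \<omega>)))" for i
    by (simp add: pred_def vimage_def Int_def conj_commute)
  moreover have "?d \<omega> \<in> {0, 1}" for \<omega>
    by (auto simp: multistage_decision stage_decision_def)
  ultimately have "?d \<in> pre_sigma (\<lambda>\<omega>. enat (?\<tau> \<omega>)) \<rightarrow>\<^sub>M count_space {0, 1}"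
    by (subst measurable_count_space_eq2) auto
  then show ?thesis
    using st pos\<tau> by (simp add: is_test_def multistage_test_def one_enat_def)
qed

lemma multistage_decision_1:
  assumes "snd (multistage_test T A R N K) \<omega> = 1"
  shows "\<exists>(n, c)\<in>insert (N, K) R. T n \<omega> > c"
  using assms by (auto simp: multistage_decision stage_decision_def rejects_def split: if_splits)

lemma multistage_decision_0:
  assumes "snd (multistage_test T A R N K) \<omega> = 0"
  shows "\<exists>(n, c)\<in>insert (N, K) A. T n \<omega> \<le> c"
  using assms multistage_time_stops[of T A R N \<omega>]
  by (auto simp: multistage_decision stage_decision_def accepts_def not_less split: if_splits)

text \<open>
  An erroneous rejection requires the statistic to exceed its threshold at some rejection stage or
  at the final one, so a union bound over these stages applies.
\<close>

lemma multistage_type1_error: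
  assumes P: "prob_space P"
    and meas: "\<And>n c. (n, c) \<in> insert (N, K) R \<Longrightarrow> {\<omega> \<in> space P. T n \<omega> > c} \<in> sets P"
    and fin: "finite R"
    and err: "\<And>n c. (n, c) \<in> insert (N, K) R \<Longrightarrow> measure P {\<omega> \<in> space P. T n \<omega> > c} \<le> e"
  shows "measure P {\<omega> \<in> space P. snd (multistage_test T A R N K) \<omega> = 1} \<le> real (card (insert (N, K) R)) * e"
proof -
  interpret prob_space P by fact
  let ?S = "\<lambda>(n, c). {\<omega> \<in> space P. T n \<omega> > c}"
  have "measure P {\<omega> \<in> space P. snd (multistage_test T A R N K) \<omega> = 1}
      \<le> measure P (\<Union>s\<in>insert (N, K) R. ?S s)"
  proof (rule finite_measure_mono)
    show "{\<omega> \<in> space P. snd (multistage_test T A R N K) \<omega> = 1} \<subseteq> (\<Union>s\<in>insert (N, K) R. ?S s)"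
      using multistage_decision_1[of T A R N K] by blast
    show "(\<Union>s\<in>insert (N, K) R. ?S s) \<in> sets P"
      using fin meas by (intro sets.finite_UN) auto
  qed
  also have "\<dots> \<le> (\<Sum>s\<in>insert (N, K) R. measure P (?S s))"
    using fin meas by (intro measure_UNION_le) auto
  also have "\<dots> \<le> of_nat (card (insert (N, K) R)) * e"
    using err by (intro sum_bounded_above) auto
  finally show ?thesis .
qed

lemma multistage_type2_error:
  assumes P: "prob_space P"
    and meas: "\<And>n c. (n, c) \<in> insert (N, K) A \<Longrightarrow> {\<omega> \<in> space P. T n \<omega> \<le> c} \<in> sets P"
    and fin: "finite A"
    and err: "\<And>n c. (n, c) \<in> insert (N, K) A \<Longrightarrow> measure P {\<omega> \<in> space P. T n \<omega> \<le> c} \<le> e"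
  shows "measure P {\<omega> \<in> space P. snd (multistage_test T A R N K) \<omega> = 0} \<le> real (card (insert (N, K) A)) * e"
proof -
  interpret prob_space P by fact
  let ?S = "\<lambda>(n, c). {\<omega> \<in> space P. T n \<omega> \<le> c}"
  have "measure P {\<omega> \<in> space P. snd (multistage_test T A R N K) \<omega> = 0}
      \<le> measure P (\<Union>s\<in>insert (N, K) A. ?S s)"
  proof (rule finite_measure_mono)
    show "{\<omega> \<in> space P. snd (multistage_test T A R N K) \<omega> = 0} \<subseteq> (\<Union>s\<in>insert (N, K) A. ?S s)"
      using multistage_decision_0[of T A R N K] by blast
    show "(\<Union>s\<in>insert (N, K) A. ?S s) \<in> sets P"
      using fin meas by (intro sets.finite_UN) auto
  qed
  also have "\<dots> \<le> (\<Sum>s\<in>insert (N, K) A. measure P (?S s))"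
    using fin meas by (intro measure_UNION_le) auto
  also have "\<dots> \<le> of_nat (card (insert (N, K) A)) * e"
    using err by (intro sum_bounded_above) auto
  finally show ?thesis .
qed

lemma multistage_time_measurable:
  assumes test: "is_test \<Omega> F (\<lambda>\<omega>. enat (\<tau> \<omega>)) d"
    and sub: "\<And>t. sets (F t) \<subseteq> sets P" "space P = \<Omega>" "\<And>t. space (F t) = \<Omega>"
  shows "\<tau> \<in> P \<rightarrow>\<^sub>M count_space UNIV"
proof -
  have "\<tau> \<in> borel_measurable P"
  proof (rule borel_measurableI_le)
    fix n
    have "Measurable.pred (F (enat n)) (\<lambda>\<omega>. enat (\<tau> \<omega>) \<le> enat n)"
      using test by (intro stopping_timeD) (simp add: is_test_def)
    then have "{\<omega> \<in> \<Omega>. \<tau> \<omega> \<le> n} \<in> sets (F (enat n))" by (simp add: pred_def sub(3))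
    then show "{\<omega> \<in> space P. \<tau> \<omega> \<le> n} \<in> sets P" using sub by auto
  qed
  then show ?thesis by (simp add: measurable_cong_sets[OF refl sets_borel_eq_count_space])
qed

lemma card_doubleton_triple_le: "card {x, y} \<le> 2" "card {x, y, z} \<le> 3"
  by (auto simp: card_insert_if)

text \<open>
  The sample size is at most \<open>n\<close>, plus \<open>m - n\<close> if the test goes on after \<open>n\<close>, plus \<open>N - m\<close> if it goes
  on after \<open>m\<close>.
\<close>

lemma ESS_le_bound3:
  assumes P: "prob_space P"
    and meas: "fst test \<in> P \<rightarrow>\<^sub>M count_space UNIV"
    and overrun: "measure P {\<omega> \<in> space P. n < fst test \<omega>} \<le> x"
      "measure P {\<omega> \<in> space P. m < fst test \<omega>} \<le> x'"
    and ord: "n \<le> m" "m \<le> N"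
    and le: "\<And>\<omega>. \<omega> \<in> space P \<Longrightarrow> fst test \<omega> \<le> N"
  shows "ESS P test \<le> bound3 n m N x x'"
    and "(\<integral>\<^sup>+\<omega>. ennreal_of_enat (enat (fst test \<omega>)) \<partial>P) = ennreal (ESS P test)"
proof -
  interpret prob_space P by fact
  have bm: "(\<lambda>\<omega>. real (fst test \<omega>)) \<in> borel_measurable P"
    using meas by (rule measurable_compose) simp
  have int: "integrable P (\<lambda>\<omega>. real (fst test \<omega>))"
    by (rule integrable_const_bound[where B="real N"]) (use le bm in \<open>auto intro: AE_I2\<close>)
  then have "(\<integral>\<^sup>+\<omega>. ennreal (real (fst test \<omega>)) \<partial>P) = ennreal (ESS P test)"
    unfolding ESS_def by (rule nn_integral_eq_integral) auto
  then show "(\<integral>\<^sup>+\<omega>. ennreal_of_enat (enat (fst test \<omega>)) \<partial>P) = ennreal (ESS P test)"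
    by (simp add: ennreal_of_nat_eq_real_of_nat)
  define B where "B = (\<lambda>k. {\<omega> \<in> space P. k < fst test \<omega>})"
  have B: "B k \<in> sets P" for k
  proof -
    have "fst test -` {k<..} \<inter> space P \<in> sets P" using meas by (rule measurable_sets) simp
    also have "fst test -` {k<..} \<inter> space P = B k" by (auto simp: B_def)
    finally show ?thesis .
  qed
  have iB: "integrable P (indicat_real (B k))" for k
    using B by (intro integrable_real_indicator) (auto simp: emeasure_eq_measure)
  let ?f = "\<lambda>\<omega>. real n + (real m - real n) * indicator (B n) \<omega> + (real N - real m) * indicator (B m) \<omega>"
  have int': "integrable P ?f"
    by (intro Bochner_Integration.integrable_add integrable_mult_right iB integrable_const)
  have "ESS P test \<le> (\<integral>\<omega>. ?f \<omega> \<partial>P)"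
    unfolding ESS_def
  proof (rule integral_mono[OF int int'])
    fix \<omega> assume \<omega>: "\<omega> \<in> space P"
    then show "real (fst test \<omega>) \<le> ?f \<omega>"
      using le[OF \<omega>] ord by (cases "\<omega> \<in> B n"; cases "\<omega> \<in> B m") (auto simp: B_def)
  qed
  also have "\<dots> = real n + (real m - real n) * measure P (B n) + (real N - real m) * measure P (B m)"
    using B by (simp add: iB prob_space sets.Int_space_eq2)
  also have "\<dots> \<le> bound3 n m N x x'"
    unfolding bound3_def using overrun ord by (intro add_mono mult_left_mono) (auto simp: B_def)
  finally show "ESS P test \<le> bound3 n m N x x'" .
qed

section \<open>The fixed-sample-size design for the log-likelihood ratio\<close>

text \<open>
  With \<open>n\<close> slightly above \<open>\<bar>ln t\<bar> / \<kappa>\<close> the first error is at most \<open>t\<close>, while the second one is at most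
  \<open>exp (- c * n) \<le> t powr (c / \<kappa>)\<close>; this is where the exponent \<open>q = c / \<kappa>\<close> comes from.
\<close>

lemma exponential_speed:
  fixes p r :: "nat \<Rightarrow> real"
  assumes \<kappa>: "0 < \<kappa>" and p: "\<And>n. 1 \<le> n \<Longrightarrow> p n \<le> exp (- \<kappa> * real n)"
    and c: "0 < c" and r: "\<forall>\<^sub>F n in sequentially. r n \<le> exp (- c * real n)"
  shows "\<exists>q>0. \<exists>B. \<forall>t x. 0 < t \<and> t < 1 \<and> 0 < x \<and> x < 1 \<and> t powr q \<le> x \<longrightarrow>
    (\<exists>n\<ge>1. real n \<le> - ln t / \<kappa> + B \<and> p n \<le> t \<and> r n \<le> x)"
proof -
  obtain n0 where n0: "\<And>n. n0 \<le> n \<Longrightarrow> r n \<le> exp (- c * real n)"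
    using r by (auto simp: eventually_sequentially)
  have "\<exists>n\<ge>1. real n \<le> - ln t / \<kappa> + (real n0 + 2) \<and> p n \<le> t \<and> r n \<le> x"
    if tx: "0 < t" "t < 1" "0 < x" "x < 1" "t powr (c / \<kappa>) \<le> x" for t x
  proof -
    define n where "n = n0 + 1 + nat \<lceil>- ln t / \<kappa>\<rceil>"
    have nn: "0 \<le> - ln t / \<kappa>" using tx \<kappa> by (simp add: divide_nonpos_pos)
    have n: "1 \<le> n" "n0 \<le> n" "real n \<le> - ln t / \<kappa> + (real n0 + 2)" "- ln t / \<kappa> \<le> real n"
      using nn by (auto simp: n_def) linarith+
    have "- ln t \<le> \<kappa> * real n" using n(4) \<kappa> by (simp add: field_simps)
    then have "exp (- \<kappa> * real n) \<le> exp (ln t)" by simp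
    then have 1: "p n \<le> t" using p[OF n(1)] tx by simp
    have "c * (- ln t / \<kappa>) \<le> c * real n" using n(4) c by (intro mult_left_mono) auto
    then have "exp (- c * real n) \<le> exp (c / \<kappa> * ln t)" by (simp add: field_simps)
    also have "\<dots> = t powr (c / \<kappa>)" using tx by (simp add: powr_def)
    finally have "r n \<le> x" using n0[OF n(2)] tx by linarith
    with n 1 show ?thesis by blast
  qed
  moreover have "0 < c / \<kappa>" using c \<kappa> by simp
  ultimately show ?thesis by blast
qed

lemma AE_tendsto_prob_gt:
  fixes Y :: "nat \<Rightarrow> 'o \<Rightarrow> real"
  assumes P: "prob_space P" and Y: "\<And>n. 1 \<le> n \<Longrightarrow> Y n \<in> borel_measurable P"
    and lim: "AE \<omega> in P. (\<lambda>n. Y n \<omega>) \<longlonglongrightarrow> l" and l: "l < \<rho>"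
  shows "(\<lambda>n. measure P {\<omega> \<in> space P. \<rho> < Y n \<omega>}) \<longlonglongrightarrow> 0"
proof -
  interpret prob_space P by fact
  let ?A = "\<lambda>n. {\<omega> \<in> space P. \<rho> < Y (Suc n) \<omega>}"
  have [measurable]: "Y (Suc n) \<in> borel_measurable P" for n by (rule Y) simp
  have "(\<lambda>n. \<integral>\<omega>. indicat_real (?A n) \<omega> \<partial>P) \<longlonglongrightarrow> (\<integral>\<omega>. 0 \<partial>P)"
  proof (rule integral_dominated_convergence[where w="\<lambda>_. 1"])
    show "AE \<omega> in P. (\<lambda>n. indicat_real (?A n) \<omega>) \<longlonglongrightarrow> 0"
      using lim
    proof eventually_elim
      case (elim \<omega>)
      have "\<forall>\<^sub>F n in sequentially. Y (Suc n) \<omega> < \<rho>"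
        using order_tendstoD(2)[OF LIMSEQ_Suc[OF elim] l] .
      then have "\<forall>\<^sub>F n in sequentially. indicat_real (?A n) \<omega> = 0"
        by eventually_elim auto
      then show ?case by (rule tendsto_eventually)
    qed
  qed (auto simp: indicator_def)
  then have "(\<lambda>n. measure P (?A n)) \<longlonglongrightarrow> 0" by simp
  then show ?thesis by (subst filterlim_sequentially_Suc[symmetric])
qed

text \<open>
  The facts on which the asymptotic analysis rests: likelihood ratios enter only through
  the two change-of-measure inequalities, and large deviations only through exponential decay of the error
  probabilities for thresholds strictly between \<open>- I0\<close> and \<open>I1\<close>.
\<close>

locale llr_testing =
  fixes \<Omega> :: "'o set" and F :: "enat \<Rightarrow> 'o measure" and P0 P1 :: "'o measure"
    and L T :: "nat \<Rightarrow> 'o \<Rightarrow> real" and I0 I1 :: real and ks :: "real \<Rightarrow> real \<Rightarrow> real"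
  assumes filt: "filtration \<Omega> F"
    and P0: "prob_space P0" and P1: "prob_space P1"
    and space0: "space P0 = \<Omega>" and space1: "space P1 = \<Omega>"
    and sub0: "\<And>t. sets (F t) \<subseteq> sets P0" and sub1: "\<And>t. sets (F t) \<subseteq> sets P1"
    and L_meas: "\<And>n. 1 \<le> n \<Longrightarrow> L n \<in> borel_measurable (F (enat n))"
    and T_meas: "\<And>n. 1 \<le> n \<Longrightarrow> T n \<in> borel_measurable (F (enat n))"
    and T_eq: "\<And>n \<omega>. \<lbrakk>1 \<le> n; \<omega> \<in> \<Omega>\<rbrakk> \<Longrightarrow> T n \<omega> = L n \<omega> / real n"
    and change1: "\<And>n A c. \<lbrakk>1 \<le> n; A \<in> sets (F (enat n))\<rbrakk> \<Longrightarrow>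
      measure P1 {\<omega> \<in> A. L n \<omega> \<le> c} \<le> exp c * measure P0 A"
    and change0: "\<And>n A c. \<lbrakk>1 \<le> n; A \<in> sets (F (enat n))\<rbrakk> \<Longrightarrow>
      measure P0 {\<omega> \<in> A. - L n \<omega> \<le> c} \<le> exp c * measure P1 A"
    and I0_pos: "0 < I0" and I1_pos: "0 < I1"
    and lim0: "AE \<omega> in P0. (\<lambda>n. L n \<omega> / real n) \<longlonglongrightarrow> - I0"
    and lim1: "AE \<omega> in P1. (\<lambda>n. L n \<omega> / real n) \<longlonglongrightarrow> I1"
    and decay0: "\<And>\<kappa>. \<lbrakk>- I0 < \<kappa>; \<kappa> < I1\<rbrakk> \<Longrightarrow>
      \<exists>c>0. \<forall>\<^sub>F n in sequentially. measure P0 {\<omega> \<in> \<Omega>. T n \<omega> > \<kappa>} \<le> exp (- c * real n)"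
    and decay1: "\<And>\<kappa>. \<lbrakk>- I0 < \<kappa>; \<kappa> < I1\<rbrakk> \<Longrightarrow>
      \<exists>c>0. \<forall>\<^sub>F n in sequentially. measure P1 {\<omega> \<in> \<Omega>. T n \<omega> \<le> \<kappa>} \<le> exp (- c * real n)"
    and feasible: "\<And>\<alpha> \<beta>. \<lbrakk>0 < \<alpha>; \<alpha> < 1; 0 < \<beta>; \<beta> < 1\<rbrakk> \<Longrightarrow> \<exists>n\<ge>1. \<exists>\<kappa>. fss_feasible P0 P1 T \<alpha> \<beta> n \<kappa>"
    and threshold: "\<And>\<alpha> \<beta>. \<lbrakk>0 < \<alpha>; \<alpha> < 1; 0 < \<beta>; \<beta> < 1\<rbrakk> \<Longrightarrow>
      fss_feasible P0 P1 T \<alpha> \<beta> (nstar P0 P1 T \<alpha> \<beta>) (ks \<alpha> \<beta>)"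
begin

abbreviation "ns \<equiv> nstar P0 P1 T"

lemma nstar_le: "\<lbrakk>1 \<le> n; fss_feasible P0 P1 T \<alpha> \<beta> n \<kappa>\<rbrakk> \<Longrightarrow> ns \<alpha> \<beta> \<le> n"
  unfolding nstar_def by (rule Least_le) blast

lemma nstar_feasible:
  assumes "0 < \<alpha>" "\<alpha> < 1" "0 < \<beta>" "\<beta> < 1"
  shows "1 \<le> ns \<alpha> \<beta>" "\<exists>\<kappa>. fss_feasible P0 P1 T \<alpha> \<beta> (ns \<alpha> \<beta>) \<kappa>"
  using LeastI_ex[of "\<lambda>n. 1 \<le> n \<and> (\<exists>\<kappa>. fss_feasible P0 P1 T \<alpha> \<beta> n \<kappa>)"] feasible[OF assms]
  unfolding nstar_def by blast+

lemma nstar_antimono: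
  assumes "0 < \<alpha>" "\<alpha> \<le> \<alpha>'" "\<alpha>' < 1" "0 < \<beta>" "\<beta> \<le> \<beta>'" "\<beta>' < 1"
  shows "ns \<alpha>' \<beta>' \<le> ns \<alpha> \<beta>"
proof -
  have ab: "0 < \<alpha>" "\<alpha> < 1" "0 < \<beta>" "\<beta> < 1" using assms by auto
  obtain \<kappa> where "fss_feasible P0 P1 T \<alpha> \<beta> (ns \<alpha> \<beta>) \<kappa>" using nstar_feasible(2)[OF ab] by blast
  then have "fss_feasible P0 P1 T \<alpha>' \<beta>' (ns \<alpha> \<beta>) \<kappa>"
    using assms by (auto simp: fss_feasible_def intro: order_trans)
  then show ?thesis using nstar_feasible(1)[OF ab] by (intro nstar_le)
qed

lemma threshold_errors:
  assumes "0 < \<alpha>" "\<alpha> < 1" "0 < \<beta>" "\<beta> < 1"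
  shows "measure P0 {\<omega> \<in> \<Omega>. T (ns \<alpha> \<beta>) \<omega> > ks \<alpha> \<beta>} \<le> \<alpha>"
    "measure P1 {\<omega> \<in> \<Omega>. T (ns \<alpha> \<beta>) \<omega> \<le> ks \<alpha> \<beta>} \<le> \<beta>"
  using threshold[OF assms] by (auto simp: fss_feasible_def space0 space1)

lemma T_sets:
  assumes "1 \<le> n"
  shows "{\<omega> \<in> \<Omega>. T n \<omega> > \<kappa>} \<in> sets (F (enat n))" "{\<omega> \<in> \<Omega>. T n \<omega> \<le> \<kappa>} \<in> sets (F (enat n))"
proof -
  have *: "\<Omega> = space (F (enat n))" using filt by (simp add: filtration_def)
  note [measurable] = T_meas[OF assms]
  show "{\<omega> \<in> \<Omega>. T n \<omega> > \<kappa>} \<in> sets (F (enat n))" "{\<omega> \<in> \<Omega>. T n \<omega> \<le> \<kappa>} \<in> sets (F (enat n))"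
    unfolding * by measurable
qed

text \<open>
  On this event the log-likelihood ratio exceeds \<open>\<kappa> * n\<close>, and its \<open>P1\<close>-probability is at most 1.
\<close>

lemma T_exceeds_under_P0:
  assumes n: "1 \<le> n"
  shows "measure P0 {\<omega> \<in> \<Omega>. T n \<omega> > \<kappa>} \<le> exp (- \<kappa> * real n)"
proof -
  interpret P1: prob_space P1 by (rule P1)
  let ?A = "{\<omega> \<in> \<Omega>. T n \<omega> > \<kappa>}"
  have "{\<omega> \<in> ?A. - L n \<omega> \<le> - \<kappa> * real n} = ?A" using n by (auto simp: T_eq field_simps)
  then have "measure P0 ?A \<le> exp (- \<kappa> * real n) * measure P1 ?A"
    using change0[OF n T_sets(1)[OF n], of \<kappa> "- \<kappa> * real n"] by simp
  also have "\<dots> \<le> exp (- \<kappa> * real n) * 1" by (intro mult_left_mono P1.prob_le_1) auto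
  finally show ?thesis by simp
qed

lemma T_falls_below_under_P1:
  assumes n: "1 \<le> n"
  shows "measure P1 {\<omega> \<in> \<Omega>. T n \<omega> \<le> - \<kappa>} \<le> exp (- \<kappa> * real n)"
proof -
  interpret P0: prob_space P0 by (rule P0)
  let ?A = "{\<omega> \<in> \<Omega>. T n \<omega> \<le> - \<kappa>}"
  have "{\<omega> \<in> ?A. L n \<omega> \<le> - \<kappa> * real n} = ?A" using n by (auto simp: T_eq field_simps)
  then have "measure P1 ?A \<le> exp (- \<kappa> * real n) * measure P0 ?A"
    using change1[OF n T_sets(2)[OF n], of "- \<kappa>" "- \<kappa> * real n"] by simp
  also have "\<dots> \<le> exp (- \<kappa> * real n) * 1" by (intro mult_left_mono P0.prob_le_1) auto
  finally show ?thesis by simp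
qed

text \<open>
  Under \<open>P1\<close> the type-I level is the leading one and the threshold is taken close to \<open>I1\<close>: a false
  rejection is controlled with the sharp exponent by change of measure, a missed rejection by
  exponential decay with some rate.
\<close>

sublocale S1: sample_size "\<lambda>t x. ns t x" I1
proof
  show "0 < I1" by (rule I1_pos)
  show "ns t' x' \<le> ns t x" if "0 < t" "t \<le> t'" "t' < 1" "0 < x" "x \<le> x'" "x' < 1" for t t' x x'
    using that by (rule nstar_antimono)
  fix \<kappa> assume \<kappa>: "0 < \<kappa>" "\<kappa> < I1"
  then have "- I0 < \<kappa>" using I0_pos by linarith
  then obtain c where c: "0 < c"
    "\<forall>\<^sub>F n in sequentially. measure P1 {\<omega> \<in> \<Omega>. T n \<omega> \<le> \<kappa>} \<le> exp (- c * real n)"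
    using decay1[of \<kappa>] \<kappa> by blast
  from exponential_speed[OF \<kappa>(1) T_exceeds_under_P0 c]
  obtain q B where q: "0 < q" and B: "\<And>t x. 0 < t \<and> t < 1 \<and> 0 < x \<and> x < 1 \<and> t powr q \<le> x \<Longrightarrow>
    \<exists>n\<ge>1. real n \<le> - ln t / \<kappa> + B \<and> measure P0 {\<omega> \<in> \<Omega>. T n \<omega> > \<kappa>} \<le> t
      \<and> measure P1 {\<omega> \<in> \<Omega>. T n \<omega> \<le> \<kappa>} \<le> x" by blast
  have "real (ns t x) \<le> - ln t / \<kappa> + B" if tx: "0 < t \<and> t < 1 \<and> 0 < x \<and> x < 1 \<and> t powr q \<le> x" for t x
  proof -
    obtain n where n: "1 \<le> n" "real n \<le> - ln t / \<kappa> + B"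
      "measure P0 {\<omega> \<in> \<Omega>. T n \<omega> > \<kappa>} \<le> t" "measure P1 {\<omega> \<in> \<Omega>. T n \<omega> \<le> \<kappa>} \<le> x"
      using B[OF tx] by blast
    then have "ns t x \<le> n" by (intro nstar_le[of n t x \<kappa>]) (auto simp: fss_feasible_def space0 space1)
    then show ?thesis using n by linarith
  qed
  with q show "\<exists>q>0. \<exists>B. \<forall>t x. 0 < t \<and> t < 1 \<and> 0 < x \<and> x < 1 \<and> t powr q \<le> x \<longrightarrow>
    real (ns t x) \<le> - ln t / \<kappa> + B" by blast
qed

text \<open>
  Under \<open>P0\<close> the levels exchange their roles, and the threshold is taken close to \<open>- I0\<close>.
\<close>

sublocale S0: sample_size "\<lambda>t x. ns x t" I0
proof
  show "0 < I0" by (rule I0_pos)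
  show "ns x' t' \<le> ns x t" if "0 < t" "t \<le> t'" "t' < 1" "0 < x" "x \<le> x'" "x' < 1" for t t' x x'
    using that(4-6,1-3) by (rule nstar_antimono)
  fix \<kappa> assume \<kappa>: "0 < \<kappa>" "\<kappa> < I0"
  then have "- I0 < - \<kappa>" "- \<kappa> < I1" using I1_pos by linarith+
  then obtain c where c: "0 < c"
    "\<forall>\<^sub>F n in sequentially. measure P0 {\<omega> \<in> \<Omega>. T n \<omega> > - \<kappa>} \<le> exp (- c * real n)"
    using decay0[of "- \<kappa>"] by blast
  from exponential_speed[OF \<kappa>(1) T_falls_below_under_P1 c]
  obtain q B where q: "0 < q" and B: "\<And>t x. 0 < t \<and> t < 1 \<and> 0 < x \<and> x < 1 \<and> t powr q \<le> x \<Longrightarrow>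
    \<exists>n\<ge>1. real n \<le> - ln t / \<kappa> + B \<and> measure P1 {\<omega> \<in> \<Omega>. T n \<omega> \<le> - \<kappa>} \<le> t
      \<and> measure P0 {\<omega> \<in> \<Omega>. T n \<omega> > - \<kappa>} \<le> x" by blast
  have "real (ns x t) \<le> - ln t / \<kappa> + B" if tx: "0 < t \<and> t < 1 \<and> 0 < x \<and> x < 1 \<and> t powr q \<le> x" for t x
  proof -
    obtain n where n: "1 \<le> n" "real n \<le> - ln t / \<kappa> + B"
      "measure P1 {\<omega> \<in> \<Omega>. T n \<omega> \<le> - \<kappa>} \<le> t" "measure P0 {\<omega> \<in> \<Omega>. T n \<omega> > - \<kappa>} \<le> x"
      using B[OF tx] by blast
    then have "ns x t \<le> n" by (intro nstar_le[of n x t "- \<kappa>"]) (auto simp: fss_feasible_def space0 space1)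
    then show ?thesis using n by linarith
  qed
  with q show "\<exists>q>0. \<exists>B. \<forall>t x. 0 < t \<and> t < 1 \<and> 0 < x \<and> x < 1 \<and> t powr q \<le> x \<longrightarrow>
    real (ns x t) \<le> - ln t / \<kappa> + B" by blast
qed

lemma optimal_ESS_lower_bound_1:
  assumes n: "1 \<le> n"
  shows "ennreal (real n * (1 - \<beta> - exp (real n * \<rho>) * \<alpha>
      - measure P1 {\<omega> \<in> \<Omega>. \<rho> < L n \<omega> / real n})) \<le> optimal_ESS P1 \<Omega> F P0 P1 \<alpha> \<beta>"
  unfolding optimal_ESS_def
proof (rule INF_greatest, clarify)
  fix \<tau> d assume "(\<tau>, d) \<in> test_class \<Omega> F P0 P1 \<alpha> \<beta>"
  then have t: "is_test \<Omega> F \<tau> d" "measure P0 {\<omega> \<in> \<Omega>. d \<omega> = 1} \<le> \<alpha>"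
      "measure P1 {\<omega> \<in> \<Omega>. d \<omega> = 0} \<le> \<beta>"
    by (auto simp: test_class_def)
  have "{\<omega> \<in> \<Omega>. \<rho> < L n \<omega> / real n} = {\<omega> \<in> \<Omega>. L n \<omega> > real n * \<rho>}"
    using n by (auto simp: field_simps)
  then show "ennreal (real n * (1 - \<beta> - exp (real n * \<rho>) * \<alpha>
      - measure P1 {\<omega> \<in> \<Omega>. \<rho> < L n \<omega> / real n})) \<le> (\<integral>\<^sup>+\<omega>. ennreal_of_enat (\<tau> \<omega>) \<partial>P1)"
    using test_sample_size_lower_bound[OF filt P0 P1 space1 sub1 change1[OF n] L_meas[OF n] t(1) _ t(2,3) sub0,
        where c="real n * \<rho>"] by simp
qed

lemma optimal_ESS_lower_bound_0:
  assumes n: "1 \<le> n"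
  shows "ennreal (real n * (1 - \<alpha> - exp (real n * \<rho>) * \<beta>
      - measure P0 {\<omega> \<in> \<Omega>. \<rho> < - L n \<omega> / real n})) \<le> optimal_ESS P0 \<Omega> F P0 P1 \<alpha> \<beta>"
  unfolding optimal_ESS_def
proof (rule INF_greatest, clarify)
  fix \<tau> d assume "(\<tau>, d) \<in> test_class \<Omega> F P0 P1 \<alpha> \<beta>"
  then have t: "is_test \<Omega> F \<tau> d" "measure P0 {\<omega> \<in> \<Omega>. d \<omega> = 1} \<le> \<alpha>"
      "measure P1 {\<omega> \<in> \<Omega>. d \<omega> = 0} \<le> \<beta>"
    by (auto simp: test_class_def)
  have "{\<omega> \<in> \<Omega>. \<rho> < - L n \<omega> / real n} = {\<omega> \<in> \<Omega>. - L n \<omega> > real n * \<rho>}"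
    using n by (auto simp: field_simps)
  moreover have "(\<lambda>\<omega>. - L n \<omega>) \<in> borel_measurable (F (enat n))" using L_meas[OF n] by measurable
  moreover have "{1, 0} = {0, 1 :: nat}" by auto
  ultimately show "ennreal (real n * (1 - \<alpha> - exp (real n * \<rho>) * \<beta>
      - measure P0 {\<omega> \<in> \<Omega>. \<rho> < - L n \<omega> / real n})) \<le> (\<integral>\<^sup>+\<omega>. ennreal_of_enat (\<tau> \<omega>) \<partial>P0)"
    using test_sample_size_lower_bound[OF filt P1 P0 space0 sub0 change0[OF n] _ t(1) _ t(3,2) sub1,
        where c="real n * \<rho>"] by simp
qed

end

section \<open>Error probabilities and sample sizes of the three designs\<close>

context llr_testing
begin

lemma space_F: "space (F t) = \<Omega>"
  using filt by (simp add: filtration_def)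

context
  fixes A R :: "(nat \<times> real) set" and N :: nat and K :: real
  assumes fin: "finite A" "finite R"
    and pos: "\<And>n c. (n, c) \<in> A \<union> R \<Longrightarrow> 1 \<le> n" "1 \<le> N"
begin

abbreviation "staged \<equiv> multistage_test T A R N K"

lemma staged_is_test: "is_test \<Omega> F (\<lambda>\<omega>. enat (fst staged \<omega>)) (snd staged)"
  by (rule multistage_is_test[OF filt T_meas fin pos])

lemma staged_time_measurable:
  "fst staged \<in> P0 \<rightarrow>\<^sub>M count_space UNIV" "fst staged \<in> P1 \<rightarrow>\<^sub>M count_space UNIV"
  using multistage_time_measurable[OF staged_is_test sub0 space0 space_F]
    multistage_time_measurable[OF staged_is_test sub1 space1 space_F] by auto

lemma staged_time_le: "fst staged \<omega> \<le> N"
  by (simp add: multistage_test_def multistage_time_le_N)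

lemma staged_in_test_class:
  assumes "card (insert (N, K) R) \<le> i" "real i * e0 \<le> \<alpha>" "0 \<le> e0"
    and e0: "\<And>n c. (n, c) \<in> insert (N, K) R \<Longrightarrow> measure P0 {\<omega> \<in> \<Omega>. T n \<omega> > c} \<le> e0"
    and "card (insert (N, K) A) \<le> j" "real j * e1 \<le> \<beta>" "0 \<le> e1"
    and e1: "\<And>n c. (n, c) \<in> insert (N, K) A \<Longrightarrow> measure P1 {\<omega> \<in> \<Omega>. T n \<omega> \<le> c} \<le> e1"
  shows "(\<lambda>\<omega>. enat (fst staged \<omega>), snd staged) \<in> test_class \<Omega> F P0 P1 \<alpha> \<beta>"
proof -
  have "measure P0 {\<omega> \<in> \<Omega>. snd staged \<omega> = 1} \<le> real (card (insert (N, K) R)) * e0"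
  proof (rule multistage_type1_error[OF P0 _ fin(2), unfolded space0])
    show "{\<omega> \<in> \<Omega>. T n \<omega> > c} \<in> sets P0" if "(n, c) \<in> insert (N, K) R" for n c
      using that pos by (intro subsetD[OF sub0 T_sets(1)]) auto
  qed (rule e0)
  also have "\<dots> \<le> real i * e0" using assms by (intro mult_right_mono) auto
  finally have 1: "measure P0 {\<omega> \<in> \<Omega>. snd staged \<omega> = 1} \<le> \<alpha>" using assms by linarith
  have "measure P1 {\<omega> \<in> \<Omega>. snd staged \<omega> = 0} \<le> real (card (insert (N, K) A)) * e1"
  proof (rule multistage_type2_error[OF P1 _ fin(1), unfolded space1])
    show "{\<omega> \<in> \<Omega>. T n \<omega> \<le> c} \<in> sets P1" if "(n, c) \<in> insert (N, K) A" for n c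
      using that pos by (intro subsetD[OF sub1 T_sets(2)]) auto
  qed (rule e1)
  also have "\<dots> \<le> real j * e1" using assms by (intro mult_right_mono) auto
  finally have "measure P1 {\<omega> \<in> \<Omega>. snd staged \<omega> = 0} \<le> \<beta>" using assms by linarith
  with 1 show ?thesis using staged_is_test by (auto simp: test_class_def)
qed

lemma optimal_ESS_le_staged:
  assumes "(\<lambda>\<omega>. enat (fst staged \<omega>), snd staged) \<in> test_class \<Omega> F P0 P1 \<alpha> \<beta>"
  shows "optimal_ESS P0 \<Omega> F P0 P1 \<alpha> \<beta> \<le> ennreal (ESS P0 staged)"
    and "optimal_ESS P1 \<Omega> F P0 P1 \<alpha> \<beta> \<le> ennreal (ESS P1 staged)"
proof -
  have "optimal_ESS P \<Omega> F P0 P1 \<alpha> \<beta> \<le> (\<integral>\<^sup>+\<omega>. ennreal_of_enat (enat (fst staged \<omega>)) \<partial>P)" for P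
    unfolding optimal_ESS_def by (rule INF_lower2[OF assms]) simp
  moreover have "(\<integral>\<^sup>+\<omega>. ennreal_of_enat (enat (fst staged \<omega>)) \<partial>P0) = ennreal (ESS P0 staged)"
    by (rule ESS_le_bound3(2)[OF P0 staged_time_measurable(1) order_refl order_refl order_refl order_refl])
      (rule staged_time_le)
  moreover have "(\<integral>\<^sup>+\<omega>. ennreal_of_enat (enat (fst staged \<omega>)) \<partial>P1) = ennreal (ESS P1 staged)"
    by (rule ESS_le_bound3(2)[OF P1 staged_time_measurable(2) order_refl order_refl order_refl order_refl])
      (rule staged_time_le)
  ultimately show "optimal_ESS P0 \<Omega> F P0 P1 \<alpha> \<beta> \<le> ennreal (ESS P0 staged)"
    "optimal_ESS P1 \<Omega> F P0 P1 \<alpha> \<beta> \<le> ennreal (ESS P1 staged)" by metis+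
qed

lemma overrun_1:
  assumes nc: "(n, c) \<in> R" and x: "measure P1 {\<omega> \<in> \<Omega>. T n \<omega> \<le> c} \<le> x"
  shows "measure P1 {\<omega> \<in> space P1. n < fst staged \<omega>} \<le> x"
proof -
  interpret P1: prob_space P1 by (rule P1)
  have "fst staged \<omega> \<le> n" if "c < T n \<omega>" for \<omega>
    using that nc by (auto simp: multistage_test_def multistage_time_le_iff rejects_def)
  then have "{\<omega> \<in> space P1. n < fst staged \<omega>} \<subseteq> {\<omega> \<in> \<Omega>. T n \<omega> \<le> c}"
    by (auto simp: space1 not_less[symmetric])
  then have "measure P1 {\<omega> \<in> space P1. n < fst staged \<omega>} \<le> measure P1 {\<omega> \<in> \<Omega>. T n \<omega> \<le> c}"
    using pos(1)[of n c] nc by (intro P1.finite_measure_mono subsetD[OF sub1 T_sets(2)]) auto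
  with x show ?thesis by linarith
qed

lemma overrun_0:
  assumes nc: "(n, c) \<in> A" and x: "measure P0 {\<omega> \<in> \<Omega>. T n \<omega> > c} \<le> x"
  shows "measure P0 {\<omega> \<in> space P0. n < fst staged \<omega>} \<le> x"
proof -
  interpret P0: prob_space P0 by (rule P0)
  have "fst staged \<omega> \<le> n" if "T n \<omega> \<le> c" for \<omega>
    using that nc by (auto simp: multistage_test_def multistage_time_le_iff accepts_def)
  then have "{\<omega> \<in> space P0. n < fst staged \<omega>} \<subseteq> {\<omega> \<in> \<Omega>. T n \<omega> > c}"
    by (auto simp: space0 not_le[symmetric])
  then have "measure P0 {\<omega> \<in> space P0. n < fst staged \<omega>} \<le> measure P0 {\<omega> \<in> \<Omega>. T n \<omega> > c}"
    using pos(1)[of n c] nc by (intro P0.finite_measure_mono subsetD[OF sub0 T_sets(1)]) auto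
  with x show ?thesis by linarith
qed

lemma ESS_1_two_stages:
  assumes "(n, c) \<in> R" "measure P1 {\<omega> \<in> \<Omega>. T n \<omega> \<le> c} \<le> x" "n \<le> N"
  shows "ESS P1 staged \<le> bound2 n N x"
proof -
  have "{\<omega> \<in> space P1. N < fst staged \<omega>} = {}" using staged_time_le by (auto simp: not_less[symmetric])
  then have "measure P1 {\<omega> \<in> space P1. N < fst staged \<omega>} \<le> 0"
    by (simp only: measure_empty)
  then have "ESS P1 staged \<le> bound3 n N N x 0"
    by (rule ESS_le_bound3(1)[OF P1 staged_time_measurable(2) overrun_1[OF assms(1,2)] _ assms(3) order_refl staged_time_le])
  then show ?thesis by (simp add: bound2_def bound3_def)
qed

lemma ESS_0_two_stages:
  assumes "(n, c) \<in> A" "measure P0 {\<omega> \<in> \<Omega>. T n \<omega> > c} \<le> x" "n \<le> N"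
  shows "ESS P0 staged \<le> bound2 n N x"
proof -
  have "{\<omega> \<in> space P0. N < fst staged \<omega>} = {}" using staged_time_le by (auto simp: not_less[symmetric])
  then have "measure P0 {\<omega> \<in> space P0. N < fst staged \<omega>} \<le> 0"
    by (simp only: measure_empty)
  then have "ESS P0 staged \<le> bound3 n N N x 0"
    by (rule ESS_le_bound3(1)[OF P0 staged_time_measurable(1) overrun_0[OF assms(1,2)] _ assms(3) order_refl staged_time_le])
  then show ?thesis by (simp add: bound2_def bound3_def)
qed

lemma ESS_1_three_stages:
  assumes "(n, c) \<in> R" "measure P1 {\<omega> \<in> \<Omega>. T n \<omega> \<le> c} \<le> x"
    and "(m, c') \<in> R" "measure P1 {\<omega> \<in> \<Omega>. T m \<omega> \<le> c'} \<le> x'" "n \<le> m" "m \<le> N"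
  shows "ESS P1 staged \<le> bound3 n m N x x'"
  using assms
  by (intro ESS_le_bound3(1)[OF P1 staged_time_measurable(2) overrun_1 overrun_1] staged_time_le)

lemma ESS_0_three_stages:
  assumes "(n, c) \<in> A" "measure P0 {\<omega> \<in> \<Omega>. T n \<omega> > c} \<le> x"
    and "(m, c') \<in> A" "measure P0 {\<omega> \<in> \<Omega>. T m \<omega> > c'} \<le> x'" "n \<le> m" "m \<le> N"
  shows "ESS P0 staged \<le> bound3 n m N x x'"
  using assms
  by (intro ESS_le_bound3(1)[OF P0 staged_time_measurable(1) overrun_0 overrun_0] staged_time_le)

end

lemma tilde_test_properties:
  assumes ab: "0 < \<alpha>" "\<alpha> < 1" "0 < \<beta>" "\<beta> < 1"
    and g: "\<alpha> / 2 < g" "g < 1" and d: "\<beta> / 2 < d" "d < 1"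
  defines "test \<equiv> tilde_test P0 P1 T ks \<alpha> \<beta> g d" and "N \<equiv> ns (\<alpha> / 2) (\<beta> / 2)"
  shows "optimal_ESS P0 \<Omega> F P0 P1 \<alpha> \<beta> \<le> ennreal (ESS P0 test)"
    and "optimal_ESS P1 \<Omega> F P0 P1 \<alpha> \<beta> \<le> ennreal (ESS P1 test)"
    and "ESS P0 test \<le> bound2 (ns g (\<beta> / 2)) N g"
    and "ESS P1 test \<le> bound2 (ns (\<alpha> / 2) d) N d"
proof -
  have pos: "0 < \<alpha> / 2" "\<alpha> / 2 < 1" "0 < \<beta> / 2" "\<beta> / 2 < 1" "0 < g" "0 < d"
    using ab g d by auto
  let ?A = "{(ns g (\<beta> / 2), ks g (\<beta> / 2))}" and ?R = "{(ns (\<alpha> / 2) d, ks (\<alpha> / 2) d)}"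
  have test: "test = multistage_test T ?A ?R N (ks (\<alpha> / 2) (\<beta> / 2))"
    by (simp add: test_def tilde_test_def N_def Let_def)
  have fin: "finite ?A" "finite ?R" by auto
  have ge1: "1 \<le> n" if "(n, c) \<in> ?A \<union> ?R" for n c
    using that nstar_feasible(1) pos g d by auto
  have N1: "1 \<le> N" unfolding N_def using nstar_feasible(1) pos by blast
  have le: "ns g (\<beta> / 2) \<le> N" "ns (\<alpha> / 2) d \<le> N"
    unfolding N_def using pos g d by (auto intro!: nstar_antimono)
  have cl: "(\<lambda>\<omega>. enat (fst test \<omega>), snd test) \<in> test_class \<Omega> F P0 P1 \<alpha> \<beta>"
    unfolding test
  proof (rule staged_in_test_class[OF fin ge1 N1, where i=2 and j=2 and ?e0.0="\<alpha> / 2" and ?e1.0="\<beta> / 2"])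
    show "measure P0 {\<omega> \<in> \<Omega>. T n \<omega> > c} \<le> \<alpha> / 2" if "(n, c) \<in> insert (N, ks (\<alpha> / 2) (\<beta> / 2)) ?R" for n c
      using that threshold_errors(1) pos g d unfolding N_def by blast
    show "measure P1 {\<omega> \<in> \<Omega>. T n \<omega> \<le> c} \<le> \<beta> / 2" if "(n, c) \<in> insert (N, ks (\<alpha> / 2) (\<beta> / 2)) ?A" for n c
      using that threshold_errors(2) pos g d unfolding N_def by blast
  qed (use pos card_doubleton_triple_le in auto)
  show "optimal_ESS P0 \<Omega> F P0 P1 \<alpha> \<beta> \<le> ennreal (ESS P0 test)"
    "optimal_ESS P1 \<Omega> F P0 P1 \<alpha> \<beta> \<le> ennreal (ESS P1 test)"
    using optimal_ESS_le_staged[OF fin ge1 N1 cl[unfolded test]] unfolding test by auto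
  show "ESS P0 test \<le> bound2 (ns g (\<beta> / 2)) N g"
    unfolding test using threshold_errors(1) pos g
    by (intro ESS_0_two_stages[OF fin ge1 N1 _ _ le(1)]) auto
  show "ESS P1 test \<le> bound2 (ns (\<alpha> / 2) d) N d"
    unfolding test using threshold_errors(2) pos d
    by (intro ESS_1_two_stages[OF fin ge1 N1 _ _ le(2)]) auto
qed

lemma hat_test_properties:
  assumes ab: "0 < \<alpha>" "\<alpha> < 1" "0 < \<beta>" "\<beta> < 1"
    and g: "\<alpha> / 2 < g'" "g' < g" "g < 1" and d: "\<beta> / 3 < d" "d < 1"
  defines "test \<equiv> hat_test P0 P1 T ks \<alpha> \<beta> g g' d" and "N \<equiv> ns (\<alpha> / 2) (\<beta> / 3)"
  shows "optimal_ESS P0 \<Omega> F P0 P1 \<alpha> \<beta> \<le> ennreal (ESS P0 test)"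
    and "optimal_ESS P1 \<Omega> F P0 P1 \<alpha> \<beta> \<le> ennreal (ESS P1 test)"
    and "ESS P0 test \<le> bound3 (ns g (\<beta> / 3)) (ns g' (\<beta> / 3)) N g g'"
    and "ESS P1 test \<le> bound2 (ns (\<alpha> / 2) d) N d"
proof -
  have pos: "0 < \<alpha> / 2" "\<alpha> / 2 < 1" "0 < \<beta> / 3" "\<beta> / 3 < 1" "0 < g" "0 < g'" "g' < 1" "0 < d"
    using ab g d by auto
  let ?A = "{(ns g (\<beta> / 3), ks g (\<beta> / 3)), (ns g' (\<beta> / 3), ks g' (\<beta> / 3))}"
    and ?R = "{(ns (\<alpha> / 2) d, ks (\<alpha> / 2) d)}"
  have test: "test = multistage_test T ?A ?R N (ks (\<alpha> / 2) (\<beta> / 3))"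
    by (simp add: test_def hat_test_def N_def Let_def)
  have fin: "finite ?A" "finite ?R" by auto
  have ge1: "1 \<le> n" if "(n, c) \<in> ?A \<union> ?R" for n c
    using that nstar_feasible(1) pos g d by auto
  have N1: "1 \<le> N" unfolding N_def using nstar_feasible(1) pos by blast
  have le: "ns g (\<beta> / 3) \<le> ns g' (\<beta> / 3)" "ns g' (\<beta> / 3) \<le> N" "ns (\<alpha> / 2) d \<le> N"
    unfolding N_def using pos g d by (auto intro!: nstar_antimono)
  have cl: "(\<lambda>\<omega>. enat (fst test \<omega>), snd test) \<in> test_class \<Omega> F P0 P1 \<alpha> \<beta>"
    unfolding test
  proof (rule staged_in_test_class[OF fin ge1 N1, where i=2 and j=3 and ?e0.0="\<alpha> / 2" and ?e1.0="\<beta> / 3"])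
    show "measure P0 {\<omega> \<in> \<Omega>. T n \<omega> > c} \<le> \<alpha> / 2" if "(n, c) \<in> insert (N, ks (\<alpha> / 2) (\<beta> / 3)) ?R" for n c
      using that threshold_errors(1) pos g d unfolding N_def by blast
    show "measure P1 {\<omega> \<in> \<Omega>. T n \<omega> \<le> c} \<le> \<beta> / 3" if "(n, c) \<in> insert (N, ks (\<alpha> / 2) (\<beta> / 3)) ?A" for n c
      using that threshold_errors(2) pos g d unfolding N_def by blast
  qed (use pos card_doubleton_triple_le in auto)
  show "optimal_ESS P0 \<Omega> F P0 P1 \<alpha> \<beta> \<le> ennreal (ESS P0 test)"
    "optimal_ESS P1 \<Omega> F P0 P1 \<alpha> \<beta> \<le> ennreal (ESS P1 test)"
    using optimal_ESS_le_staged[OF fin ge1 N1 cl[unfolded test]] unfolding test by auto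
  show "ESS P0 test \<le> bound3 (ns g (\<beta> / 3)) (ns g' (\<beta> / 3)) N g g'"
    unfolding test using threshold_errors(1) pos g
    by (intro ESS_0_three_stages[OF fin ge1 N1 _ _ _ _ le(1,2)]) auto
  show "ESS P1 test \<le> bound2 (ns (\<alpha> / 2) d) N d"
    unfolding test using threshold_errors(2) pos d
    by (intro ESS_1_two_stages[OF fin ge1 N1 _ _ le(3)]) auto
qed

lemma check_test_properties:
  assumes ab: "0 < \<alpha>" "\<alpha> < 1" "0 < \<beta>" "\<beta> < 1"
    and g: "\<alpha> / 3 < g" "g < 1" and d: "\<beta> / 2 < d'" "d' < d" "d < 1"
  defines "test \<equiv> check_test P0 P1 T ks \<alpha> \<beta> g d d'" and "N \<equiv> ns (\<alpha> / 3) (\<beta> / 2)"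
  shows "optimal_ESS P0 \<Omega> F P0 P1 \<alpha> \<beta> \<le> ennreal (ESS P0 test)"
    and "optimal_ESS P1 \<Omega> F P0 P1 \<alpha> \<beta> \<le> ennreal (ESS P1 test)"
    and "ESS P0 test \<le> bound2 (ns g (\<beta> / 2)) N g"
    and "ESS P1 test \<le> bound3 (ns (\<alpha> / 3) d) (ns (\<alpha> / 3) d') N d d'"
proof -
  have pos: "0 < \<alpha> / 3" "\<alpha> / 3 < 1" "0 < \<beta> / 2" "\<beta> / 2 < 1" "0 < g" "0 < d" "0 < d'" "d' < 1"
    using ab g d by auto
  let ?A = "{(ns g (\<beta> / 2), ks g (\<beta> / 2))}"
    and ?R = "{(ns (\<alpha> / 3) d, ks (\<alpha> / 3) d), (ns (\<alpha> / 3) d', ks (\<alpha> / 3) d')}"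
  have test: "test = multistage_test T ?A ?R N (ks (\<alpha> / 3) (\<beta> / 2))"
    by (simp add: test_def check_test_def N_def Let_def)
  have fin: "finite ?A" "finite ?R" by auto
  have ge1: "1 \<le> n" if "(n, c) \<in> ?A \<union> ?R" for n c
    using that nstar_feasible(1) pos g d by auto
  have N1: "1 \<le> N" unfolding N_def using nstar_feasible(1) pos by blast
  have le: "ns g (\<beta> / 2) \<le> N" "ns (\<alpha> / 3) d \<le> ns (\<alpha> / 3) d'" "ns (\<alpha> / 3) d' \<le> N"
    unfolding N_def using pos g d by (auto intro!: nstar_antimono)
  have cl: "(\<lambda>\<omega>. enat (fst test \<omega>), snd test) \<in> test_class \<Omega> F P0 P1 \<alpha> \<beta>"
    unfolding test
  proof (rule staged_in_test_class[OF fin ge1 N1, where i=3 and j=2 and ?e0.0="\<alpha> / 3" and ?e1.0="\<beta> / 2"])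
    show "measure P0 {\<omega> \<in> \<Omega>. T n \<omega> > c} \<le> \<alpha> / 3" if "(n, c) \<in> insert (N, ks (\<alpha> / 3) (\<beta> / 2)) ?R" for n c
      using that threshold_errors(1) pos g d unfolding N_def by blast
    show "measure P1 {\<omega> \<in> \<Omega>. T n \<omega> \<le> c} \<le> \<beta> / 2" if "(n, c) \<in> insert (N, ks (\<alpha> / 3) (\<beta> / 2)) ?A" for n c
      using that threshold_errors(2) pos g d unfolding N_def by blast
  qed (use pos card_doubleton_triple_le in auto)
  show "optimal_ESS P0 \<Omega> F P0 P1 \<alpha> \<beta> \<le> ennreal (ESS P0 test)"
    "optimal_ESS P1 \<Omega> F P0 P1 \<alpha> \<beta> \<le> ennreal (ESS P1 test)"
    using optimal_ESS_le_staged[OF fin ge1 N1 cl[unfolded test]] unfolding test by auto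
  show "ESS P0 test \<le> bound2 (ns g (\<beta> / 2)) N g"
    unfolding test using threshold_errors(1) pos g
    by (intro ESS_0_two_stages[OF fin ge1 N1 _ _ le(1)]) auto
  show "ESS P1 test \<le> bound3 (ns (\<alpha> / 3) d) (ns (\<alpha> / 3) d') N d d'"
    unfolding test using threshold_errors(2) pos d
    by (intro ESS_1_three_stages[OF fin ge1 N1 _ _ _ _ le(2,3)]) auto
qed

end

section \<open>Matching bounds along sequences of levels\<close>

lemma bound2_le: "0 \<le> x \<Longrightarrow> bound2 n N x \<le> real n + real N * x"
  by (simp add: bound2_def algebra_simps)

lemma bound3_le:
  assumes "0 \<le> x" "0 \<le> x'"
  shows "bound3 n m N x x' \<le> real n + real m * x + real N * x'"
  using mult_nonneg_nonneg[of "real n" x] mult_nonneg_nonneg[of "real m" x'] assms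
  by (simp add: bound3_def algebra_simps)

lemma is_arg_min_le:
  fixes f :: "'a \<Rightarrow> real"
  assumes "is_arg_min f P x" "P y"
  shows "f x \<le> f y"
  using assms by (auto simp: is_arg_min_def not_less)

lemma le_enn2real_ennreal: "x \<le> enn2real (ennreal x)"
  by (cases "0 \<le> x") (auto intro: order_trans[OF _ enn2real_nonneg])

context llr_testing
begin

text \<open>
  In the regime \<open>\<bar>ln b\<bar>\<close> is at most about \<open>\<bar>ln a\<bar>\<close>, so the larger of the two logarithms dominates the
  crude linear bound.
\<close>

lemma final_sample_size:
  assumes R: "regime a b" and cd: "1 \<le> c" "1 \<le> d"
  obtains C where "0 \<le> C" "\<forall>\<^sub>F k in sequentially. real (ns (a k / c) (b k / d)) \<le> C * - ln (a k)"
proof -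
  note lev = regimeD[OF R]
  obtain C B where C: "0 < C" "0 \<le> B"
    "\<And>t x. \<lbrakk>0 < t; t < 1; 0 < x; x < 1\<rbrakk> \<Longrightarrow> real (ns t x) \<le> C * (- ln t - ln x) + B"
    using S1.linear_bound by blast
  have U: "filterlim (\<lambda>k. - ln (a k)) at_top sequentially"
    using neg_ln_levels_at_top lev(1,2) by blast
  have "\<forall>\<^sub>F k in sequentially. C * (ln c + ln d) + B \<le> - ln (a k)"
    using U unfolding filterlim_at_top by blast
  then have "\<forall>\<^sub>F k in sequentially. real (ns (a k / c) (b k / d)) \<le> (3 * C + 1) * - ln (a k)"
    using lev(4)
  proof eventually_elim
    case (elim k)
    have p: "0 < a k / c" "a k / c < 1" "0 < b k / d" "b k / d < 1"
      using lev(1)[of k] cd by (auto simp: divide_simps)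
    have "real (ns (a k / c) (b k / d)) \<le> C * (- ln (a k / c) - ln (b k / d)) + B"
      using C(3) p by blast
    also have "\<dots> = C * (- ln (a k) - ln (b k)) + (C * (ln c + ln d) + B)"
      using lev(1)[of k] cd by (simp add: ln_div algebra_simps)
    also have "\<dots> \<le> C * (3 * - ln (a k)) + - ln (a k)"
      using elim C(1) by (intro add_mono mult_left_mono) auto
    finally show ?case by (simp add: algebra_simps)
  qed
  with C(1) show thesis by (intro that[of "3 * C + 1"]) auto
qed

lemma two_stage_ESS_1:
  assumes R: "regime a b" and cd: "1 \<le> c" "1 \<le> d"
    and V: "\<And>k y. \<lbrakk>b k / d < y; y < 1\<rbrakk> \<Longrightarrow> V k \<le> bound2 (ns (a k / c) y) (ns (a k / c) (b k / d)) y"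
    and \<epsilon>: "0 < \<epsilon>"
  shows "\<forall>\<^sub>F k in sequentially. V k \<le> (1 / I1 + \<epsilon>) * - ln (a k)"
proof -
  note lev = regimeD[OF R]
  obtain C where C: "\<forall>\<^sub>F k in sequentially. real (ns (a k / c) (b k / d)) \<le> C * - ln (a k)"
    using final_sample_size[OF R cd] by blast
  show ?thesis
  proof (rule S1.two_stage_upper[where u=b and c=c and d=d and N="\<lambda>k. real (ns (a k / c) (b k / d))"])
    show "(\<lambda>k. real (ns (a k / c) (b k / d)) * (a k powr q + b k) / - ln (a k)) \<longlonglongrightarrow> 0" if "0 < q" for q
      by (rule first_stage_correction_vanishes[OF R C that])
    fix k x assume x: "b k / d < x" "x < 1"
    have "0 < b k / d" using lev(1)[of k] cd by simp
    then have "0 \<le> x" using x by linarith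
    with V[OF x] bound2_le[of x] show "V k \<le> real (ns (a k / c) x) + real (ns (a k / c) (b k / d)) * x"
      by (blast intro: order_trans)
  qed (use lev cd \<epsilon> in auto)
qed

lemma three_stage_ESS_1:
  assumes R: "regime a b" and cd: "1 \<le> c" "1 \<le> d"
    and V: "\<And>k y y'. \<lbrakk>b k / d < y'; y' < y; y < 1\<rbrakk> \<Longrightarrow>
      V k \<le> bound3 (ns (a k / c) y) (ns (a k / c) y') (ns (a k / c) (b k / d)) y y'"
    and \<epsilon>: "0 < \<epsilon>"
  shows "\<forall>\<^sub>F k in sequentially. V k \<le> (1 / I1 + \<epsilon>) * - ln (a k)"
proof -
  note lev = regimeD[OF R]
  obtain C where C: "\<forall>\<^sub>F k in sequentially. real (ns (a k / c) (b k / d)) \<le> C * - ln (a k)"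
    using final_sample_size[OF R cd] by blast
  show ?thesis
  proof (rule S1.three_stage_upper[where u=b and c=c and d=d and s=1 and N="\<lambda>k. real (ns (a k / c) (b k / d))"])
    show "(\<lambda>k. real (ns (a k / c) (b k / d)) * (a k powr 1 + b k) / - ln (a k)) \<longlonglongrightarrow> 0"
      by (rule first_stage_correction_vanishes[OF R C]) simp
    fix k x x' assume x: "b k / d < x'" "x' < x" "x < 1"
    have "0 < b k / d" using lev(1)[of k] cd by simp
    then have "0 \<le> x" "0 \<le> x'" using x by linarith+
    with V[OF x] bound3_le[of x x']
    show "V k \<le> real (ns (a k / c) x) + real (ns (a k / c) x') * x + real (ns (a k / c) (b k / d)) * x'"
      by (blast intro: order_trans)
  qed (use lev cd \<epsilon> in auto)
qed

lemma two_stage_ESS_0: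
  assumes R: "regime a b" and cd: "1 \<le> c" "1 \<le> d"
    and rel: "\<And>q. 0 < q \<Longrightarrow> (\<lambda>k. - ln (a k) * b k powr q / - ln (b k)) \<longlonglongrightarrow> 0"
    and V: "\<And>k x. \<lbrakk>a k / c < x; x < 1\<rbrakk> \<Longrightarrow> V k \<le> bound2 (ns x (b k / d)) (ns (a k / c) (b k / d)) x"
    and \<epsilon>: "0 < \<epsilon>"
  shows "\<forall>\<^sub>F k in sequentially. V k \<le> (1 / I0 + \<epsilon>) * - ln (b k)"
proof -
  note lev = regimeD[OF R]
  obtain C where C: "0 \<le> C" "\<forall>\<^sub>F k in sequentially. real (ns (a k / c) (b k / d)) \<le> C * - ln (a k)"
    using final_sample_size[OF R cd] by blast
  show ?thesis
  proof (rule S0.two_stage_upper[where u=a and c=d and d=c and N="\<lambda>k. real (ns (a k / c) (b k / d))"])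
    show "(\<lambda>k. real (ns (a k / c) (b k / d)) * (b k powr q + a k) / - ln (b k)) \<longlonglongrightarrow> 0" if "0 < q" for q
      by (rule second_stage_correction_vanishes[OF R C(2,1) rel[OF that]])
    fix k x assume x: "a k / c < x" "x < 1"
    have "0 < a k / c" using lev(1)[of k] cd by simp
    then have "0 \<le> x" using x by linarith
    with V[OF x] bound2_le[of x] show "V k \<le> real (ns x (b k / d)) + real (ns (a k / c) (b k / d)) * x"
      by (blast intro: order_trans)
  qed (use lev cd \<epsilon> in auto)
qed

lemma three_stage_ESS_0:
  assumes R: "regime a b" and cd: "1 \<le> c" "1 \<le> d"
    and s: "0 < s" and rel: "(\<lambda>k. - ln (a k) * b k powr s / - ln (b k)) \<longlonglongrightarrow> 0"
    and V: "\<And>k x x'. \<lbrakk>a k / c < x'; x' < x; x < 1\<rbrakk> \<Longrightarrow>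
      V k \<le> bound3 (ns x (b k / d)) (ns x' (b k / d)) (ns (a k / c) (b k / d)) x x'"
    and \<epsilon>: "0 < \<epsilon>"
  shows "\<forall>\<^sub>F k in sequentially. V k \<le> (1 / I0 + \<epsilon>) * - ln (b k)"
proof -
  note lev = regimeD[OF R]
  obtain C where C: "0 \<le> C" "\<forall>\<^sub>F k in sequentially. real (ns (a k / c) (b k / d)) \<le> C * - ln (a k)"
    using final_sample_size[OF R cd] by blast
  show ?thesis
  proof (rule S0.three_stage_upper[where u=a and c=d and d=c and s=s and N="\<lambda>k. real (ns (a k / c) (b k / d))"])
    show "(\<lambda>k. real (ns (a k / c) (b k / d)) * (b k powr s + a k) / - ln (b k)) \<longlonglongrightarrow> 0"
      by (rule second_stage_correction_vanishes[OF R C(2,1) rel])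
    fix k x x' assume x: "a k / c < x'" "x' < x" "x < 1"
    have "0 < a k / c" using lev(1)[of k] cd by simp
    then have "0 \<le> x" "0 \<le> x'" using x by linarith+
    with V[OF x] bound3_le[of x x']
    show "V k \<le> real (ns x (b k / d)) + real (ns x' (b k / d)) * x + real (ns (a k / c) (b k / d)) * x'"
      by (blast intro: order_trans)
  qed (use lev cd s \<epsilon> in auto)
qed

lemma optimal_ESS_1_lower:
  assumes R: "regime a b" and \<epsilon>: "0 < \<epsilon>"
    and fin: "\<And>k. optimal_ESS P1 \<Omega> F P0 P1 (a k) (b k) < \<infinity>"
  shows "\<forall>\<^sub>F k in sequentially. (1 / I1 - \<epsilon>) * - ln (a k) \<le> enn2real (optimal_ESS P1 \<Omega> F P0 P1 (a k) (b k))"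
proof (rule lower_asymptotics[OF I1_pos, where u=b and
      p="\<lambda>\<rho> n. measure P1 {\<omega> \<in> \<Omega>. \<rho> < L n \<omega> / real n}"])
  show "(\<lambda>n. measure P1 {\<omega> \<in> \<Omega>. \<rho> < L n \<omega> / real n}) \<longlonglongrightarrow> 0" if "I1 < \<rho>" for \<rho>
  proof (rule AE_tendsto_prob_gt[OF P1 _ lim1 that, unfolded space1])
    show "(\<lambda>\<omega>. L n \<omega> / real n) \<in> borel_measurable P1" if "1 \<le> n" for n
      using measurable_from_subalg[of P1 "F (enat n)", OF _ L_meas[OF that]] sub1 space1 space_F
      by (auto simp: subalgebra_def)
  qed
  fix k n \<rho> assume n: "1 \<le> (n :: nat)"
  show "real n * (1 - b k - exp (real n * \<rho>) * a k - measure P1 {\<omega> \<in> \<Omega>. \<rho> < L n \<omega> / real n})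
      \<le> enn2real (optimal_ESS P1 \<Omega> F P0 P1 (a k) (b k))" (is "?x \<le> _")
  proof -
    have "?x \<le> enn2real (ennreal ?x)" by (rule le_enn2real_ennreal)
    also have "\<dots> \<le> enn2real (optimal_ESS P1 \<Omega> F P0 P1 (a k) (b k))"
      by (rule enn2real_mono[OF optimal_ESS_lower_bound_1[OF n]]) (use fin in simp)
    finally show ?thesis .
  qed
qed (use regimeD[OF R] \<epsilon> in auto)

lemma optimal_ESS_0_lower:
  assumes R: "regime a b" and \<epsilon>: "0 < \<epsilon>"
    and fin: "\<And>k. optimal_ESS P0 \<Omega> F P0 P1 (a k) (b k) < \<infinity>"
  shows "\<forall>\<^sub>F k in sequentially. (1 / I0 - \<epsilon>) * - ln (b k) \<le> enn2real (optimal_ESS P0 \<Omega> F P0 P1 (a k) (b k))"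
proof (rule lower_asymptotics[OF I0_pos, where u=a and
      p="\<lambda>\<rho> n. measure P0 {\<omega> \<in> \<Omega>. \<rho> < - L n \<omega> / real n}"])
  show "(\<lambda>n. measure P0 {\<omega> \<in> \<Omega>. \<rho> < - L n \<omega> / real n}) \<longlonglongrightarrow> 0" if "I0 < \<rho>" for \<rho>
  proof (rule AE_tendsto_prob_gt[OF P0 _ _ that, unfolded space0])
    show "(\<lambda>\<omega>. - L n \<omega> / real n) \<in> borel_measurable P0" if "1 \<le> n" for n
      using measurable_from_subalg[of P0 "F (enat n)", OF _ L_meas[OF that]] sub0 space0 space_F
      by (auto simp: subalgebra_def)
    show "AE \<omega> in P0. (\<lambda>n. - L n \<omega> / real n) \<longlonglongrightarrow> I0"
      using lim0
    proof eventually_elim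
      case (elim \<omega>)
      then show ?case using tendsto_minus by fastforce
    qed
  qed
  fix k n \<rho> assume n: "1 \<le> (n :: nat)"
  show "real n * (1 - a k - exp (real n * \<rho>) * b k - measure P0 {\<omega> \<in> \<Omega>. \<rho> < - L n \<omega> / real n})
      \<le> enn2real (optimal_ESS P0 \<Omega> F P0 P1 (a k) (b k))" (is "?x \<le> _")
  proof -
    have "?x \<le> enn2real (ennreal ?x)" by (rule le_enn2real_ennreal)
    also have "\<dots> \<le> enn2real (optimal_ESS P0 \<Omega> F P0 P1 (a k) (b k))"
      by (rule enn2real_mono[OF optimal_ESS_lower_bound_0[OF n]]) (use fin in simp)
    finally show ?thesis .
  qed
qed (use regimeD[OF R] \<epsilon> in auto)

lemma ESS_nonneg: "0 \<le> ESS P test"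
  by (simp add: ESS_def)

lemma enn2real_le_ESS: "x \<le> ennreal (ESS P test) \<Longrightarrow> enn2real x \<le> ESS P test"
  using enn2real_mono[of x "ennreal (ESS P test)"] ESS_nonneg[of P test] by simp

text \<open>
  A family of tests in the class whose expected sample size attains the lower bound pins down the
  optimal value as well.
\<close>

lemma asymptotically_optimal_1:
  assumes R: "regime a b"
    and opt: "\<And>k. optimal_ESS P1 \<Omega> F P0 P1 (a k) (b k) \<le> ennreal (ESS P1 (test k))"
    and upper: "\<And>\<epsilon>. 0 < \<epsilon> \<Longrightarrow> \<forall>\<^sub>F k in sequentially. ESS P1 (test k) \<le> (1 / I1 + \<epsilon>) * - ln (a k)"
  shows "(\<lambda>k. ESS P1 (test k)) \<sim>[sequentially] (\<lambda>k. - ln (a k) / I1)"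
    and "(\<lambda>k. enn2real (optimal_ESS P1 \<Omega> F P0 P1 (a k) (b k))) \<sim>[sequentially] (\<lambda>k. - ln (a k) / I1)"
proof -
  have U: "filterlim (\<lambda>k. - ln (a k)) at_top sequentially"
    using neg_ln_levels_at_top regimeD[OF R] by blast
  let ?L = "\<lambda>k. enn2real (optimal_ESS P1 \<Omega> F P0 P1 (a k) (b k))"
  have le: "?L k \<le> ESS P1 (test k)" for k by (rule enn2real_le_ESS[OF opt])
  have fin: "optimal_ESS P1 \<Omega> F P0 P1 (a k) (b k) < \<infinity>" for k
    using opt[of k] by (rule order_le_less_trans) simp
  note lower = optimal_ESS_1_lower[OF R _ fin]
  show "(\<lambda>k. ESS P1 (test k)) \<sim>[sequentially] (\<lambda>k. - ln (a k) / I1)"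
  proof (rule asymp_equiv_of_bounds[OF U I1_pos upper])
    show "\<forall>\<^sub>F k in sequentially. (1 / I1 - \<epsilon>) * - ln (a k) \<le> ESS P1 (test k)" if "0 < \<epsilon>" for \<epsilon>
      using lower[OF that] by eventually_elim (use le in \<open>blast intro: order_trans\<close>)
  qed
  show "?L \<sim>[sequentially] (\<lambda>k. - ln (a k) / I1)"
  proof (rule asymp_equiv_of_bounds[OF U I1_pos _ lower])
    show "\<forall>\<^sub>F k in sequentially. ?L k \<le> (1 / I1 + \<epsilon>) * - ln (a k)" if "0 < \<epsilon>" for \<epsilon>
      using upper[OF that] by eventually_elim (use le in \<open>blast intro: order_trans\<close>)
  qed
qed

lemma asymptotically_optimal_0:
  assumes R: "regime a b"
    and opt: "\<And>k. optimal_ESS P0 \<Omega> F P0 P1 (a k) (b k) \<le> ennreal (ESS P0 (test k))"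
    and upper: "\<And>\<epsilon>. 0 < \<epsilon> \<Longrightarrow> \<forall>\<^sub>F k in sequentially. ESS P0 (test k) \<le> (1 / I0 + \<epsilon>) * - ln (b k)"
  shows "(\<lambda>k. ESS P0 (test k)) \<sim>[sequentially] (\<lambda>k. - ln (b k) / I0)"
    and "(\<lambda>k. enn2real (optimal_ESS P0 \<Omega> F P0 P1 (a k) (b k))) \<sim>[sequentially] (\<lambda>k. - ln (b k) / I0)"
proof -
  have U: "filterlim (\<lambda>k. - ln (b k)) at_top sequentially"
    using neg_ln_levels_at_top regimeD[OF R] by blast
  let ?L = "\<lambda>k. enn2real (optimal_ESS P0 \<Omega> F P0 P1 (a k) (b k))"
  have le: "?L k \<le> ESS P0 (test k)" for k by (rule enn2real_le_ESS[OF opt])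
  have fin: "optimal_ESS P0 \<Omega> F P0 P1 (a k) (b k) < \<infinity>" for k
    using opt[of k] by (rule order_le_less_trans) simp
  note lower = optimal_ESS_0_lower[OF R _ fin]
  show "(\<lambda>k. ESS P0 (test k)) \<sim>[sequentially] (\<lambda>k. - ln (b k) / I0)"
  proof (rule asymp_equiv_of_bounds[OF U I0_pos upper])
    show "\<forall>\<^sub>F k in sequentially. (1 / I0 - \<epsilon>) * - ln (b k) \<le> ESS P0 (test k)" if "0 < \<epsilon>" for \<epsilon>
      using lower[OF that] by eventually_elim (use le in \<open>blast intro: order_trans\<close>)
  qed
  show "?L \<sim>[sequentially] (\<lambda>k. - ln (b k) / I0)"
  proof (rule asymp_equiv_of_bounds[OF U I0_pos _ lower])
    show "\<forall>\<^sub>F k in sequentially. ?L k \<le> (1 / I0 + \<epsilon>) * - ln (b k)" if "0 < \<epsilon>" for \<epsilon>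
      using upper[OF that] by eventually_elim (use le in \<open>blast intro: order_trans\<close>)
  qed
qed

text \<open>
  The minimizing property of the selected parameters is used to replace them by
  arbitrary admissible ones in the bounds on the expected sample size.
\<close>

lemma tilde_test_asymptotics:
  assumes R: "regime a b"
    and sel: "\<And>k. tilde_selected P0 P1 T (a k) (b k) (g k) (d k)"
  defines "test \<equiv> \<lambda>k. tilde_test P0 P1 T ks (a k) (b k) (g k) (d k)"
  shows "\<And>k. optimal_ESS P0 \<Omega> F P0 P1 (a k) (b k) \<le> ennreal (ESS P0 (test k))"
    and "\<And>k. optimal_ESS P1 \<Omega> F P0 P1 (a k) (b k) \<le> ennreal (ESS P1 (test k))"
    and "0 < \<epsilon> \<Longrightarrow> \<forall>\<^sub>F k in sequentially. ESS P1 (test k) \<le> (1 / I1 + \<epsilon>) * - ln (a k)"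
    and "\<lbrakk>0 < \<epsilon>; \<And>q. 0 < q \<Longrightarrow> (\<lambda>k. - ln (a k) * b k powr q / - ln (b k)) \<longlonglongrightarrow> 0\<rbrakk> \<Longrightarrow>
      \<forall>\<^sub>F k in sequentially. ESS P0 (test k) \<le> (1 / I0 + \<epsilon>) * - ln (b k)"
proof -
  note lev = regimeD(1)[OF R]
  have range: "a k / 2 < g k" "g k < 1" "b k / 2 < d k" "d k < 1" for k
    using sel[of k] by (auto simp: tilde_selected_def is_arg_min_def Let_def)
  have sel': "is_arg_min (\<lambda>x. bound2 (ns x (b k / 2)) (ns (a k / 2) (b k / 2)) x) (\<lambda>x. a k / 2 < x \<and> x < 1) (g k)"
    "is_arg_min (\<lambda>y. bound2 (ns (a k / 2) y) (ns (a k / 2) (b k / 2)) y) (\<lambda>y. b k / 2 < y \<and> y < 1) (d k)" for k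
    using sel[of k] unfolding tilde_selected_def Let_def by blast+
  have min0: "bound2 (ns (g k) (b k / 2)) (ns (a k / 2) (b k / 2)) (g k)
      \<le> bound2 (ns x (b k / 2)) (ns (a k / 2) (b k / 2)) x" if "a k / 2 < x" "x < 1" for k x
    using is_arg_min_le[OF sel'(1), of k "x"] that by simp
  have min1: "bound2 (ns (a k / 2) (d k)) (ns (a k / 2) (b k / 2)) (d k)
      \<le> bound2 (ns (a k / 2) y) (ns (a k / 2) (b k / 2)) y" if "b k / 2 < y" "y < 1" for k y
    using is_arg_min_le[OF sel'(2), of k "y"] that by simp
  have lv: "0 < a k" "a k < 1" "0 < b k" "b k < 1" for k using lev by auto
  note props = tilde_test_properties[OF lv range]
  show "\<And>k. optimal_ESS P0 \<Omega> F P0 P1 (a k) (b k) \<le> ennreal (ESS P0 (test k))"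
    "\<And>k. optimal_ESS P1 \<Omega> F P0 P1 (a k) (b k) \<le> ennreal (ESS P1 (test k))"
    unfolding test_def using props(1,2) by auto
  show "\<forall>\<^sub>F k in sequentially. ESS P1 (test k) \<le> (1 / I1 + \<epsilon>) * - ln (a k)" if "0 < \<epsilon>"
    unfolding test_def
    by (rule two_stage_ESS_1[OF R _ _ order_trans[OF props(4) min1] that]) auto
  show "\<forall>\<^sub>F k in sequentially. ESS P0 (test k) \<le> (1 / I0 + \<epsilon>) * - ln (b k)"
    if "0 < \<epsilon>" "\<And>q. 0 < q \<Longrightarrow> (\<lambda>k. - ln (a k) * b k powr q / - ln (b k)) \<longlonglongrightarrow> 0"
    unfolding test_def
    by (rule two_stage_ESS_0[OF R _ _ that(2) order_trans[OF props(3) min0] that(1)]) auto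
qed

lemma hat_test_asymptotics:
  assumes R: "regime a b"
    and sel: "\<And>k. hat_selected P0 P1 T (a k) (b k) (g k) (g' k) (d k)"
  defines "test \<equiv> \<lambda>k. hat_test P0 P1 T ks (a k) (b k) (g k) (g' k) (d k)"
  shows "\<And>k. optimal_ESS P0 \<Omega> F P0 P1 (a k) (b k) \<le> ennreal (ESS P0 (test k))"
    and "\<And>k. optimal_ESS P1 \<Omega> F P0 P1 (a k) (b k) \<le> ennreal (ESS P1 (test k))"
    and "0 < \<epsilon> \<Longrightarrow> \<forall>\<^sub>F k in sequentially. ESS P1 (test k) \<le> (1 / I1 + \<epsilon>) * - ln (a k)"
    and "\<lbrakk>0 < \<epsilon>; 0 < s; (\<lambda>k. - ln (a k) * b k powr s / - ln (b k)) \<longlonglongrightarrow> 0\<rbrakk> \<Longrightarrow>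
      \<forall>\<^sub>F k in sequentially. ESS P0 (test k) \<le> (1 / I0 + \<epsilon>) * - ln (b k)"
proof -
  note lev = regimeD(1)[OF R]
  have range: "a k / 2 < g' k" "g' k < g k" "g k < 1" "b k / 3 < d k" "d k < 1" for k
    using sel[of k] by (auto simp: hat_selected_def is_arg_min_def Let_def)
  have sel': "is_arg_min (\<lambda>(x, x'). bound3 (ns x (b k / 3)) (ns x' (b k / 3)) (ns (a k / 2) (b k / 3)) x x')
      (\<lambda>(x, x'). a k / 2 < x' \<and> x' < x \<and> x < 1) (g k, g' k)"
    "is_arg_min (\<lambda>y. bound2 (ns (a k / 2) y) (ns (a k / 2) (b k / 3)) y) (\<lambda>y. b k / 3 < y \<and> y < 1) (d k)" for k
    using sel[of k] unfolding hat_selected_def Let_def by blast+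
  have min0: "bound3 (ns (g k) (b k / 3)) (ns (g' k) (b k / 3)) (ns (a k / 2) (b k / 3)) (g k) (g' k)
      \<le> bound3 (ns x (b k / 3)) (ns x' (b k / 3)) (ns (a k / 2) (b k / 3)) x x'"
    if "a k / 2 < x'" "x' < x" "x < 1" for k x x'
    using is_arg_min_le[OF sel'(1), of k "(x, x')"] that by simp
  have min1: "bound2 (ns (a k / 2) (d k)) (ns (a k / 2) (b k / 3)) (d k)
      \<le> bound2 (ns (a k / 2) y) (ns (a k / 2) (b k / 3)) y" if "b k / 3 < y" "y < 1" for k y
    using is_arg_min_le[OF sel'(2), of k "y"] that by simp
  have lv: "0 < a k" "a k < 1" "0 < b k" "b k < 1" for k using lev by auto
  note props = hat_test_properties[OF lv range]
  show "\<And>k. optimal_ESS P0 \<Omega> F P0 P1 (a k) (b k) \<le> ennreal (ESS P0 (test k))"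
    "\<And>k. optimal_ESS P1 \<Omega> F P0 P1 (a k) (b k) \<le> ennreal (ESS P1 (test k))"
    unfolding test_def using props(1,2) by auto
  show "\<forall>\<^sub>F k in sequentially. ESS P1 (test k) \<le> (1 / I1 + \<epsilon>) * - ln (a k)" if "0 < \<epsilon>"
    unfolding test_def
    by (rule two_stage_ESS_1[OF R _ _ order_trans[OF props(4) min1] that]) auto
  show "\<forall>\<^sub>F k in sequentially. ESS P0 (test k) \<le> (1 / I0 + \<epsilon>) * - ln (b k)"
    if "0 < \<epsilon>" "0 < s" "(\<lambda>k. - ln (a k) * b k powr s / - ln (b k)) \<longlonglongrightarrow> 0"
    unfolding test_def
    by (rule three_stage_ESS_0[OF R _ _ that(2,3) order_trans[OF props(3) min0] that(1)]) auto
qed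

lemma check_test_asymptotics:
  assumes R: "regime a b"
    and sel: "\<And>k. check_selected P0 P1 T (a k) (b k) (g k) (d k) (d' k)"
  defines "test \<equiv> \<lambda>k. check_test P0 P1 T ks (a k) (b k) (g k) (d k) (d' k)"
  shows "\<And>k. optimal_ESS P0 \<Omega> F P0 P1 (a k) (b k) \<le> ennreal (ESS P0 (test k))"
    and "\<And>k. optimal_ESS P1 \<Omega> F P0 P1 (a k) (b k) \<le> ennreal (ESS P1 (test k))"
    and "0 < \<epsilon> \<Longrightarrow> \<forall>\<^sub>F k in sequentially. ESS P1 (test k) \<le> (1 / I1 + \<epsilon>) * - ln (a k)"
    and "\<lbrakk>0 < \<epsilon>; \<And>q. 0 < q \<Longrightarrow> (\<lambda>k. - ln (a k) * b k powr q / - ln (b k)) \<longlonglongrightarrow> 0\<rbrakk> \<Longrightarrow>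
      \<forall>\<^sub>F k in sequentially. ESS P0 (test k) \<le> (1 / I0 + \<epsilon>) * - ln (b k)"
proof -
  note lev = regimeD(1)[OF R]
  have range: "a k / 3 < g k" "g k < 1" "b k / 2 < d' k" "d' k < d k" "d k < 1" for k
    using sel[of k] by (auto simp: check_selected_def is_arg_min_def Let_def)
  have sel': "is_arg_min (\<lambda>x. bound2 (ns x (b k / 2)) (ns (a k / 3) (b k / 2)) x) (\<lambda>x. a k / 3 < x \<and> x < 1) (g k)"
    "is_arg_min (\<lambda>(y, y'). bound3 (ns (a k / 3) y) (ns (a k / 3) y') (ns (a k / 3) (b k / 2)) y y')
      (\<lambda>(y, y'). b k / 2 < y' \<and> y' < y \<and> y < 1) (d k, d' k)" for k
    using sel[of k] unfolding check_selected_def Let_def by blast+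
  have min0: "bound2 (ns (g k) (b k / 2)) (ns (a k / 3) (b k / 2)) (g k)
      \<le> bound2 (ns x (b k / 2)) (ns (a k / 3) (b k / 2)) x" if "a k / 3 < x" "x < 1" for k x
    using is_arg_min_le[OF sel'(1), of k "x"] that by simp
  have min1: "bound3 (ns (a k / 3) (d k)) (ns (a k / 3) (d' k)) (ns (a k / 3) (b k / 2)) (d k) (d' k)
      \<le> bound3 (ns (a k / 3) y) (ns (a k / 3) y') (ns (a k / 3) (b k / 2)) y y'"
    if "b k / 2 < y'" "y' < y" "y < 1" for k y y'
    using is_arg_min_le[OF sel'(2), of k "(y, y')"] that by simp
  have lv: "0 < a k" "a k < 1" "0 < b k" "b k < 1" for k using lev by auto
  note props = check_test_properties[OF lv range]
  show "\<And>k. optimal_ESS P0 \<Omega> F P0 P1 (a k) (b k) \<le> ennreal (ESS P0 (test k))"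
    "\<And>k. optimal_ESS P1 \<Omega> F P0 P1 (a k) (b k) \<le> ennreal (ESS P1 (test k))"
    unfolding test_def using props(1,2) by auto
  show "\<forall>\<^sub>F k in sequentially. ESS P1 (test k) \<le> (1 / I1 + \<epsilon>) * - ln (a k)" if "0 < \<epsilon>"
    unfolding test_def
    by (rule three_stage_ESS_1[OF R _ _ order_trans[OF props(4) min1] that]) auto
  show "\<forall>\<^sub>F k in sequentially. ESS P0 (test k) \<le> (1 / I0 + \<epsilon>) * - ln (b k)"
    if "0 < \<epsilon>" "\<And>q. 0 < q \<Longrightarrow> (\<lambda>k. - ln (a k) * b k powr q / - ln (b k)) \<longlonglongrightarrow> 0"
    unfolding test_def
    by (rule two_stage_ESS_0[OF R _ _ that(2) order_trans[OF props(3) min0] that(1)]) auto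
qed

end

section \<open>The observation filtration and exponential rates\<close>

lemma obs_filtration_generators:
  "{X i -` A \<inter> \<Omega> | i A. 1 \<le> i \<and> enat i \<le> t \<and> A \<in> sets S} \<subseteq> Pow \<Omega>"
  by auto

lemma filtration_obs_filtration: "filtration \<Omega> (obs_filtration \<Omega> S X)"
proof
  show "space (obs_filtration \<Omega> S X t) = \<Omega>" for t
    unfolding obs_filtration_def by (rule space_measure_of[OF obs_filtration_generators])
  show "sets (obs_filtration \<Omega> S X s) \<subseteq> sets (obs_filtration \<Omega> S X t)" if "s \<le> t" for s t
    unfolding obs_filtration_def sets_measure_of[OF obs_filtration_generators]
    by (rule sigma_sets_mono') (use that in \<open>blast intro: order_trans\<close>)
qed

lemma obs_filtration_subset:
  assumes X: "\<And>n. 1 \<le> n \<Longrightarrow> X n \<in> M \<rightarrow>\<^sub>M S"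
  shows "sets (obs_filtration (space M) S X t) \<subseteq> sets M"
proof -
  have "{X i -` A \<inter> space M | i A. 1 \<le> i \<and> enat i \<le> t \<and> A \<in> sets S} \<subseteq> sets M"
    using measurable_sets[OF X] by blast
  then show ?thesis
    unfolding obs_filtration_def sets_measure_of[OF obs_filtration_generators]
    by (rule sets.sigma_sets_subset)
qed

lemma exponential_decay_of_rate:
  fixes p :: "nat \<Rightarrow> real"
  assumes rate: "(\<lambda>n. 1 / real n * ln (p n)) \<longlonglongrightarrow> - \<psi>" and \<psi>: "0 < \<psi>" and p: "\<And>n. 0 \<le> p n"
  shows "\<exists>c>0. \<forall>\<^sub>F n in sequentially. p n \<le> exp (- c * real n)"
proof -
  have "\<forall>\<^sub>F n in sequentially. 1 / real n * ln (p n) < - (\<psi> / 2)"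
    by (rule order_tendstoD(2)[OF rate]) (use \<psi> in simp)
  then have "\<forall>\<^sub>F n in sequentially. p n \<le> exp (- (\<psi> / 2) * real n)"
    using eventually_gt_at_top[of 0]
  proof eventually_elim
    case (elim n)
    then have l: "ln (p n) < - (\<psi> / 2) * real n" by (simp add: field_simps)
    also have "\<dots> \<le> 0" using \<psi> by simp
    \<comment> \<open>\<open>ln 0 = 0\<close>, so a negative logarithm forces a positive argument.\<close>
    finally have "p n \<noteq> 0" by auto
    then have "p n = exp (ln (p n))" using p[of n] by simp
    then show ?case using l by (metis exp_le_cancel_iff less_imp_le)
  qed
  then show ?thesis using \<psi> by (intro exI[of _ "\<psi> / 2"]) auto
qed

lemma AE_limit_unique:
  fixes f g :: "nat \<Rightarrow> 'o \<Rightarrow> real"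
  assumes P: "prob_space P"
    and f: "AE \<omega> in P. (\<lambda>n. f n \<omega>) \<longlonglongrightarrow> l" and g: "AE \<omega> in P. (\<lambda>n. g n \<omega>) \<longlonglongrightarrow> l'"
    and eq: "\<And>n \<omega>. \<lbrakk>1 \<le> n; \<omega> \<in> space P\<rbrakk> \<Longrightarrow> f n \<omega> = g n \<omega>"
  shows "l = l'"
proof -
  interpret prob_space P by fact
  have "AE \<omega> in P. l = l'"
    using f g AE_space
  proof eventually_elim
    case (elim \<omega>)
    have "\<forall>\<^sub>F n in sequentially. f n \<omega> = g n \<omega>"
      using eventually_ge_at_top[of 1] by eventually_elim (use eq elim in blast)
    then have "(\<lambda>n. g n \<omega>) \<longlonglongrightarrow> l" using elim(1) by (rule Lim_transform_eventually[rotated])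
    then show ?case using elim(2) by (rule LIMSEQ_unique)
  qed
  then show ?thesis by simp
qed

section \<open>Asymptotic optimality of the multistage tests\<close>

theorem theorem4p3:
  fixes \<Omega> :: "'o set" and M :: "'o measure" and S :: "'s measure"
    and X :: "nat \<Rightarrow> 'o \<Rightarrow> 's"
    and F :: "enat \<Rightarrow> 'o measure"
    and PP PP0 PP1 :: "(nat \<Rightarrow> 's) measure set"
    and P0 P1 :: "'o measure"
    and \<Lambda> T :: "nat \<Rightarrow> 'o \<Rightarrow> real"
    and I0 I1 J0 J1 :: real
    and \<psi>0 \<psi>1 :: "real \<Rightarrow> ennreal"
    and ks :: "real \<Rightarrow> real \<Rightarrow> real"
    and \<gamma>t \<delta>t \<gamma>h \<gamma>h' \<delta>h \<gamma>c \<delta>c \<delta>c' :: "real \<Rightarrow> real \<Rightarrow> real"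
  defines "\<Omega> \<equiv> space M" and "F \<equiv> obs_filtration \<Omega> S X"
  assumes X: "\<And>n. n \<ge> 1 \<Longrightarrow> X n \<in> M \<rightarrow>\<^sub>M S"
    and families: "\<And>Q. Q \<in> PP \<Longrightarrow> prob_space Q \<and> sets Q = sets (\<Pi>\<^sub>M n\<in>{1..}. S)"
      "PP0 \<subseteq> PP" "PP1 \<subseteq> PP" "PP0 \<inter> PP1 = {}"
    and P0: "prob_space P0" "sets P0 = sets M" "obs_law S X P0 \<in> PP0"
    and P1: "prob_space P1" "sets P1 = sets M" "obs_law S X P1 \<in> PP1"
    and mutual_ac:
      "\<And>n. n \<ge> 1 \<Longrightarrow> absolutely_continuous (restr_to_subalg P0 (F (enat n))) (restr_to_subalg P1 (F (enat n)))"
      "\<And>n. n \<ge> 1 \<Longrightarrow> absolutely_continuous (restr_to_subalg P1 (F (enat n))) (restr_to_subalg P0 (F (enat n)))"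
    and LLR: "\<And>n. n \<ge> 1 \<Longrightarrow> is_LLR P0 P1 (F (enat n)) (\<Lambda> n)"
    and I: "0 < I0" "0 < I1"
    and LLR_lim:
      "AE \<omega> in P0. (\<lambda>n. \<Lambda> n \<omega> / real n) \<longlonglongrightarrow> - I0"
      "AE \<omega> in P1. (\<lambda>n. \<Lambda> n \<omega> / real n) \<longlonglongrightarrow> I1"
    and LLR_complete:
      "\<And>\<epsilon>. \<epsilon> > 0 \<Longrightarrow> summable (\<lambda>n. measure P0 {\<omega> \<in> \<Omega>. \<Lambda> n \<omega> / real n > - I0 + \<epsilon>})"
      "\<And>\<epsilon>. \<epsilon> > 0 \<Longrightarrow> summable (\<lambda>n. measure P1 {\<omega> \<in> \<Omega>. \<Lambda> n \<omega> / real n \<le> I1 - \<epsilon>})"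
    and T_meas: "\<And>n. n \<ge> 1 \<Longrightarrow> T n \<in> borel_measurable (F (enat n))"
    and T_feasible:
      "\<And>\<alpha> \<beta>. 0 < \<alpha> \<Longrightarrow> \<alpha> < 1 \<Longrightarrow> 0 < \<beta> \<Longrightarrow> \<beta> < 1 \<Longrightarrow> \<exists>n\<ge>1. \<exists>\<kappa>. fss_feasible P0 P1 T \<alpha> \<beta> n \<kappa>"
    and kappa_star:
      "\<And>\<alpha> \<beta>. 0 < \<alpha> \<Longrightarrow> \<alpha> < 1 \<Longrightarrow> 0 < \<beta> \<Longrightarrow> \<beta> < 1 \<Longrightarrow>
        fss_feasible P0 P1 T \<alpha> \<beta> (nstar P0 P1 T \<alpha> \<beta>) (ks \<alpha> \<beta>)"
    and J: "J0 < J1"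
    and T_lim: "AE \<omega> in P0. (\<lambda>n. T n \<omega>) \<longlonglongrightarrow> J0" "AE \<omega> in P1. (\<lambda>n. T n \<omega>) \<longlonglongrightarrow> J1"
    and psi0: "convex_ennreal \<psi>0" "lsc_ennreal \<psi>0" "\<And>x. x \<in> {J0..J1} \<Longrightarrow> \<psi>0 x < \<infinity>"
      "\<psi>0 J0 = 0" "strict_mono_on {J0..J1} \<psi>0"
    and psi1: "convex_ennreal \<psi>1" "lsc_ennreal \<psi>1" "\<And>x. x \<in> {J0..J1} \<Longrightarrow> \<psi>1 x < \<infinity>"
      "\<psi>1 J1 = 0" "strict_antimono_on {J0..J1} \<psi>1"
    and rates:
      "\<And>\<kappa>. \<kappa> \<in> {J0<..<J1} \<Longrightarrow>
        (\<lambda>n. 1 / real n * ln (measure P0 {\<omega> \<in> \<Omega>. T n \<omega> > \<kappa>})) \<longlonglongrightarrow> - enn2real (\<psi>0 \<kappa>)"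
      "\<And>\<kappa>. \<kappa> \<in> {J0<..<J1} \<Longrightarrow>
        (\<lambda>n. 1 / real n * ln (measure P1 {\<omega> \<in> \<Omega>. T n \<omega> \<le> \<kappa>})) \<longlonglongrightarrow> - enn2real (\<psi>1 \<kappa>)"
    and T_eq: "\<And>n \<omega>. n \<ge> 1 \<Longrightarrow> \<omega> \<in> \<Omega> \<Longrightarrow> T n \<omega> = \<Lambda> n \<omega> / real n"
    and selected:
      "\<And>\<alpha> \<beta>. 0 < \<alpha> \<Longrightarrow> \<alpha> < 1 \<Longrightarrow> 0 < \<beta> \<Longrightarrow> \<beta> < 1 \<Longrightarrow>
        tilde_selected P0 P1 T \<alpha> \<beta> (\<gamma>t \<alpha> \<beta>) (\<delta>t \<alpha> \<beta>)"
      "\<And>\<alpha> \<beta>. 0 < \<alpha> \<Longrightarrow> \<alpha> < 1 \<Longrightarrow> 0 < \<beta> \<Longrightarrow> \<beta> < 1 \<Longrightarrow>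
        hat_selected P0 P1 T \<alpha> \<beta> (\<gamma>h \<alpha> \<beta>) (\<gamma>h' \<alpha> \<beta>) (\<delta>h \<alpha> \<beta>)"
      "\<And>\<alpha> \<beta>. 0 < \<alpha> \<Longrightarrow> \<alpha> < 1 \<Longrightarrow> 0 < \<beta> \<Longrightarrow> \<beta> < 1 \<Longrightarrow>
        check_selected P0 P1 T \<alpha> \<beta> (\<gamma>c \<alpha> \<beta>) (\<delta>c \<alpha> \<beta>) (\<delta>c' \<alpha> \<beta>)"
  defines "tilde \<equiv> \<lambda>\<alpha> \<beta>. tilde_test P0 P1 T ks \<alpha> \<beta> (\<gamma>t \<alpha> \<beta>) (\<delta>t \<alpha> \<beta>)"
    and "hat \<equiv> \<lambda>\<alpha> \<beta>. hat_test P0 P1 T ks \<alpha> \<beta> (\<gamma>h \<alpha> \<beta>) (\<gamma>h' \<alpha> \<beta>) (\<delta>h \<alpha> \<beta>)"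
    and "check \<equiv> \<lambda>\<alpha> \<beta>. check_test P0 P1 T ks \<alpha> \<beta> (\<gamma>c \<alpha> \<beta>) (\<delta>c \<alpha> \<beta>) (\<delta>c' \<alpha> \<beta>)"
    and "L0 \<equiv> \<lambda>\<alpha> \<beta>. enn2real (optimal_ESS P0 \<Omega> F P0 P1 \<alpha> \<beta>)"
    and "L1 \<equiv> \<lambda>\<alpha> \<beta>. enn2real (optimal_ESS P1 \<Omega> F P0 P1 \<alpha> \<beta>)"
  shows
    "(\<forall>a b. regime a b \<longrightarrow>
        (\<lambda>k. ESS P1 (tilde (a k) (b k))) \<sim>[sequentially] (\<lambda>k. ESS P1 (hat (a k) (b k))) \<and>
        (\<lambda>k. ESS P1 (hat (a k) (b k))) \<sim>[sequentially] (\<lambda>k. ESS P1 (check (a k) (b k))) \<and>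
        (\<lambda>k. ESS P1 (check (a k) (b k))) \<sim>[sequentially] (\<lambda>k. \<bar>ln (a k)\<bar> / I1) \<and>
        (\<lambda>k. \<bar>ln (a k)\<bar> / I1) \<sim>[sequentially] (\<lambda>k. L1 (a k) (b k)))
     \<and> (\<forall>a b r. regime a b \<and> r > 0 \<and>
          asymp_le (\<lambda>k. \<bar>ln (a k)\<bar>) (\<lambda>k. \<bar>ln (b k)\<bar> / (b k) powr r) \<longrightarrow>
        (\<lambda>k. ESS P0 (hat (a k) (b k))) \<sim>[sequentially] (\<lambda>k. \<bar>ln (b k)\<bar> / I0) \<and>
        (\<lambda>k. \<bar>ln (b k)\<bar> / I0) \<sim>[sequentially] (\<lambda>k. L0 (a k) (b k)))
     \<and> (\<forall>a b r. regime a b \<and> r \<ge> 1 \<and>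
          asymp_le (\<lambda>k. \<bar>ln (a k)\<bar>) (\<lambda>k. \<bar>ln (b k)\<bar> powr r) \<longrightarrow>
        (\<lambda>k. ESS P0 (tilde (a k) (b k))) \<sim>[sequentially] (\<lambda>k. ESS P0 (check (a k) (b k))) \<and>
        (\<lambda>k. ESS P0 (check (a k) (b k))) \<sim>[sequentially] (\<lambda>k. \<bar>ln (b k)\<bar> / I0) \<and>
        (\<lambda>k. \<bar>ln (b k)\<bar> / I0) \<sim>[sequentially] (\<lambda>k. L0 (a k) (b k)))"
proof -
  have space: "space P0 = \<Omega>" "space P1 = \<Omega>"
    using P0(2) P1(2) by (auto simp: \<Omega>_def dest: sets_eq_imp_space_eq)
  have filt: "filtration \<Omega> F" unfolding F_def by (rule filtration_obs_filtration)
  have sub: "sets (F t) \<subseteq> sets P0" "sets (F t) \<subseteq> sets P1" for t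
    using obs_filtration_subset[OF X] P0(2) P1(2) by (auto simp: F_def \<Omega>_def)
  have subalg: "subalgebra P0 (F t)" "subalgebra P1 (F t)" for t
    using sub space filt by (auto simp: subalgebra_def filtration_def)
  have J0: "J0 = - I0"
    by (rule AE_limit_unique[OF P0(1) T_lim(1) LLR_lim(1)]) (use T_eq space in auto)
  have J1: "J1 = I1"
    by (rule AE_limit_unique[OF P1(1) T_lim(2) LLR_lim(2)]) (use T_eq space in auto)
  have psi0_pos: "0 < enn2real (\<psi>0 \<kappa>)" if "- I0 < \<kappa>" "\<kappa> < I1" for \<kappa>
    using strict_mono_onD[OF psi0(5), of J0 \<kappa>] psi0(3)[of \<kappa>] psi0(4) that
    by (simp add: J0 J1 enn2real_positive_iff less_top)
  have psi1_pos: "0 < enn2real (\<psi>1 \<kappa>)" if "- I0 < \<kappa>" "\<kappa> < I1" for \<kappa>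
    using monotone_onD[OF psi1(5), of \<kappa> J1] psi1(3)[of \<kappa>] psi1(4) that
    by (simp add: J0 J1 enn2real_positive_iff less_top)
  interpret llr_testing \<Omega> F P0 P1 \<Lambda> T I0 I1 ks
  proof (rule llr_testing.intro)
    fix n A c assume n: "1 \<le> (n :: nat)" and A: "A \<in> sets (F (enat n))"
    note change = LLR_change_of_measure[OF P0(1) P1(1) subalg mutual_ac[OF n] LLR[OF n] A]
    show "measure P1 {\<omega> \<in> A. \<Lambda> n \<omega> \<le> c} \<le> exp c * measure P0 A"
      "measure P0 {\<omega> \<in> A. - \<Lambda> n \<omega> \<le> c} \<le> exp c * measure P1 A" by (rule change)+
  next
    fix \<kappa> assume \<kappa>: "- I0 < \<kappa>" "\<kappa> < I1"
    then have "\<kappa> \<in> {J0<..<J1}" by (simp add: J0 J1)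
    note rate = rates[OF this]
    show "\<exists>c>0. \<forall>\<^sub>F n in sequentially. measure P0 {\<omega> \<in> \<Omega>. T n \<omega> > \<kappa>} \<le> exp (- c * real n)"
      by (rule exponential_decay_of_rate[OF rate(1) psi0_pos[OF \<kappa>]]) simp
    show "\<exists>c>0. \<forall>\<^sub>F n in sequentially. measure P1 {\<omega> \<in> \<Omega>. T n \<omega> \<le> \<kappa>} \<le> exp (- c * real n)"
      by (rule exponential_decay_of_rate[OF rate(2) psi1_pos[OF \<kappa>]]) simp
  next
    show "\<Lambda> n \<in> borel_measurable (F (enat n))" if "1 \<le> n" for n
      using LLR[OF that] by (simp add: is_LLR_def)
  qed (fact filt P0(1) P1(1) space sub T_meas T_eq I LLR_lim T_feasible kappa_star)+
  have abs_ln: "(\<lambda>k. \<bar>ln (a k)\<bar> / c) = (\<lambda>k. - ln (a k) / c)" "(\<lambda>k. \<bar>ln (b k)\<bar> / c) = (\<lambda>k. - ln (b k) / c)"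
    if "regime a b" for a b c
    using regimeD(1)[OF that] by (auto simp: fun_eq_iff abs_if not_less)
  have part1: "(\<lambda>k. ESS P1 (tilde (a k) (b k))) \<sim>[sequentially] (\<lambda>k. \<bar>ln (a k)\<bar> / I1)"
    "(\<lambda>k. ESS P1 (hat (a k) (b k))) \<sim>[sequentially] (\<lambda>k. \<bar>ln (a k)\<bar> / I1)"
    "(\<lambda>k. ESS P1 (check (a k) (b k))) \<sim>[sequentially] (\<lambda>k. \<bar>ln (a k)\<bar> / I1)"
    "(\<lambda>k. L1 (a k) (b k)) \<sim>[sequentially] (\<lambda>k. \<bar>ln (a k)\<bar> / I1)"
    if R: "regime a b" for a b
  proof -
    note lev = regimeD(1)[OF R]
    note t = tilde_test_asymptotics(2,3)[OF R selected(1)]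
    note h = hat_test_asymptotics(2,3)[OF R selected(2)]
    note c = check_test_asymptotics(2,3)[OF R selected(3)]
    show "(\<lambda>k. ESS P1 (tilde (a k) (b k))) \<sim>[sequentially] (\<lambda>k. \<bar>ln (a k)\<bar> / I1)"
      unfolding abs_ln(1)[OF R] tilde_def
      by (rule asymptotically_optimal_1(1)[OF R t]) (use lev in auto)
    show "(\<lambda>k. ESS P1 (hat (a k) (b k))) \<sim>[sequentially] (\<lambda>k. \<bar>ln (a k)\<bar> / I1)"
      unfolding abs_ln(1)[OF R] hat_def
      by (rule asymptotically_optimal_1(1)[OF R h]) (use lev in auto)
    show "(\<lambda>k. ESS P1 (check (a k) (b k))) \<sim>[sequentially] (\<lambda>k. \<bar>ln (a k)\<bar> / I1)"
      unfolding abs_ln(1)[OF R] check_def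
      by (rule asymptotically_optimal_1(1)[OF R c]) (use lev in auto)
    show "(\<lambda>k. L1 (a k) (b k)) \<sim>[sequentially] (\<lambda>k. \<bar>ln (a k)\<bar> / I1)"
      unfolding abs_ln(1)[OF R] L1_def
      by (rule asymptotically_optimal_1(2)[OF R t]) (use lev in auto)
  qed
  have part2: "(\<lambda>k. ESS P0 (hat (a k) (b k))) \<sim>[sequentially] (\<lambda>k. \<bar>ln (b k)\<bar> / I0)"
    "(\<lambda>k. L0 (a k) (b k)) \<sim>[sequentially] (\<lambda>k. \<bar>ln (b k)\<bar> / I0)"
    if R: "regime a b" and r: "0 < r"
      and le: "asymp_le (\<lambda>k. \<bar>ln (a k)\<bar>) (\<lambda>k. \<bar>ln (b k)\<bar> / (b k) powr r)" for a b r
  proof -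
    note lev = regimeD(1)[OF R]
    \<comment> \<open>The exponent of the inner level: it has to compensate the growth \<open>b powr (- r)\<close> of \<open>\<bar>ln a\<bar>\<close> with
      something left to spare.\<close>
    have s: "0 < r + 1" using r by simp
    note h = hat_test_asymptotics(1,4)[OF R selected(2)]
    note h = h(1) h(2)[OF _ _ _ _ _ s correction_powr_regime[OF R r le]]
    show "(\<lambda>k. ESS P0 (hat (a k) (b k))) \<sim>[sequentially] (\<lambda>k. \<bar>ln (b k)\<bar> / I0)"
      unfolding abs_ln(2)[OF R] hat_def
      by (rule asymptotically_optimal_0(1)[OF R h]) (use lev in auto)
    show "(\<lambda>k. L0 (a k) (b k)) \<sim>[sequentially] (\<lambda>k. \<bar>ln (b k)\<bar> / I0)"
      unfolding abs_ln(2)[OF R] L0_def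
      by (rule asymptotically_optimal_0(2)[OF R h]) (use lev in auto)
  qed
  have part3: "(\<lambda>k. ESS P0 (tilde (a k) (b k))) \<sim>[sequentially] (\<lambda>k. \<bar>ln (b k)\<bar> / I0)"
    "(\<lambda>k. ESS P0 (check (a k) (b k))) \<sim>[sequentially] (\<lambda>k. \<bar>ln (b k)\<bar> / I0)"
    "(\<lambda>k. L0 (a k) (b k)) \<sim>[sequentially] (\<lambda>k. \<bar>ln (b k)\<bar> / I0)"
    if R: "regime a b" and le: "asymp_le (\<lambda>k. \<bar>ln (a k)\<bar>) (\<lambda>k. \<bar>ln (b k)\<bar> powr r)" for a b r
  proof -
    note lev = regimeD(1)[OF R]
    note rel = correction_polylog_regime[OF R _ le]
    note t = tilde_test_asymptotics(1)[OF R selected(1)] tilde_test_asymptotics(4)[OF R selected(1) _ rel]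
    note c = check_test_asymptotics(1)[OF R selected(3)] check_test_asymptotics(4)[OF R selected(3) _ rel]
    show "(\<lambda>k. ESS P0 (tilde (a k) (b k))) \<sim>[sequentially] (\<lambda>k. \<bar>ln (b k)\<bar> / I0)"
      unfolding abs_ln(2)[OF R] tilde_def
      by (rule asymptotically_optimal_0(1)[OF R t]) (use lev in auto)
    show "(\<lambda>k. ESS P0 (check (a k) (b k))) \<sim>[sequentially] (\<lambda>k. \<bar>ln (b k)\<bar> / I0)"
      unfolding abs_ln(2)[OF R] check_def
      by (rule asymptotically_optimal_0(1)[OF R c]) (use lev in auto)
    show "(\<lambda>k. L0 (a k) (b k)) \<sim>[sequentially] (\<lambda>k. \<bar>ln (b k)\<bar> / I0)"
      unfolding abs_ln(2)[OF R] L0_def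
      by (rule asymptotically_optimal_0(2)[OF R t]) (use lev in auto)
  qed
  have equiv: "f \<sim>[sequentially] g" if "f \<sim>[sequentially] h" "g \<sim>[sequentially] h" for f g h :: "nat \<Rightarrow> real"
    by (rule asymp_equiv_trans[OF that(1) asymp_equiv_symI[OF that(2)]])
  show ?thesis
  proof ((intro conjI; intro allI impI), goal_cases)
    case (1 a b)
    note p = part1[OF 1]
    show ?case
      by (intro conjI equiv[OF p(1,2)] equiv[OF p(2,3)] p(3) asymp_equiv_symI[OF p(4)])
  next
    case (2 a b r)
    then have "regime a b" "0 < r" "asymp_le (\<lambda>k. \<bar>ln (a k)\<bar>) (\<lambda>k. \<bar>ln (b k)\<bar> / (b k) powr r)"
      by auto
    note p = part2[OF this]
    show ?case by (intro conjI p(1) asymp_equiv_symI[OF p(2)])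
  next
    case (3 a b r)
    then have "regime a b" "asymp_le (\<lambda>k. \<bar>ln (a k)\<bar>) (\<lambda>k. \<bar>ln (b k)\<bar> powr r)"
      by auto
    note p = part3[OF this]
    show ?case
      by (intro conjI equiv[OF p(1,2)] p(2) asymp_equiv_symI[OF p(3)])
  qed
qed

end
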